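(* Let $P\subset\mathbb{R}^n$ be a full-dimensional polytope. The set $\mathsf{W}^{\pm}(P)$ of reversible small perturbations of $P$ is given by $$\mathsf{W}^{\pm}(P)=\sum_{F\in\Phi_{n-1}(P)}\big[\mathsf{M}^{\mathrm{cvx}}_1(F)\cap -\mathsf{M}^{\mathrm{cvx}}_1(F)\big],$$ where $\Phi_{n-1}(P)$ is the set of facets of $P$. This set is a vector space of dimension $\#\Phi_{n-1}(P)\cdot n$.
   Context: A convex body is a non-empty compact convex subset of $\mathbb{R}^n$; a polytope is the convex hull of a finite set. A signed measure is a finite signed Borel measure on $\mathbb{R}^n$. For a Borel set $X\subset\mathbb{R}^n$, $\mathsf{M}(X)$ is the vector space of signed measures supported on $X$, i.e. with $\mu(B)=0$ for all Borel $B\subset\mathbb{R}^n\setminus X$. A family $(K_t)_{t\in[0,1]}$ of full-dimensional convex bodies is weakly differentiable if for every continuous $f:\mathbb{R}^n\to\mathbb{R}$ the function $\phi_f(t)=\int_{K_t}f(x)\,dx$ is differentiable from the right at $t=0$; its weak derivative is the linear map $K_0':f\mapsto \frac{d}{dt}\phi_f(t)|_{t=0}$ on $C(\mathbb{R}^n)$. A signed measure $\mu\in\mathsf{M}(\mathrm{bd}\,K)$ is a small perturbation of a full-dimensional convex body $K$ if there is a weakly differentiable family $(K_t)_{t\in[0,1]}$ with $K_0=K$ and $K_0'(f)=\int_{\mathrm{bd}\,K}f\,d\mu$ for all $f\in C(\mathbb{R}^n)$. It is reversible if $-\mu$ is also a small perturbation of $K$. $\mathsf{W}^\pm(K)$ denotes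 the set of reversible small perturbations of $K$. For a polytope $F$, $\mathsf{M}^{\mathrm{cvx}}_1(F)$ is the set of all signed measures that are absolutely continuous with respect to the $(\dim F)$-dimensional volume on $F$ (counting measure if $\dim F=0$) with a convex density $f:\mathrm{relint}\,F\to\mathbb{R}$, and $-\mathsf{M}^{\mathrm{cvx}}_1(F)=\{-\mu\mid\mu\in\mathsf{M}^{\mathrm{cvx}}_1(F)\}$. *)

theory Defs
  imports "HOL-Analysis.Analysis" "HOL-Library.Set_Algebras"
begin

text \<open>A finite signed Borel measure is a countably additive real-valued set function on the Borel
  sets.  The value off the Borel sets is fixed to be 0, so that equality of signed measures is
  equality on Borel sets.\<close>

typedef (overloaded) 'a signed_measure =
  "{\<mu> :: 'a::topological_space set \<Rightarrow> real.
      \<mu> {} = 0 \<and>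
      (\<forall>A :: nat \<Rightarrow> 'a set. range A \<subseteq> sets borel \<longrightarrow> disjoint_family A \<longrightarrow>
          (\<lambda>i. \<mu> (A i)) sums \<mu> (\<Union>i. A i)) \<and>
      (\<forall>B. B \<notin> sets borel \<longrightarrow> \<mu> B = 0)}"
  morphisms sm_apply Abs_signed_measure
  by (rule exI[of _ "\<lambda>_. 0"]) simp

setup_lifting type_definition_signed_measure

instantiation signed_measure :: (topological_space) real_vector
begin

lift_definition zero_signed_measure :: "'a signed_measure" is "\<lambda>_. 0"
  by simp

lift_definition plus_signed_measure ::
    "'a signed_measure \<Rightarrow> 'a signed_measure \<Rightarrow> 'a signed_measure"
  is "\<lambda>\<mu> \<nu> B. \<mu> B + \<nu> B"
  by (auto intro!: sums_add)

lift_definition uminus_signed_measure :: "'a signed_measure \<Rightarrow> 'a signed_measure"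
  is "\<lambda>\<mu> B. - \<mu> B"
  by (auto intro!: sums_minus)

lift_definition minus_signed_measure ::
    "'a signed_measure \<Rightarrow> 'a signed_measure \<Rightarrow> 'a signed_measure"
  is "\<lambda>\<mu> \<nu> B. \<mu> B - \<nu> B"
  by (auto intro!: sums_diff)

lift_definition scaleR_signed_measure :: "real \<Rightarrow> 'a signed_measure \<Rightarrow> 'a signed_measure"
  is "\<lambda>c \<mu> B. c * \<mu> B"
  by (auto intro!: sums_mult)

instance
  by standard (transfer, simp add: fun_eq_iff algebra_simps)+

end

definition supported_on :: "'a::topological_space signed_measure \<Rightarrow> 'a set \<Rightarrow> bool" where
  "supported_on \<mu> X \<longleftrightarrow> (\<forall>B \<in> sets borel. B \<subseteq> - X \<longrightarrow> sm_apply \<mu> B = 0)"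

text \<open>The positive part of the Jordan decomposition: its value at a Borel set \<open>A\<close> is the supremum of
  \<open>\<mu> B\<close> over Borel \<open>B \<subseteq> A\<close>.  This supremum is nonnegative because of \<open>B = {}\<close>, so nothing is lost
  by \<^const>\<open>ennreal\<close> truncating negative values.  The negative part of \<open>\<mu>\<close> is the positive part of
  \<open>- \<mu>\<close>.\<close>

definition positive_variation :: "'a::topological_space signed_measure \<Rightarrow> 'a measure" where
  "positive_variation \<mu> =
     measure_of UNIV (sets borel) (\<lambda>A. SUP B \<in> {B \<in> sets borel. B \<subseteq> A}. ennreal (sm_apply \<mu> B))"

definition signed_set_integral ::
    "'a::topological_space signed_measure \<Rightarrow> 'a set \<Rightarrow> ('a \<Rightarrow> real) \<Rightarrow> real" where
  "signed_set_integral \<mu> X f =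
     (LINT x:X|positive_variation \<mu>. f x) - (LINT x:X|positive_variation (- \<mu>). f x)"

definition full_dimensional :: "'a::euclidean_space set \<Rightarrow> bool" where
  "full_dimensional S \<longleftrightarrow> aff_dim S = int DIM('a)"

definition convex_body :: "'a::euclidean_space set \<Rightarrow> bool" where
  "convex_body K \<longleftrightarrow> K \<noteq> {} \<and> compact K \<and> convex K"

text \<open>Families are total functions on the reals; only the parameters in \<open>[0, 1]\<close> matter.\<close>

definition weakly_differentiable :: "(real \<Rightarrow> 'a::euclidean_space set) \<Rightarrow> bool" where
  "weakly_differentiable K \<longleftrightarrow>
     (\<forall>t \<in> {0..1}. convex_body (K t) \<and> full_dimensional (K t)) \<and>
     (\<forall>f :: 'a \<Rightarrow> real. continuous_on UNIV f \<longrightarrow>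
        (\<lambda>t. LINT x:K t|lborel. f x) differentiable (at_right 0))"

definition weak_derivative :: "(real \<Rightarrow> 'a::euclidean_space set) \<Rightarrow> ('a \<Rightarrow> real) \<Rightarrow> real" where
  "weak_derivative K f = vector_derivative (\<lambda>t. LINT x:K t|lborel. f x) (at_right 0)"

definition small_perturbation :: "'a::euclidean_space set \<Rightarrow> 'a signed_measure \<Rightarrow> bool" where
  "small_perturbation K \<mu> \<longleftrightarrow>
     supported_on \<mu> (frontier K) \<and>
     (\<exists>Kt. weakly_differentiable Kt \<and> Kt 0 = K \<and>
        (\<forall>f. continuous_on UNIV f \<longrightarrow>
           weak_derivative Kt f = signed_set_integral \<mu> (frontier K) f))"

definition reversible_small_perturbations ::
    "'a::euclidean_space set \<Rightarrow> 'a signed_measure set" where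
  "reversible_small_perturbations K = {\<mu>. small_perturbation K \<mu> \<and> small_perturbation K (- \<mu>)}"

text \<open>The volume of dimension \<open>aff_dim A\<close> on the affine hull of a non-empty set \<open>A\<close>, viewed as a
  Borel measure on the whole space: the image of the product Lebesgue measure under an isometric
  parametrization by orthonormal coordinates.  It does not depend on the chosen origin and
  orthonormal basis.  If \<open>A\<close> is a single point, then the basis is empty and this is the Dirac
  (hence counting) measure at that point.\<close>

definition affine_volume :: "'a::euclidean_space set \<Rightarrow> 'a measure" where
  "affine_volume A =
     (let p = (SOME p. p \<in> A);
          B = (SOME B. pairwise orthogonal B \<and> (\<forall>b\<in>B. norm b = 1) \<and>
                       span B = span {x - y |x y. x \<in> A \<and> y \<in> A})
      in distr (\<Pi>\<^sub>M b\<in>B. lborel) borel (\<lambda>c. p + (\<Sum>b\<in>B. c b *\<^sub>R b)))"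

text \<open>Since signed measures are finite, the density has to be integrable.\<close>

definition convex_density_measures :: "'a::euclidean_space set \<Rightarrow> 'a signed_measure set" where
  "convex_density_measures F =
     {\<mu>. \<exists>f :: 'a \<Rightarrow> real.
        convex_on (rel_interior F) f \<and>
        set_integrable (affine_volume F) (rel_interior F) f \<and>
        (\<forall>A \<in> sets borel. sm_apply \<mu> A = (LINT x:A \<inter> rel_interior F|affine_volume F. f x))}"

end

theory Submission
  imports Defs
begin

text \<open>
  Suppose that each facet inequality \<open>u i \<bullet> x \<le> c i\<close> of the polytope is replaced by
  \<open>u i \<bullet> x \<le> c i + t * h i x\<close> with an affine function \<open>h i\<close>. The result is again a polytope, and
  it moves the points of the facet of \<open>i\<close> outwards by about \<open>t * h i x\<close>, so that the weak derivative at
  \<open>t = 0\<close> has the density \<open>h i\<close> on that facet (\<open>first_variation\<close>). As \<open>- h i\<close> is affine as well, all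
  sums of measures with affine densities on the facets are reversible small perturbations.

  Conversely, let \<open>\<mu>\<close> and \<open>- \<mu>\<close> both be small perturbations. Over the relative interior of a facet
  the surface of a convex body close to \<open>P\<close> is the graph of a concave function, its height above the
  hyperplane of the facet, and \<open>\<mu>\<close> is there the limit of these heights divided by \<open>t\<close>
  (\<open>height_limit\<close>). So a function on the facet whose integral against every concave function is at
  most 0 also has an integral of at most 0 against \<open>\<mu>\<close> and \<open>- \<mu>\<close>, hence integral 0. There are
  enough such functions to force an affine density (\<open>reversible_affine_density\<close>): a concave function
  is bounded below by interpolation between points surrounding the argument, and averages of it by symmetric weights
  are bounded above by its value at the centre. Convexity of the bodies also keeps them within distance of order
  \<open>t\<close> from \<open>P\<close>, so that \<open>\<mu>\<close> and \<open>- \<mu>\<close> are bounded by a multiple of the surface measure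
  (\<open>perturbs_le_surface\<close>). Hence \<open>\<mu>\<close> has no mass on the faces of lower dimension, and its densities on
  the facets determine it (\<open>reversible_density\<close>).

  A density that is convex and whose negative is convex as well is affine
  (\<open>convex_density_measures_reversible\<close>). With an interior point \<open>x0\<close> of \<open>P\<close>, the affine functions on
  the hyperplane of a facet are the functions \<open>x \<mapsto> a \<bullet> (x - x0)\<close> for a unique vector \<open>a\<close>. Each facet
  therefore contributes \<open>n\<close> dimensions, and the contributions are independent because the relative
  interiors of the facets are disjoint.
\<close>


section \<open>Jordan decomposition and integration of signed measures\<close>

lemma sm_empty [simp]: "sm_apply \<mu> {} = 0"
  using sm_apply[of \<mu>] by simp

lemma sm_sums:
  "range A \<subseteq> sets borel \<Longrightarrow> disjoint_family A \<Longrightarrow> (\<lambda>i. sm_apply \<mu> (A i)) sums sm_apply \<mu> (\<Union>i. A i)"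
  using sm_apply[of \<mu>] by simp

lemma sm_nonborel: "B \<notin> sets borel \<Longrightarrow> sm_apply \<mu> B = 0"
  using sm_apply[of \<mu>] by simp

lemma sm_eqI: "(\<And>B. B \<in> sets borel \<Longrightarrow> sm_apply \<mu> B = sm_apply \<nu> B) \<Longrightarrow> \<mu> = \<nu>"
  by (metis sm_apply_inject sm_nonborel ext)

lemma sm_zero [simp]: "sm_apply 0 B = 0"
  by transfer simp

lemma sm_plus [simp]: "sm_apply (\<mu> + \<nu>) B = sm_apply \<mu> B + sm_apply \<nu> B"
  by transfer simp

lemma sm_uminus [simp]: "sm_apply (- \<mu>) B = - sm_apply \<mu> B"
  by transfer simp

lemma sm_minus [simp]: "sm_apply (\<mu> - \<nu>) B = sm_apply \<mu> B - sm_apply \<nu> B"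
  by transfer simp

lemma sm_scaleR [simp]: "sm_apply (c *\<^sub>R \<mu>) B = c * sm_apply \<mu> B"
  by transfer simp

lemma sm_sum [simp]: "sm_apply (\<Sum>i\<in>I. \<mu> i) B = (\<Sum>i\<in>I. sm_apply (\<mu> i) B)"
  by (induction I rule: infinite_finite_induct) auto

lemma sm_Un:
  assumes [measurable]: "A \<in> sets borel" "B \<in> sets borel" and d: "A \<inter> B = {}"
  shows "sm_apply \<mu> (A \<union> B) = sm_apply \<mu> A + sm_apply \<mu> B"
proof -
  have "(\<lambda>n. sm_apply \<mu> (binaryset A B n)) sums (sm_apply \<mu> A + sm_apply \<mu> B)"
    by (rule binaryset_sums) simp
  moreover have "(\<lambda>n. sm_apply \<mu> (binaryset A B n)) sums sm_apply \<mu> (\<Union>i. binaryset A B i)"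
    using d by (intro sm_sums) (auto simp: binaryset_def disjoint_family_on_def)
  ultimately show ?thesis
    by (metis sums_unique2 UN_binaryset_eq)
qed

lemma sm_Int_Diff:
  assumes "A \<in> sets borel" "H \<in> sets borel"
  shows "sm_apply \<mu> A = sm_apply \<mu> (A \<inter> H) + sm_apply \<mu> (A - H)"
  using sm_Un[of "A \<inter> H" "A - H" \<mu>] assms by (simp add: Int_Diff_disjoint Int_Diff_Un sets.Int sets.Diff)

text \<open>Half of a Hahn decomposition: a set on which \<open>\<mu>\<close> has no negative part. The other half is
  a positive set of \<open>- \<mu>\<close>.\<close>

definition positive_for :: "'a::topological_space signed_measure \<Rightarrow> 'a set \<Rightarrow> bool" where
  "positive_for \<mu> B \<longleftrightarrow> B \<in> sets borel \<and> (\<forall>C \<in> sets borel. C \<subseteq> B \<longrightarrow> 0 \<le> sm_apply \<mu> C)"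

lemma positive_for_mono:
  assumes "positive_for \<mu> B" "C \<in> sets borel" "C \<subseteq> B"
  shows "sm_apply \<mu> C \<le> sm_apply \<mu> B"
proof -
  have [measurable]: "B \<in> sets borel" "C \<in> sets borel"
    using assms by (auto simp: positive_for_def)
  have "sm_apply \<mu> B = sm_apply \<mu> (B \<inter> C) + sm_apply \<mu> (B - C)"
    by (rule sm_Int_Diff) auto
  moreover have "0 \<le> sm_apply \<mu> (B - C)"
    using assms by (auto simp: positive_for_def)
  ultimately show ?thesis
    using assms(3) by (simp add: Int_absorb1)
qed

lemma positive_for_UN:
  fixes B :: "nat \<Rightarrow> 'a::topological_space set"
  assumes "\<And>n. positive_for \<mu> (B n)"
  shows "positive_for \<mu> (\<Union>n. B n)"
  unfolding positive_for_def
proof (intro conjI ballI impI)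
  have m[measurable]: "B n \<in> sets borel" for n
    using assms by (auto simp: positive_for_def)
  then show "(\<Union>n. B n) \<in> sets borel" by auto
  fix C :: "'a set" assume C[measurable]: "C \<in> sets borel" and CB: "C \<subseteq> (\<Union>n. B n)"
  define D where "D = (\<lambda>n. C \<inter> disjointed B n)"
  have dm: "disjointed B n \<in> sets borel" for n
    using sets.range_disjointed_sets[of B borel] m by (simp add: image_subset_iff)
  then have D: "D n \<in> sets borel" for n
    by (auto simp: D_def)
  have "(\<lambda>n. sm_apply \<mu> (D n)) sums sm_apply \<mu> (\<Union>n. D n)"
    using D disjoint_family_disjointed[of B]
    by (intro sm_sums) (auto simp: D_def disjoint_family_on_def)
  moreover have "(\<Union>n. D n) = C"
    using CB UN_disjointed_eq[of B] by (auto simp: D_def)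
  moreover have "0 \<le> sm_apply \<mu> (D n)" for n
    using assms[of n] D[of n] disjointed_subset[of B n] by (auto simp: positive_for_def D_def)
  ultimately show "0 \<le> sm_apply \<mu> C"
    by (metis (no_types, lifting) sums_le sums_zero)
qed

text \<open>Repeatedly removing from \<open>A\<close> a set whose measure is at most half of the least possible
  one, truncated at \<open>- 1\<close>, leaves a positive set: the removed measures are summable, so they tend
  to 0.\<close>

lemma exists_positive_subset:
  assumes A: "A \<in> sets borel"
  obtains B where "positive_for \<mu> B" "B \<subseteq> A" "sm_apply \<mu> A \<le> sm_apply \<mu> B"
proof -
  define pick where "pick E C \<longleftrightarrow> C \<in> sets borel \<and> C \<subseteq> E \<and> sm_apply \<mu> C \<le> 0 \<and>
     (\<forall>D\<in>sets borel. D \<subseteq> E \<longrightarrow> 2 * max (sm_apply \<mu> C) (-1) \<le> max (sm_apply \<mu> D) (-1))" for E C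
  have ex: "\<exists>C. pick E C" for E
  proof -
    define m where "m = Inf ((\<lambda>D. max (sm_apply \<mu> D) (-1)) ` {D \<in> sets borel. D \<subseteq> E})"
    have bb: "bdd_below ((\<lambda>D. max (sm_apply \<mu> D) (-1)) ` {D \<in> sets borel. D \<subseteq> E})"
      by (rule bdd_belowI[of _ "-1"]) auto
    have le: "m \<le> max (sm_apply \<mu> D) (-1)" if "D \<in> sets borel" "D \<subseteq> E" for D
      unfolding m_def using that bb by (intro cInf_lower) auto
    have "m \<le> 0"
      using le[of "{}"] by simp
    show ?thesis
    proof (cases "m = 0")
      case True
      then have "pick E {}"
        using le by (auto simp: pick_def)
      then show ?thesis by blast
    next
      case False
      then have "m < m / 2"
        using \<open>m \<le> 0\<close> by simp
      then have "\<exists>x\<in>(\<lambda>D. max (sm_apply \<mu> D) (-1)) ` {D \<in> sets borel. D \<subseteq> E}. x < m / 2"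
        using bb unfolding m_def by (subst (asm) (1) cInf_less_iff) auto
      then obtain C where C: "C \<in> sets borel" "C \<subseteq> E" "max (sm_apply \<mu> C) (-1) < m / 2"
        by auto
      have "pick E C"
        unfolding pick_def
      proof (intro conjI ballI impI)
        fix D assume "D \<in> sets borel" "D \<subseteq> E"
        from le[OF this] C(3) show "2 * max (sm_apply \<mu> C) (-1) \<le> max (sm_apply \<mu> D) (-1)"
          by linarith
      qed (use C \<open>m \<le> 0\<close> in \<open>auto\<close>)
      then show ?thesis by blast
    qed
  qed
  define c where "c E = (SOME C. pick E C)" for E
  have c: "pick E (c E)" for E
    unfolding c_def using ex[of E] by (rule someI_ex)
  define E where "E = rec_nat A (\<lambda>_ E. E - c E)"
  have E0: "E 0 = A" and ES: "E (Suc n) = E n - c (E n)" for n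
    by (simp_all add: E_def)
  have cm: "c (E n) \<in> sets borel" "c (E n) \<subseteq> E n" "sm_apply \<mu> (c (E n)) \<le> 0" for n
    using c[of "E n"] by (auto simp: pick_def)
  have Em: "E n \<in> sets borel" for n
    by (induction n) (auto simp: E0 ES A cm)
  have dec: "E n \<subseteq> E m" if "m \<le> n" for m n
    using that by (induction rule: dec_induct) (auto simp: ES)
  have disj: "c (E m) \<inter> c (E n) = {}" if "m < n" for m n
  proof -
    have "E n \<subseteq> E (Suc m)"
      using that by (intro dec) auto
    then show ?thesis
      using cm(2)[of n] by (auto simp: ES)
  qed
  have disj': "disjoint_family (\<lambda>n. c (E n))"
    unfolding disjoint_family_on_def
    by (metis disj inf_commute linorder_neqE_nat)
  define B where "B = A - (\<Union>n. c (E n))"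
  have BE: "B \<subseteq> E n" for n
    by (induction n) (auto simp: B_def E0 ES)
  have s: "(\<lambda>n. sm_apply \<mu> (c (E n))) sums sm_apply \<mu> (\<Union>n. c (E n))"
    using cm disj' by (intro sm_sums) auto
  then have to0: "(\<lambda>n. sm_apply \<mu> (c (E n))) \<longlonglongrightarrow> 0"
    by (meson sums_summable summable_LIMSEQ_zero)
  have Bm: "B \<in> sets borel"
    unfolding B_def using A cm by auto
  have "positive_for \<mu> B"
    unfolding positive_for_def
  proof (intro conjI ballI impI)
    fix D :: "'a set" assume D: "D \<in> sets borel" "D \<subseteq> B"
    have "2 * max (sm_apply \<mu> (c (E n))) (-1) \<le> max (sm_apply \<mu> D) (-1)" for n
      using c[of "E n"] D BE[of n] by (auto simp: pick_def)
    moreover have lim: "(\<lambda>n. 2 * max (sm_apply \<mu> (c (E n))) (-1)) \<longlonglongrightarrow> 2 * max 0 (-1)"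
      by (intro tendsto_intros to0)
    ultimately have "2 * max 0 (-1) \<le> max (sm_apply \<mu> D) (-1)"
      by (intro LIMSEQ_le_const2[OF lim]) blast
    then show "0 \<le> sm_apply \<mu> D" by auto
  qed (rule Bm)
  moreover have "sm_apply \<mu> (\<Union>n. c (E n)) \<le> 0"
    using sums_le[OF _ s sums_zero] cm(3) by auto
  then have "sm_apply \<mu> A \<le> sm_apply \<mu> B"
  proof -
    have "(\<Union>n. c (E n)) \<subseteq> A"
      using cm(2) dec[of 0] by (fastforce simp: E0)
    then have "A \<inter> (\<Union>n. c (E n)) = (\<Union>n. c (E n))" by auto
    moreover have "(\<Union>n. c (E n)) \<in> sets borel"
      using cm by auto
    ultimately show ?thesis
      using sm_Int_Diff[OF A, of "\<Union>n. c (E n)" \<mu>] \<open>sm_apply \<mu> (\<Union>n. c (E n)) \<le> 0\<close>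
      by (simp add: B_def)
  qed
  ultimately show ?thesis
    using that[of B] by (auto simp: B_def)
qed

text \<open>A positive set of largest measure exists because positive sets are closed under countable
  unions. A set of positive measure in its complement would contain a positive set, with which
  it could be enlarged.\<close>

lemma hahn_decomposition:
  obtains H where "positive_for \<mu> H" "positive_for (- \<mu>) (- H)"
proof -
  let ?S = "sm_apply \<mu> ` {B. positive_for \<mu> B}"
  have e: "positive_for \<mu> {}" by (auto simp: positive_for_def)
  have bdd: "bdd_above ?S"
  proof (rule ccontr)
    assume "\<not> bdd_above ?S"
    then have "\<forall>n::nat. \<exists>B. positive_for \<mu> B \<and> real n < sm_apply \<mu> B"
      by (force simp: bdd_above_def not_le)
    then obtain B where B: "\<And>n::nat. positive_for \<mu> (B n)" "\<And>n. real n < sm_apply \<mu> (B n)"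
      by metis
    have "real n < sm_apply \<mu> (\<Union>n. B n)" for n
      using B(2)[of n] positive_for_mono[OF positive_for_UN[of \<mu> B], of "B n"] B(1)
      by (force simp: positive_for_def)
    then show False
      by (meson less_asym reals_Archimedean2)
  qed
  have "\<exists>B. positive_for \<mu> B \<and> Sup ?S - 1 / real (Suc n) < sm_apply \<mu> B" for n
  proof -
    have "Sup ?S - 1 / real (Suc n) < Sup ?S" by simp
    then show ?thesis
      using less_cSup_iff[of ?S "Sup ?S - 1 / real (Suc n)"] bdd e by blast
  qed
  then obtain B where B: "\<And>n::nat. positive_for \<mu> (B n)"
      "\<And>n. Sup ?S - 1 / real (Suc n) < sm_apply \<mu> (B n)"
    by metis
  define H where "H = (\<Union>n. B n)"
  have H: "positive_for \<mu> H"
    unfolding H_def using B(1) by (rule positive_for_UN)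
  have ge: "Sup ?S \<le> sm_apply \<mu> H"
  proof (rule LIMSEQ_le_const2)
    show "(\<lambda>n. Sup ?S - 1 / real (Suc n)) \<longlonglongrightarrow> Sup ?S"
      using tendsto_diff[OF tendsto_const[of "Sup ?S"] LIMSEQ_inverse_real_of_nat]
      by (simp add: divide_inverse)
    have "Sup ?S - 1 / real (Suc n) \<le> sm_apply \<mu> H" for n
      using B(2)[of n] positive_for_mono[OF H, of "B n"] B(1)[of n]
      by (force simp: positive_for_def H_def)
    then show "\<exists>N. \<forall>n\<ge>N. Sup ?S - 1 / real (Suc n) \<le> sm_apply \<mu> H" by blast
  qed
  have Hm: "H \<in> sets borel" using H by (auto simp: positive_for_def)
  have "positive_for (- \<mu>) (- H)"
    unfolding positive_for_def
  proof (intro conjI ballI impI)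
    show "- H \<in> sets borel" using Hm by (rule borel_comp)
    fix C :: "'a set" assume C: "C \<in> sets borel" "C \<subseteq> - H"
    show "0 \<le> sm_apply (- \<mu>) C"
    proof (rule ccontr)
      assume "\<not> ?thesis"
      then have pos: "0 < sm_apply \<mu> C" by simp
      obtain D where D: "positive_for \<mu> D" "D \<subseteq> C" "sm_apply \<mu> C \<le> sm_apply \<mu> D"
        using exists_positive_subset[OF C(1)] by blast
      have Dm: "D \<in> sets borel" using D by (auto simp: positive_for_def)
      have "positive_for \<mu> (\<Union>n::nat. if n = 0 then H else D)"
        using H D by (intro positive_for_UN) auto
      moreover have "(\<Union>n::nat. if n = 0 then H else D) = H \<union> D"
        by (auto split: if_splits)
      ultimately have "sm_apply \<mu> (H \<union> D) \<le> Sup ?S"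
        using bdd by (intro cSup_upper) auto
      moreover have "sm_apply \<mu> (H \<union> D) = sm_apply \<mu> H + sm_apply \<mu> D"
        using C D Hm Dm by (intro sm_Un) auto
      ultimately show False
        using ge pos D(3) by linarith
    qed
  qed
  with H show ?thesis by (rule that)
qed

lemma sets_positive_variation [simp, measurable_cong]:
  "sets (positive_variation (\<mu> :: 'a::topological_space signed_measure)) = sets borel"
  unfolding positive_variation_def
  using sets.sigma_sets_eq[of "borel :: 'a measure"] by (simp add: sets_measure_of)

lemma space_positive_variation [simp]: "space (positive_variation \<mu>) = UNIV"
  using sets_eq_imp_space_eq[OF sets_positive_variation] by simp

text \<open>The supremum defining the positive variation is attained at the part of \<open>A\<close> inside the
  positive half of a Hahn decomposition.\<close>

lemma emeasure_positive_variation: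
  fixes \<mu> :: "'a::topological_space signed_measure"
  assumes H: "positive_for \<mu> H" "positive_for (- \<mu>) (- H)" and A: "A \<in> sets borel"
  shows "emeasure (positive_variation \<mu>) A = ennreal (sm_apply \<mu> (A \<inter> H))"
proof -
  have Hm: "H \<in> sets borel" using H by (auto simp: positive_for_def)
  have sup: "(SUP B \<in> {B \<in> sets borel. B \<subseteq> A}. ennreal (sm_apply \<mu> B)) = ennreal (sm_apply \<mu> (A \<inter> H))"
    if A: "A \<in> sets borel" for A
  proof (rule antisym)
    show "(SUP B \<in> {B \<in> sets borel. B \<subseteq> A}. ennreal (sm_apply \<mu> B)) \<le> ennreal (sm_apply \<mu> (A \<inter> H))"
    proof (rule SUP_least)
      fix B :: "'a set" assume "B \<in> {B \<in> sets borel. B \<subseteq> A}"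
      then have B: "B \<in> sets borel" "B \<subseteq> A" by auto
      have "sm_apply \<mu> B = sm_apply \<mu> (B \<inter> H) + sm_apply \<mu> (B - H)"
        using B Hm by (intro sm_Int_Diff)
      moreover have "0 \<le> sm_apply (- \<mu>) (B - H)"
        using H(2) B Hm by (auto simp: positive_for_def)
      moreover have "sm_apply \<mu> (B \<inter> H) \<le> sm_apply \<mu> (A \<inter> H)"
      proof (rule positive_for_mono)
        show "positive_for \<mu> (A \<inter> H)"
          using H(1) A by (auto simp: positive_for_def)
      qed (use B Hm in auto)
      ultimately show "ennreal (sm_apply \<mu> B) \<le> ennreal (sm_apply \<mu> (A \<inter> H))"
        by (intro ennreal_leI) simp
    qed
    show "ennreal (sm_apply \<mu> (A \<inter> H)) \<le> (SUP B \<in> {B \<in> sets borel. B \<subseteq> A}. ennreal (sm_apply \<mu> B))"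
      using A Hm by (intro SUP_upper) auto
  qed
  show ?thesis
    unfolding positive_variation_def
  proof (subst emeasure_measure_of_sigma)
    show "sigma_algebra UNIV (sets (borel :: 'a measure))"
      by (metis sets.sigma_algebra_axioms space_borel)
    show "positive (sets borel) (\<lambda>A. SUP B \<in> {B \<in> sets borel. B \<subseteq> A}. ennreal (sm_apply \<mu> B))"
      by (simp add: positive_def sup)
    show "countably_additive (sets borel) (\<lambda>A. SUP B \<in> {B \<in> sets borel. B \<subseteq> A}. ennreal (sm_apply \<mu> B))"
      unfolding countably_additive_def
    proof (intro allI impI)
      fix F :: "nat \<Rightarrow> 'a set"
      assume F: "range F \<subseteq> sets borel" "disjoint_family F" "(\<Union>i. F i) \<in> sets borel"
      have nn: "0 \<le> sm_apply \<mu> (B \<inter> H)" if "B \<in> sets borel" for B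
        using H(1) Hm that unfolding positive_for_def by (metis inf_le2 sets.Int)
      have "(\<lambda>i. sm_apply \<mu> (F i \<inter> H)) sums sm_apply \<mu> (\<Union>i. F i \<inter> H)"
        using F Hm by (intro sm_sums) (auto simp: disjoint_family_on_def)
      then have "(\<lambda>i. sm_apply \<mu> (F i \<inter> H)) sums sm_apply \<mu> ((\<Union>i. F i) \<inter> H)"
        by simp
      then have "(\<lambda>i. ennreal (sm_apply \<mu> (F i \<inter> H))) sums ennreal (sm_apply \<mu> ((\<Union>i. F i) \<inter> H))"
        using nn F by (subst sums_ennreal) auto
      then have "(\<Sum>i. ennreal (sm_apply \<mu> (F i \<inter> H))) = ennreal (sm_apply \<mu> ((\<Union>i. F i) \<inter> H))"
        by (rule sums_unique[symmetric])
      moreover have "F i \<in> sets borel" for i using F(1) by auto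
      ultimately show "(\<Sum>i. SUP B \<in> {B \<in> sets borel. B \<subseteq> F i}. ennreal (sm_apply \<mu> B)) =
          (SUP B \<in> {B \<in> sets borel. B \<subseteq> (\<Union>i. F i)}. ennreal (sm_apply \<mu> B))"
        using F(3) by (simp add: sup)
    qed
  qed (use A sup in auto)
qed

lemma finite_measure_positive_variation: "finite_measure (positive_variation \<mu>)"
proof -
  obtain H where "positive_for \<mu> H" "positive_for (- \<mu>) (- H)"
    by (rule hahn_decomposition)
  then show ?thesis
    by (intro finite_measureI) (auto simp: emeasure_positive_variation)
qed

lemma jordan_decomposition:
  assumes B: "B \<in> sets borel"
  shows "sm_apply \<mu> B = measure (positive_variation \<mu>) B - measure (positive_variation (- \<mu>)) B"
proof -
  obtain H where H: "positive_for \<mu> H" "positive_for (- \<mu>) (- H)"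
    by (rule hahn_decomposition)
  then have H': "positive_for (- \<mu>) (- H)" "positive_for (- (- \<mu>)) (- (- H))" by auto
  have Hm: "H \<in> sets borel" using H by (auto simp: positive_for_def)
  have "measure (positive_variation \<mu>) B = sm_apply \<mu> (B \<inter> H)"
    using H(1) Hm B unfolding measure_def emeasure_positive_variation[OF H B]
    by (auto simp: positive_for_def)
  moreover have "measure (positive_variation (- \<mu>)) B = sm_apply (- \<mu>) (B \<inter> - H)"
  proof -
    have "0 \<le> sm_apply (- \<mu>) (B \<inter> - H)"
      using H(2) Hm B unfolding positive_for_def by (metis inf_le2 sets.Int)
    then show ?thesis
      unfolding measure_def emeasure_positive_variation[OF H' B] by (rule enn2real_ennreal)
  qed
  ultimately show ?thesis
    using sm_Int_Diff[OF B Hm, of \<mu>] by (simp add: Diff_eq)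
qed

lemma integrable_bounded_borel:
  fixes f :: "'a::topological_space \<Rightarrow> real"
  assumes "finite_measure N" and s: "sets N = sets borel" and f: "f \<in> borel_measurable borel"
    and bd: "\<And>x. \<bar>f x\<bar> \<le> b"
  shows "integrable N f"
proof (rule finite_measure.integrable_const_bound[OF assms(1), of _ b])
  show "AE x in N. norm (f x) \<le> b" using bd by simp
  show "f \<in> borel_measurable N" using f measurable_cong_sets[OF s refl] by blast
qed

text \<open>A linear relation between finite measures extends from sets to bounded functions.  The
  additivity of the integral against a signed measure, and its independence of the
  representation, come from this, since \<^const>\<open>signed_set_integral\<close> is such a combination.\<close>

lemma linear_relation_of_integrals:
  fixes M :: "'i \<Rightarrow> 'a::topological_space measure" and c :: "'i \<Rightarrow> real"
  assumes I: "finite I"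
    and fin: "\<And>i. i \<in> I \<Longrightarrow> finite_measure (M i)" and s: "\<And>i. i \<in> I \<Longrightarrow> sets (M i) = sets borel"
    and rel: "\<And>B. B \<in> sets borel \<Longrightarrow> (\<Sum>i\<in>I. c i * measure (M i) B) = 0"
    and f: "f \<in> borel_measurable borel" and bd: "\<And>x. \<bar>f x\<bar> \<le> b"
  shows "(\<Sum>i\<in>I. c i * (\<integral>x. f x \<partial>M i)) = 0"
proof -
  have mb: "g \<in> borel_measurable (M i)" if "i \<in> I" "g \<in> borel_measurable borel" for i and g :: "'a \<Rightarrow> real"
    using that s by (simp cong: measurable_cong_sets)
  have nn: "\<forall>b. (\<forall>x. u x \<le> b) \<longrightarrow> (\<Sum>i\<in>I. c i * (\<integral>x. u x \<partial>M i)) = 0"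
    if "u \<in> borel_measurable borel" "\<And>x. 0 \<le> u x" for u :: "'a \<Rightarrow> real"
    using that
  proof (induction u rule: borel_measurable_induct_real)
    case (set A)
    have "(\<integral>x. indicator A x \<partial>M i) = measure (M i) A" if "i \<in> I" for i
      using set s[OF that] sets_eq_imp_space_eq[OF s[OF that]] by simp
    then show ?case using rel[OF set] by simp
  next
    case (mult u k)
    show ?case
    proof (intro allI impI)
      fix b assume b: "\<forall>x. k * u x \<le> b"
      show "(\<Sum>i\<in>I. c i * (\<integral>x. k * u x \<partial>M i)) = 0"
      proof (cases "k = 0")
        case False
        then have "\<forall>x. u x \<le> b / k"
          using b mult by (auto simp: field_simps)
        then have "(\<Sum>i\<in>I. c i * (\<integral>x. u x \<partial>M i)) = 0" using mult by blast
        then have "k * (\<Sum>i\<in>I. c i * (\<integral>x. u x \<partial>M i)) = 0" by simp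
        then show ?thesis
          by (simp add: sum_distrib_left mult.left_commute)
      qed simp
    qed
  next
    case (add u v)
    show ?case
    proof (intro allI impI)
      fix b assume b: "\<forall>x. v x + u x \<le> b"
      then have b': "u x \<le> b \<and> v x \<le> b" for x
        using add.hyps(2)[of x] add.hyps(4)[of x] b[rule_format, of x] by linarith
      have "integrable (M i) u" if "i \<in> I" for i
        by (rule integrable_bounded_borel[OF fin[OF that] s[OF that], of _ b])
          (use add.hyps b' in \<open>auto\<close>)
      moreover have "integrable (M i) v" if "i \<in> I" for i
        by (rule integrable_bounded_borel[OF fin[OF that] s[OF that], of _ b])
          (use add.hyps b' in \<open>auto\<close>)
      ultimately have "(\<Sum>i\<in>I. c i * (\<integral>x. v x + u x \<partial>M i)) =
          (\<Sum>i\<in>I. c i * (\<integral>x. v x \<partial>M i)) + (\<Sum>i\<in>I. c i * (\<integral>x. u x \<partial>M i))"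
        by (simp add: sum.distrib algebra_simps)
      then show "(\<Sum>i\<in>I. c i * (\<integral>x. v x + u x \<partial>M i)) = 0"
        using add.IH(1)[THEN spec[of _ b], THEN mp] add.IH(2)[THEN spec[of _ b], THEN mp] b' by simp
    qed
  next
    case (seq U)
    show ?case
    proof (intro allI impI)
      fix b assume b: "\<forall>x. u x \<le> b"
      have Ub: "U n x \<le> b" for n x
      proof -
        have "U n x \<le> u x"
          by (rule incseq_le[of "\<lambda>n. U n x"]) (use seq in \<open>auto simp: incseq_def le_fun_def\<close>)
        then show ?thesis using b by (meson order_trans)
      qed
      have "(\<lambda>n. (\<integral>x. U n x \<partial>M i)) \<longlonglongrightarrow> (\<integral>x. u x \<partial>M i)" if "i \<in> I" for i
      proof (rule integral_dominated_convergence)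
        show "integrable (M i) (\<lambda>_. b)"
          by (rule finite_measure.integrable_const[OF fin[OF that]])
        show "AE x in M i. (\<lambda>n. U n x) \<longlonglongrightarrow> u x" using seq by simp
        show "AE x in M i. norm (U n x) \<le> b" for n using Ub seq by simp
        show "u \<in> borel_measurable (M i)"
        proof -
          have "u \<in> borel_measurable borel"
            by (rule borel_measurable_LIMSEQ_real[of _ U, OF seq.hyps(4) seq.hyps(1)]) auto
          then show ?thesis using mb[OF that] by blast
        qed
        show "U n \<in> borel_measurable (M i)" for n
          using mb[OF that seq.hyps(1)] .
      qed
      then have "(\<lambda>n. \<Sum>i\<in>I. c i * (\<integral>x. U n x \<partial>M i)) \<longlonglongrightarrow> (\<Sum>i\<in>I. c i * (\<integral>x. u x \<partial>M i))"
        by (intro tendsto_intros)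
      moreover have "(\<Sum>i\<in>I. c i * (\<integral>x. U n x \<partial>M i)) = 0" for n
        using seq Ub by blast
      ultimately show "(\<Sum>i\<in>I. c i * (\<integral>x. u x \<partial>M i)) = 0"
        by (simp add: LIMSEQ_const_iff)
    qed
  qed
  have fb: "- b \<le> f x" "f x \<le> b" for x using bd[of x] by auto
  have "integrable (M i) f" if "i \<in> I" for i
    by (rule integrable_bounded_borel[OF fin[OF that] s[OF that] f bd])
  moreover have "integrable (M i) (\<lambda>x. b)" if "i \<in> I" for i
    by (rule finite_measure.integrable_const[OF fin[OF that]])
  ultimately have "(\<Sum>i\<in>I. c i * (\<integral>x. f x + b \<partial>M i)) =
      (\<Sum>i\<in>I. c i * (\<integral>x. f x \<partial>M i)) + (\<Sum>i\<in>I. c i * (\<integral>x. b \<partial>M i))"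
    by (simp add: sum.distrib algebra_simps)
  moreover have "(\<Sum>i\<in>I. c i * (\<integral>x. f x + b \<partial>M i)) = 0"
  proof -
    have "0 \<le> f x + b" "f x + b \<le> b + b" for x using fb[of x] by linarith+
    moreover have "(\<lambda>x. f x + b) \<in> borel_measurable borel" using f by simp
    ultimately show ?thesis
      using nn[of "\<lambda>x. f x + b", THEN spec[of _ "b + b"], THEN mp] by simp
  qed
  moreover have "0 \<le> b" using bd[of undefined] by linarith
  then have "(\<Sum>i\<in>I. c i * (\<integral>x. b \<partial>M i)) = 0"
    using nn[of "\<lambda>x. b"] by auto
  ultimately show ?thesis by simp
qed

text \<open>Any representation of \<open>\<mu>\<close> as a difference of finite measures computes the integral, not
  only the Jordan decomposition, in terms of which the integral is defined.\<close>

lemma signed_set_integral_eq: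
  fixes f :: "'a::topological_space \<Rightarrow> real"
  assumes M: "finite_measure M1" "finite_measure M2" "sets M1 = sets borel" "sets M2 = sets borel"
    and rep: "\<And>B. B \<in> sets borel \<Longrightarrow> sm_apply \<mu> B = measure M1 B - measure M2 B"
    and f: "f \<in> borel_measurable borel" and X: "X \<in> sets borel" and bd: "\<And>x. x \<in> X \<Longrightarrow> \<bar>f x\<bar> \<le> b"
  shows "signed_set_integral \<mu> X f = (LINT x:X|M1. f x) - (LINT x:X|M2. f x)"
proof -
  define M where "M = (\<lambda>i::nat. [positive_variation \<mu>, positive_variation (- \<mu>), M1, M2] ! i)"
  define c where "c = (\<lambda>i::nat. [1, -1, -1, 1 :: real] ! i)"
  have "(\<Sum>i<4. c i * (\<integral>x. indicator X x * f x \<partial>M i)) = 0"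
  proof (rule linear_relation_of_integrals[where b = "\<bar>b\<bar>"])
    have "\<forall>i<4. finite_measure (M i) \<and> sets (M i) = sets borel"
      using M by (simp add: M_def eval_nat_numeral All_less_Suc finite_measure_positive_variation)
    then show "finite_measure (M i)" "sets (M i) = sets borel" if "i \<in> {..<4}" for i
      using that by auto
  next
    fix B :: "'a set" assume "B \<in> sets borel"
    then show "(\<Sum>i<4. c i * measure (M i) B) = 0"
      using rep[of B] jordan_decomposition[of B \<mu>] by (simp add: M_def c_def eval_nat_numeral)
  next
    show "(\<lambda>x. indicator X x * f x) \<in> borel_measurable borel" using f X by measurable
    show "\<bar>indicator X x * f x\<bar> \<le> \<bar>b\<bar>" for x
      using bd[of x] by (auto simp: indicator_def)
  qed auto
  then show ?thesis
    by (simp add: M_def c_def eval_nat_numeral signed_set_integral_def set_lebesgue_integral_def)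
qed

lemma signed_set_integral_add:
  fixes f :: "'a::topological_space \<Rightarrow> real"
  assumes f: "f \<in> borel_measurable borel" and X: "X \<in> sets borel" and bd: "\<And>x. x \<in> X \<Longrightarrow> \<bar>f x\<bar> \<le> b"
  shows "signed_set_integral (\<mu> + \<nu>) X f = signed_set_integral \<mu> X f + signed_set_integral \<nu> X f"
proof -
  define M where "M = (\<lambda>i::nat. [positive_variation (\<mu> + \<nu>), positive_variation (- (\<mu> + \<nu>)),
      positive_variation \<mu>, positive_variation (- \<mu>), positive_variation \<nu>, positive_variation (- \<nu>)] ! i)"
  define c where "c = (\<lambda>i::nat. [1, -1, -1, 1, -1, 1 :: real] ! i)"
  have "(\<Sum>i<6. c i * (\<integral>x. indicator X x * f x \<partial>M i)) = 0"
  proof (rule linear_relation_of_integrals[where b = "\<bar>b\<bar>"])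
    have "\<forall>i<6. finite_measure (M i) \<and> sets (M i) = sets borel"
      by (simp add: M_def eval_nat_numeral All_less_Suc finite_measure_positive_variation
          del: minus_add_distrib)
    then show "finite_measure (M i)" "sets (M i) = sets borel" if "i \<in> {..<6}" for i
      using that by auto
  next
    fix B :: "'a set" assume "B \<in> sets borel"
    then show "(\<Sum>i<6. c i * measure (M i) B) = 0"
      using sm_plus[of \<mu> \<nu> B] jordan_decomposition[of B \<mu>] jordan_decomposition[of B \<nu>]
        jordan_decomposition[of B "\<mu> + \<nu>"]
      by (simp add: M_def c_def eval_nat_numeral del: minus_add_distrib)
  next
    show "(\<lambda>x. indicator X x * f x) \<in> borel_measurable borel" using f X by measurable
    show "\<bar>indicator X x * f x\<bar> \<le> \<bar>b\<bar>" for x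
      using bd[of x] by (auto simp: indicator_def)
  qed auto
  then show ?thesis
    by (simp add: M_def c_def eval_nat_numeral signed_set_integral_def set_lebesgue_integral_def
        del: minus_add_distrib)
qed

lemma signed_set_integral_uminus:
  "signed_set_integral (- \<mu>) X f = - signed_set_integral \<mu> X f"
  by (simp add: signed_set_integral_def)

lemma signed_set_integral_zero: "signed_set_integral 0 X f = 0"
  using signed_set_integral_uminus[of 0 X f] by simp

lemma signed_set_integral_sum:
  fixes f :: "'a::topological_space \<Rightarrow> real"
  assumes f: "f \<in> borel_measurable borel" and X: "X \<in> sets borel" and bd: "\<And>x. x \<in> X \<Longrightarrow> \<bar>f x\<bar> \<le> b"
  shows "signed_set_integral (\<Sum>i\<in>I. \<mu> i) X f = (\<Sum>i\<in>I. signed_set_integral (\<mu> i) X f)"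
  by (induction I rule: infinite_finite_induct)
    (auto simp: signed_set_integral_zero signed_set_integral_add[OF f X bd])

text \<open>The positive and negative parts of the density are such a representation.\<close>

lemma signed_set_integral_density:
  fixes f h :: "'a::topological_space \<Rightarrow> real"
  assumes s: "sets M = sets borel" and h: "integrable M h"
    and rep: "\<And>B. B \<in> sets borel \<Longrightarrow> sm_apply \<mu> B = (LINT x:B|M. h x)"
    and f: "f \<in> borel_measurable borel" and X: "X \<in> sets borel" and bd: "\<And>x. x \<in> X \<Longrightarrow> \<bar>f x\<bar> \<le> b"
  shows "signed_set_integral \<mu> X f = (LINT x:X|M. f x * h x)"
proof -
  have hm[measurable]: "h \<in> borel_measurable M" using h by simp
  have fm[measurable]: "f \<in> borel_measurable M" using f measurable_cong_sets[OF s refl] by blast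
  have Xm[measurable]: "X \<in> sets M" using X s by simp
  define N where "N g = density M (\<lambda>x. ennreal (max 0 (g x)))" for g :: "'a \<Rightarrow> real"
  have int: "integrable M (\<lambda>x. max 0 (h x))" "integrable M (\<lambda>x. max 0 (- h x))"
    using h by (auto intro!: integrable_max)
  have e: "emeasure (N g) B = ennreal (LINT x:B|M. max 0 (g x))"
    if "integrable M (\<lambda>x. max 0 (g x))" "g \<in> borel_measurable M" "B \<in> sets M" for g :: "'a \<Rightarrow> real" and B
  proof -
    have "emeasure (N g) B = (\<integral>\<^sup>+x. ennreal (indicator B x * max 0 (g x)) \<partial>M)"
      unfolding N_def using that
      by (subst emeasure_density) (auto intro!: nn_integral_cong simp: indicator_def)
    also have "\<dots> = ennreal (\<integral>x. indicator B x * max 0 (g x) \<partial>M)"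
      using integrable_mult_indicator[OF that(3,1)]
      by (intro nn_integral_eq_integral) auto
    finally show ?thesis by (simp add: set_lebesgue_integral_def)
  qed
  have fin: "finite_measure (N g)" if "integrable M (\<lambda>x. max 0 (g x))" "g \<in> borel_measurable M" for g
    using e[OF that, of "space M"] by (intro finite_measureI) (simp add: N_def)
  have m: "measure (N g) B = (LINT x:B|M. max 0 (g x))"
    if "integrable M (\<lambda>x. max 0 (g x))" "g \<in> borel_measurable M" "B \<in> sets M" for g :: "'a \<Rightarrow> real" and B
    unfolding measure_def e[OF that]
    by (rule enn2real_ennreal) (auto simp: set_lebesgue_integral_def intro!: integral_nonneg)
  have "signed_set_integral \<mu> X f = (LINT x:X|N h. f x) - (LINT x:X|N (\<lambda>x. - h x). f x)"
  proof (rule signed_set_integral_eq[OF _ _ _ _ _ f X bd])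
    fix B :: "'a set" assume B: "B \<in> sets borel"
    then have B': "B \<in> sets M" using s by simp
    have "(LINT x:B|M. max 0 (h x)) - (LINT x:B|M. max 0 (- h x)) = (LINT x:B|M. max 0 (h x) - max 0 (- h x))"
      using integrable_mult_indicator[OF B' int(1)] integrable_mult_indicator[OF B' int(2)]
      by (subst set_integral_diff(2)) (auto simp: set_integrable_def)
    also have "(\<lambda>x. max 0 (h x) - max 0 (- h x)) = h" by (auto simp: max_def)
    finally show "sm_apply \<mu> B = measure (N h) B - measure (N (\<lambda>x. - h x)) B"
      using int B' by (simp add: m rep[OF B])
  qed (use int s fin in \<open>auto simp: N_def\<close>)
  also have "\<dots> = (\<integral>x. max 0 (h x) * (indicator X x * f x) \<partial>M) - (\<integral>x. max 0 (- h x) * (indicator X x * f x) \<partial>M)"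
    unfolding N_def set_lebesgue_integral_def
    by (subst (1 2) integral_density) auto
  also have "\<dots> = (\<integral>x. max 0 (h x) * (indicator X x * f x) - max 0 (- h x) * (indicator X x * f x) \<partial>M)"
  proof (rule Bochner_Integration.integral_diff[symmetric])
    have *: "integrable M (\<lambda>x. g x * (indicator X x * f x))" if "integrable M g" for g :: "'a \<Rightarrow> real"
    proof (rule Bochner_Integration.integrable_bound[of _ "\<lambda>x. \<bar>b\<bar> * g x"])
      show "AE x in M. norm (g x * (indicator X x * f x)) \<le> norm (\<bar>b\<bar> * g x)"
      proof (rule AE_I2)
        fix x
        have "\<bar>indicator X x * f x\<bar> \<le> \<bar>b\<bar>"
          using bd[of x] by (cases "x \<in> X") auto
        then show "norm (g x * (indicator X x * f x)) \<le> norm (\<bar>b\<bar> * g x)"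
          using mult_left_mono[of "\<bar>indicator X x * f x\<bar>" "\<bar>b\<bar>" "\<bar>g x\<bar>"]
          by (simp add: abs_mult mult.commute)
      qed
    qed (use that in auto)
    show "integrable M (\<lambda>x. max 0 (h x) * (indicator X x * f x))"
         "integrable M (\<lambda>x. max 0 (- h x) * (indicator X x * f x))"
      by (intro * int)+
  qed
  also have "\<dots> = (LINT x:X|M. f x * h x)"
    unfolding set_lebesgue_integral_def
    by (intro Bochner_Integration.integral_cong) (auto simp: max_def algebra_simps indicator_def)
  finally show ?thesis .
qed

text \<open>Indicators of closed sets are decreasing limits of continuous functions, and closed sets
  generate the Borel sets.\<close>

lemma signed_measure_eq_on_closed:
  fixes \<mu> \<nu> :: "'a::metric_space signed_measure"
  assumes X: "closed X"
    and bd: "\<And>f :: 'a \<Rightarrow> real. continuous_on UNIV f \<Longrightarrow> bounded (f ` X)"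
    and eq: "\<And>f. continuous_on UNIV f \<Longrightarrow> signed_set_integral \<mu> X f = signed_set_integral \<nu> X f"
    and sup: "supported_on \<mu> X" "supported_on \<nu> X"
  shows "\<mu> = \<nu>"
proof -
  have Xm[measurable]: "X \<in> sets borel" using X by simp
  define \<kappa> where "\<kappa> = \<mu> + - \<nu>"
  let ?p = "positive_variation \<kappa>" and ?m = "positive_variation (- \<kappa>)"
  have eq0: "(LINT x:X|?p. f x) = (LINT x:X|?m. f x)" if f: "continuous_on UNIV f" for f :: "'a \<Rightarrow> real"
  proof -
    obtain b where b: "\<And>x. x \<in> X \<Longrightarrow> \<bar>f x\<bar> \<le> b"
      using bd[OF f] by (auto simp: bounded_iff)
    have "signed_set_integral \<kappa> X f = 0"
      unfolding \<kappa>_def using eq[OF that] that b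
      by (subst signed_set_integral_add[of f X b])
        (auto simp: signed_set_integral_uminus intro: borel_measurable_continuous_onI)
    then show ?thesis by (simp add: signed_set_integral_def)
  qed
  define P where "P = (\<lambda>M. density M (indicator X) :: 'a measure)"
  have eP: "emeasure (P M) B = emeasure M (B \<inter> X)" if "sets M = sets borel" "B \<in> sets borel" for M B
  proof -
    have "(\<lambda>x. indicator X x * indicator B x :: ennreal) = indicator (B \<inter> X)"
      by (auto simp: indicator_def)
    then have "emeasure (P M) B = (\<integral>\<^sup>+x. indicator (B \<inter> X) x \<partial>M)"
      unfolding P_def using that Xm by (subst emeasure_density) auto
    then show ?thesis using that Xm by simp
  qed
  have fm: "finite_measure ?p" "finite_measure ?m" by (rule finite_measure_positive_variation)+
  have closed: "measure ?p (C \<inter> X) = measure ?m (C \<inter> X)" if C: "closed C" for C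
  proof (cases "C = {}")
    case False
    define g where "g k x = max 0 (1 - real k * infdist x C)" for k x
    have gc: "continuous_on UNIV (g k)" for k
      unfolding g_def by (intro continuous_intros)
    have g01: "\<bar>g k x\<bar> \<le> 1" for k x
      using infdist_nonneg[of x C] by (auto simp: g_def abs_le_iff)
    have lim: "(\<lambda>k. g k x) \<longlonglongrightarrow> indicator C x" for x
    proof (cases "x \<in> C")
      case True
      then show ?thesis by (simp add: g_def)
    next
      case F: False
      then have pos: "0 < infdist x C"
        using C False by (simp add: infdist_pos_not_in_closed)
      obtain K where K: "1 / infdist x C < real K" using reals_Archimedean2 by blast
      have "g k x = 0" if "k \<ge> K" for k
      proof -
        have "1 < real K * infdist x C" using K pos by (simp add: field_simps)
        also have "\<dots> \<le> real k * infdist x C" using that pos by (intro mult_right_mono) auto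
        finally show ?thesis by (simp add: g_def)
      qed
      then show ?thesis
        using F by (intro tendsto_eventually) (auto simp: eventually_sequentially)
    qed
    have conv: "(\<lambda>k. (LINT x:X|M. g k x)) \<longlonglongrightarrow> measure M (C \<inter> X)"
      if M: "finite_measure M" "sets M = sets borel" for M
    proof -
      have "(\<lambda>k. (LINT x:X|M. g k x)) \<longlonglongrightarrow> (\<integral>x. indicator X x *\<^sub>R indicator C x \<partial>M)"
        unfolding set_lebesgue_integral_def
      proof (rule integral_dominated_convergence)
        show "integrable M (\<lambda>_. 1 :: real)"
          by (rule finite_measure.integrable_const[OF M(1)])
        show "AE x in M. (\<lambda>k. indicator X x *\<^sub>R g k x) \<longlonglongrightarrow> indicator X x *\<^sub>R indicator C x"
          by (intro AE_I2 tendsto_intros lim)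
        show "AE x in M. norm (indicator X x *\<^sub>R g k x) \<le> 1" for k
          using g01[of k] by (intro AE_I2) (auto simp: indicator_def)
        show "(\<lambda>x. indicator X x *\<^sub>R g k x) \<in> borel_measurable M" for k
          using borel_measurable_continuous_onI[OF gc[of k]] M(2) by (simp add: measurable_cong_sets[OF M(2) refl])
        show "(\<lambda>x. indicator X x *\<^sub>R indicator C x :: real) \<in> borel_measurable M"
          using C by (simp add: measurable_cong_sets[OF M(2) refl])
      qed
      also have "(\<lambda>x. indicator X x *\<^sub>R indicator C x :: real) = indicator (C \<inter> X)"
        by (auto simp: indicator_def)
      finally show ?thesis
        using C X M(2) sets_eq_imp_space_eq[OF M(2)] by simp
    qed
    show ?thesis
      using conv[OF fm(1)] conv[OF fm(2)] eq0[OF gc] by (simp add: LIMSEQ_unique)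
  qed simp
  have "P ?p = P ?m"
  proof (rule measure_eqI_generator_eq[where E = "Collect closed" and \<Omega> = UNIV and A = "\<lambda>_. UNIV"])
    show "Int_stable (Collect closed :: 'a set set)" by (auto simp: Int_stable_def)
    show "emeasure (P ?p) C = emeasure (P ?m) C" if "C \<in> Collect closed" for C
      using that closed[of C] by (simp add: eP finite_measure.emeasure_eq_measure[OF fm(1)] finite_measure.emeasure_eq_measure[OF fm(2)])
    show "sets (P ?p) = sigma_sets UNIV (Collect closed)" "sets (P ?m) = sigma_sets UNIV (Collect closed)"
      unfolding P_def by (simp_all add: borel_eq_closed)
    show "emeasure (P ?p) UNIV \<noteq> \<infinity>"
      by (simp add: eP finite_measure.emeasure_eq_measure[OF fm(1)])
  qed auto
  then have on: "sm_apply \<kappa> (B \<inter> X) = 0" if "B \<in> sets borel" for B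
    using that eP[of ?p B] eP[of ?m B]
    by (subst jordan_decomposition) (auto simp: measure_def)
  show ?thesis
  proof (rule sm_eqI)
    fix B :: "'a set" assume B: "B \<in> sets borel"
    have "sm_apply \<kappa> B = sm_apply \<kappa> (B - X)"
      using sm_Int_Diff[OF B Xm, of \<kappa>] on[OF B] by simp
    also have "\<dots> = 0"
      using sup B Xm by (simp add: \<kappa>_def supported_on_def Diff_eq)
    finally show "sm_apply \<mu> B = sm_apply \<nu> B" by (simp add: \<kappa>_def)
  qed
qed


section \<open>Lebesgue measure in orthonormal and hyperplane coordinates\<close>

text \<open>Fubini turns the translation invariance of \<open>\<lambda>\<close> and of its image \<open>N\<close> into
  \<open>N(A) \<lambda>(B) = \<lambda>(A) N(- B)\<close>; for a ball \<open>B\<close> about the origin the factors \<open>\<lambda>(B)\<close> and \<open>N(- B)\<close>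
  agree and can be cancelled.\<close>

lemma lborel_orthogonal_transformation:
  fixes T :: "'a::euclidean_space \<Rightarrow> 'a"
  assumes T: "orthogonal_transformation T"
  shows "distr lborel borel T = lborel"
proof -
  define N where "N = distr lborel borel T"
  have lin: "linear T" using T by (rule orthogonal_transformation_linear)
  have Tm[measurable]: "T \<in> borel_measurable borel"
    using lin by (intro borel_measurable_continuous_onI linear_continuous_on) (simp add: linear_conv_bounded_linear)
  have sN[measurable_cong, simp]: "sets N = sets borel" by (simp add: N_def)
  have nT: "norm (T x) = norm x" for x using T by (simp add: orthogonal_transformation)
  have shift: "distr lborel borel ((+) a) = (lborel :: 'a measure)" for a
    using lborel_distr_plus[of a] by (simp cong: distr_cong)
  have shiftN: "(\<integral>\<^sup>+x. f (x + a) \<partial>N) = (\<integral>\<^sup>+x. f x \<partial>N)" if [measurable]: "f \<in> borel_measurable borel" for a f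
  proof -
    obtain b where b: "T b = a"
      using orthogonal_transformation_surj[OF T] by (metis surjD)
    have "(\<integral>\<^sup>+x. f (x + a) \<partial>N) = (\<integral>\<^sup>+x. f (T (b + x)) \<partial>lborel)"
      unfolding N_def by (subst nn_integral_distr) (auto simp: linear_add[OF lin] b add.commute)
    also have "\<dots> = (\<integral>\<^sup>+x. f (T x) \<partial>distr lborel borel ((+) b))"
      by (subst nn_integral_distr) auto
    also have "\<dots> = (\<integral>\<^sup>+x. f x \<partial>N)"
      unfolding shift N_def by (subst nn_integral_distr) auto
    finally show ?thesis .
  qed
  have shiftL: "(\<integral>\<^sup>+x. f (a + x) \<partial>lborel) = (\<integral>\<^sup>+x. f x \<partial>lborel)"
    if [measurable]: "f \<in> borel_measurable borel" for f and a :: 'a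
    by (subst (2) shift[of a, symmetric], subst nn_integral_distr) auto
  have ballN: "emeasure N (ball 0 r) = emeasure lborel (ball (0::'a) r)" for r
  proof -
    have "T -` ball 0 r = ball 0 r" by (auto simp: nT)
    then show ?thesis unfolding N_def by (subst emeasure_distr) auto
  qed
  have sf: "sigma_finite_measure N"
  proof
    have "range (\<lambda>k::nat. ball (0::'a) (real k)) \<subseteq> sets N" by auto
    moreover have "(\<Union>k::nat. ball (0::'a) (real k)) = space N"
      using reals_Archimedean2 by (auto simp: N_def)
    moreover have "emeasure N (ball 0 (real k)) \<noteq> \<infinity>" for k
      unfolding ballN using emeasure_bounded_finite[OF bounded_ball] by (simp add: less_top)
    ultimately show "\<exists>A. countable A \<and> A \<subseteq> sets N \<and> \<Union> A = space N \<and> (\<forall>a\<in>A. emeasure N a \<noteq> \<infinity>)"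
      by (intro exI[of _ "range (\<lambda>k::nat. ball (0::'a) (real k))"]) auto
  qed
  interpret N: sigma_finite_measure N by (rule sf)
  interpret pair_sigma_finite N "lborel :: 'a measure" ..
  have "emeasure N A = emeasure lborel A" if A[measurable]: "A \<in> sets borel" for A :: "'a set"
  proof -
    let ?C = "ball (0::'a) 1"
    have C[measurable, simp]: "?C \<in> sets borel" using open_ball borel_open by blast
    have "emeasure N A * emeasure lborel ?C = (\<integral>\<^sup>+x. \<integral>\<^sup>+y. indicator A x * indicator ?C y \<partial>lborel \<partial>N)"
    proof -
      have "(\<integral>\<^sup>+y. indicator A x * indicator ?C y \<partial>lborel) = indicator A x * emeasure lborel ?C" for x
        using C by (intro nn_integral_cmult_indicator) simp
      then show ?thesis by (simp add: nn_integral_multc)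
    qed
    also have "\<dots> = (\<integral>\<^sup>+x. \<integral>\<^sup>+y. indicator A x * indicator ?C (- x + y) \<partial>lborel \<partial>N)"
    proof (rule nn_integral_cong)
      show "(\<integral>\<^sup>+y. indicator A x * indicator ?C y \<partial>lborel) =
          (\<integral>\<^sup>+y. indicator A x * indicator ?C (- x + y) \<partial>lborel)" for x
        by (subst shiftL[of "\<lambda>y. indicator A x * indicator ?C y"]) auto
    qed
    also have "\<dots> = (\<integral>\<^sup>+y. \<integral>\<^sup>+x. indicator A x * indicator ?C (- x + y) \<partial>N \<partial>lborel)"
      by (intro Fubini'[symmetric]) (auto simp: indicator_def)
    also have "\<dots> = (\<integral>\<^sup>+y. \<integral>\<^sup>+x. indicator A (x + y) * indicator ?C (- (x + y) + y) \<partial>N \<partial>lborel)"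
    proof (rule nn_integral_cong)
      show "(\<integral>\<^sup>+x. indicator A x * indicator ?C (- x + y) \<partial>N) =
          (\<integral>\<^sup>+x. indicator A (x + y) * indicator ?C (- (x + y) + y) \<partial>N)" for y
        by (subst shiftN[of "\<lambda>x. indicator A x * indicator ?C (- x + y)" y]) auto
    qed
    also have "\<dots> = (\<integral>\<^sup>+x. \<integral>\<^sup>+y. indicator A (x + y) * indicator ?C x \<partial>lborel \<partial>N)"
      by (subst Fubini') (auto simp: indicator_def intro!: nn_integral_cong)
    also have "\<dots> = (\<integral>\<^sup>+x. emeasure lborel A * indicator ?C x \<partial>N)"
    proof (rule nn_integral_cong)
      fix x
      have "(\<integral>\<^sup>+y. indicator A (x + y) \<partial>lborel) = emeasure lborel A"
        by (subst shiftL) auto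
      then show "(\<integral>\<^sup>+y. indicator A (x + y) * indicator ?C x \<partial>lborel) = emeasure lborel A * indicator ?C x"
        by (subst nn_integral_multc) auto
    qed
    also have "\<dots> = emeasure lborel A * emeasure lborel ?C"
      by (subst nn_integral_cmult) (auto simp: ballN)
    finally have eq: "emeasure N A * emeasure lborel ?C = emeasure lborel A * emeasure lborel ?C" .
    have "emeasure lborel ?C \<noteq> 0" "emeasure lborel ?C \<noteq> \<infinity>"
      using content_ball_pos[of 1 "0::'a"] emeasure_bounded_finite[of ?C]
      by (auto simp: measure_def)
    with eq show ?thesis
      by (simp add: mult.commute[of _ "emeasure lborel ?C"] ennreal_mult_cancel_left)
  qed
  then show ?thesis
    by (intro measure_eqI) (auto simp: N_def)
qed

text \<open>A rotation taking the given orthonormal basis to the standard one turns the claim into the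
  volume of boxes; rotations preserve Lebesgue measure.\<close>

lemma lborel_eq_orthonormal_coordinates:
  fixes B :: "'a::euclidean_space set"
  assumes fin: "finite B" and orth: "pairwise orthogonal B" and unit: "\<And>b. b \<in> B \<Longrightarrow> norm b = 1"
    and card: "card B = DIM('a)"
  shows "lborel = distr (\<Pi>\<^sub>M b\<in>B. lborel) borel (\<lambda>f. \<Sum>b\<in>B. f b *\<^sub>R b)"
proof -
  define N where "N = distr (\<Pi>\<^sub>M b\<in>B. lborel :: real measure) borel (\<lambda>f. \<Sum>b\<in>B. f b *\<^sub>R b)"
  obtain p where p: "bij_betw p B (Basis :: 'a set)"
    using fin card by (metis finite_Basis finite_same_card_bij)
  then have pB: "p b \<in> Basis" if "b \<in> B" for b using that by (auto simp: bij_betw_def)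
  have pinj: "inj_on p B" using p by (auto simp: bij_betw_def)
  have ob: "b \<bullet> b' = (if b = b' then 1 else 0)" if "b \<in> B" "b' \<in> B" for b b'
    using that orth unit[of b] by (auto simp: pairwise_def orthogonal_def norm_eq_1)
  have pp: "p b \<bullet> p b' = (if b = b' then 1 else 0)" if "b \<in> B" "b' \<in> B" for b b'
    using that pB pinj by (auto simp: inner_Basis inj_on_def)
  define T where "T x = (\<Sum>b\<in>B. (x \<bullet> b) *\<^sub>R p b)" for x
  define S where "S x = (\<Sum>b\<in>B. (x \<bullet> p b) *\<^sub>R b)" for x
  have linS: "linear S" "linear T"
    by (auto simp: S_def T_def linear_iff inner_add_left scaleR_left.sum algebra_simps sum.distrib scaleR_sum_right)
  have SpT: "S (T (\<Sum>b\<in>B. f b *\<^sub>R b)) = (\<Sum>b\<in>B. f b *\<^sub>R b)" "T (\<Sum>b\<in>B. f b *\<^sub>R b) = (\<Sum>b\<in>B. f b *\<^sub>R p b)" for f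
  proof -
    have *: "(\<Sum>b\<in>B. f b *\<^sub>R b) \<bullet> b' = f b'" if "b' \<in> B" for b'
      using that fin by (simp add: inner_sum_left ob if_distrib sum.delta cong: if_cong)
    have **: "(\<Sum>b\<in>B. f b *\<^sub>R p b) \<bullet> p b' = f b'" if "b' \<in> B" for b'
      using that fin by (simp add: inner_sum_left pp if_distrib sum.delta cong: if_cong)
    show "T (\<Sum>b\<in>B. f b *\<^sub>R b) = (\<Sum>b\<in>B. f b *\<^sub>R p b)"
      unfolding T_def by (intro sum.cong) (auto simp: *)
    then show "S (T (\<Sum>b\<in>B. f b *\<^sub>R b)) = (\<Sum>b\<in>B. f b *\<^sub>R b)"
      unfolding S_def by (auto simp: ** intro!: sum.cong)
  qed
  have "orthogonal_transformation S"
    unfolding orthogonal_transformation_def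
  proof (intro conjI allI linS)
    fix v w :: 'a
    have "S v \<bullet> S w = (\<Sum>b\<in>B. (v \<bullet> p b) * (w \<bullet> p b))"
      using fin by (simp add: S_def inner_sum_left inner_sum_right ob if_distrib sum.delta mult.commute cong: if_cong)
    also have "\<dots> = (\<Sum>e\<in>Basis. (v \<bullet> e) * (w \<bullet> e))"
      by (rule sum.reindex_bij_betw[OF p])
    finally show "S v \<bullet> S w = v \<bullet> w" by (simp add: euclidean_inner[of v w])
  qed
  note orthS = lborel_orthogonal_transformation[OF this]
  have meas[measurable]: "S \<in> borel_measurable borel" "T \<in> borel_measurable borel"
    using linS by (auto intro!: borel_measurable_continuous_onI linear_continuous_on simp: linear_conv_bounded_linear)
  have sm[measurable]: "(\<lambda>f. \<Sum>b\<in>B. f b *\<^sub>R b) \<in> (\<Pi>\<^sub>M b\<in>B. lborel :: real measure) \<rightarrow>\<^sub>M borel"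
    by measurable
  interpret product_sigma_finite "\<lambda>_::'a. lborel :: real measure" ..
  have "lborel = distr N borel T"
  proof (rule lborel_eqI)
    fix l u :: 'a assume lu: "\<And>b. b \<in> Basis \<Longrightarrow> l \<bullet> b \<le> u \<bullet> b"
    have "emeasure (distr N borel T) (box l u)
        = emeasure (\<Pi>\<^sub>M b\<in>B. lborel) {f \<in> space (\<Pi>\<^sub>M b\<in>B. lborel :: real measure). T (\<Sum>b\<in>B. f b *\<^sub>R b) \<in> box l u}"
    proof -
      have "distr N borel T = distr (\<Pi>\<^sub>M b\<in>B. lborel) borel (T \<circ> (\<lambda>f. \<Sum>b\<in>B. f b *\<^sub>R b))"
        unfolding N_def by (rule distr_distr) auto
      then show ?thesis
        by (simp only:) (subst emeasure_distr, auto simp: comp_def vimage_def Int_def conj_commute)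
    qed
    also have "{f \<in> space (\<Pi>\<^sub>M b\<in>B. lborel :: real measure). T (\<Sum>b\<in>B. f b *\<^sub>R b) \<in> box l u}
        = (\<Pi>\<^sub>E b\<in>B. {l \<bullet> p b <..< u \<bullet> p b})" (is "?L = ?R")
    proof -
      have "T (\<Sum>b\<in>B. g b *\<^sub>R b) \<bullet> p b' = g b'" if "b' \<in> B" for g :: "'a \<Rightarrow> real" and b'
        unfolding SpT(2) using that fin by (simp add: inner_sum_left pp if_distrib sum.delta cong: if_cong)
      moreover have "x \<in> box l u \<longleftrightarrow> (\<forall>b\<in>B. l \<bullet> p b < x \<bullet> p b \<and> x \<bullet> p b < u \<bullet> p b)" for x
      proof -
        have "Basis = p ` B" using p by (simp add: bij_betw_def)
        then show ?thesis unfolding mem_box by (subst \<open>Basis = p ` B\<close>) blast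
      qed
      ultimately show ?thesis
        by (intro set_eqI) (simp add: space_PiM PiE_iff, blast)
    qed
    also have "emeasure (\<Pi>\<^sub>M b\<in>B. lborel) \<dots> = (\<Prod>b\<in>B. emeasure lborel {l \<bullet> p b <..< u \<bullet> p b})"
      using fin by (subst emeasure_PiM) auto
    also have "\<dots> = (\<Prod>b\<in>B. ennreal ((u - l) \<bullet> p b))"
      using lu pB by (intro prod.cong) (auto simp: inner_diff_left)
    also have "\<dots> = (\<Prod>b\<in>Basis. ennreal ((u - l) \<bullet> b))"
      by (rule prod.reindex_bij_betw[OF p])
    also have "\<dots> = ennreal (\<Prod>b\<in>Basis. (u - l) \<bullet> b)"
      using lu by (intro prod_ennreal) (auto simp: inner_diff_left)
    finally show "emeasure (distr N borel T) (box l u) = (\<Prod>b\<in>Basis. (u - l) \<bullet> b)" .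
  qed simp
  then have "distr lborel borel S = distr (distr N borel T) borel S" by simp
  also have "\<dots> = distr (\<Pi>\<^sub>M b\<in>B. lborel) borel (\<lambda>f. \<Sum>b\<in>B. f b *\<^sub>R b)"
  proof -
    have "distr (distr N borel T) borel S = distr N borel (S \<circ> T)"
      by (rule distr_distr) (auto simp: N_def)
    also have "\<dots> = distr (\<Pi>\<^sub>M b\<in>B. lborel) borel ((S \<circ> T) \<circ> (\<lambda>f. \<Sum>b\<in>B. f b *\<^sub>R b))"
      unfolding N_def by (rule distr_distr) auto
    also have "(S \<circ> T) \<circ> (\<lambda>f. \<Sum>b\<in>B. f b *\<^sub>R b) = (\<lambda>f. \<Sum>b\<in>B. f b *\<^sub>R b)"
      unfolding comp_def by (rule ext) (rule SpT)
    finally show ?thesis .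
  qed
  finally show ?thesis unfolding orthS .
qed


text \<open>The \<open>(n - 1)\<close>-dimensional volume \<open>M\<close> of a hyperplane with unit normal \<open>u\<close>, characterized by
  its role in Fubini's theorem. This hides the choice of an origin and of an orthonormal basis in
  \<^const>\<open>affine_volume\<close>; invariances of \<open>M\<close> are inherited from Lebesgue measure by means of
  cylinders over the hyperplane.\<close>

locale hyperplane_chart =
  fixes u :: "'a::euclidean_space" and c :: real and M :: "'a measure"
  assumes unit: "norm u = 1"
    and sets_M [simp, measurable_cong]: "sets M = sets borel"
    and on_hyperplane: "AE x in M. u \<bullet> x = c"
    and slices: "X \<in> sets borel \<Longrightarrow> emeasure lborel X = (\<integral>\<^sup>+x. emeasure lborel {s. x + s *\<^sub>R u \<in> X} \<partial>M)"
begin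

text \<open>The orthogonal projection to the hyperplane.\<close>

definition foot :: "'a \<Rightarrow> 'a" where
  "foot y = y - (u \<bullet> y - c) *\<^sub>R u"

lemma space_M [simp]: "space M = UNIV"
  using sets_eq_imp_space_eq[OF sets_M] by simp

lemma uu [simp]: "u \<bullet> u = 1"
  using unit by (simp add: norm_eq_1)

lemma u_foot [simp]: "u \<bullet> foot y = c"
  by (simp add: foot_def inner_diff_right)

lemma foot_shift: "u \<bullet> x = c \<Longrightarrow> foot (x + s *\<^sub>R u) = x"
  by (simp add: foot_def inner_add_right)

lemma continuous_foot [continuous_intros]: "continuous_on S foot"
  unfolding foot_def by (intro continuous_intros)

lemma foot_measurable [measurable]: "foot \<in> borel_measurable borel"
  by (intro borel_measurable_continuous_onI continuous_foot)

lemma norm_foot_le: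
  assumes "u \<bullet> p = c"
  shows "norm (foot y - p) \<le> norm (y - p)"
proof -
  have "y - p = (foot y - p) + (u \<bullet> y - c) *\<^sub>R u" by (simp add: foot_def)
  moreover have "orthogonal (foot y - p) ((u \<bullet> y - c) *\<^sub>R u)"
    using assms u_foot[of y] by (simp add: orthogonal_def inner_commute[of _ u] inner_diff_right)
  ultimately have "(norm (y - p))\<^sup>2 = (norm (foot y - p))\<^sup>2 + (norm ((u \<bullet> y - c) *\<^sub>R u))\<^sup>2"
    by (metis norm_add_Pythagorean)
  then show ?thesis
    by (metis norm_ge_zero power2_le_imp_le le_add_same_cancel1 zero_le_power2)
qed

lemma emeasure_cylinder:
  assumes A[measurable]: "A \<in> sets borel" and ab: "a \<le> b"
  shows "emeasure lborel {y. foot y \<in> A \<and> a \<le> u \<bullet> y - c \<and> u \<bullet> y - c \<le> b} = emeasure M A * ennreal (b - a)"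
proof -
  have "{y. foot y \<in> A \<and> a \<le> u \<bullet> y - c \<and> u \<bullet> y - c \<le> b} \<in> sets borel" by measurable
  then have "emeasure lborel {y. foot y \<in> A \<and> a \<le> u \<bullet> y - c \<and> u \<bullet> y - c \<le> b}
      = (\<integral>\<^sup>+x. emeasure lborel {s. x + s *\<^sub>R u \<in> {y. foot y \<in> A \<and> a \<le> u \<bullet> y - c \<and> u \<bullet> y - c \<le> b}} \<partial>M)"
    by (rule slices)
  also have "\<dots> = (\<integral>\<^sup>+x. ennreal (b - a) * indicator A x \<partial>M)"
  proof (rule nn_integral_cong_AE, use on_hyperplane in eventually_elim)
    fix x assume x: "u \<bullet> x = c"
    have "{s. x + s *\<^sub>R u \<in> {y. foot y \<in> A \<and> a \<le> u \<bullet> y - c \<and> u \<bullet> y - c \<le> b}} = (if x \<in> A then {a..b} else {})"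
      using x by (auto simp: foot_shift inner_add_right)
    then show "emeasure lborel {s. x + s *\<^sub>R u \<in> {y. foot y \<in> A \<and> a \<le> u \<bullet> y - c \<and> u \<bullet> y - c \<le> b}}
        = ennreal (b - a) * indicator A x"
      using ab by simp
  qed
  also have "\<dots> = emeasure M A * ennreal (b - a)"
    by (subst nn_integral_cmult) (auto simp: mult.commute)
  finally show ?thesis .
qed

lemma emeasure_unit_cylinder:
  "A \<in> sets borel \<Longrightarrow> emeasure M A = emeasure lborel {y. foot y \<in> A \<and> 0 \<le> u \<bullet> y - c \<and> u \<bullet> y - c \<le> 1}"
  using emeasure_cylinder[of A 0 1] by simp

lemma emeasure_bounded_lt_top:
  assumes "bounded A" "A \<in> sets borel"
  shows "emeasure M A < \<infinity>"
proof -
  obtain R where R: "A \<subseteq> cball 0 R" using assms(1) by (metis bounded_iff mem_cball_0 subsetI)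
  have "bounded {y. foot y \<in> A \<and> 0 \<le> u \<bullet> y - c \<and> u \<bullet> y - c \<le> 1}"
    unfolding bounded_iff
  proof (intro exI[of _ "R + 1"] ballI)
    fix y assume y: "y \<in> {y. foot y \<in> A \<and> 0 \<le> u \<bullet> y - c \<and> u \<bullet> y - c \<le> 1}"
    have "norm y = norm (foot y + (u \<bullet> y - c) *\<^sub>R u)" by (simp add: foot_def)
    also have "\<dots> \<le> norm (foot y) + \<bar>u \<bullet> y - c\<bar>"
      by (metis norm_triangle_ineq norm_scaleR unit mult.right_neutral)
    also have "\<dots> \<le> R + 1" using y R by (auto simp: subset_iff)
    finally show "norm y \<le> R + 1" .
  qed
  then show ?thesis
    using emeasure_unit_cylinder[OF assms(2)] emeasure_bounded_finite by simp
qed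

sublocale sigma_finite_measure M
proof
  have "emeasure M (cball 0 (real k)) \<noteq> \<infinity>" for k
    using emeasure_bounded_lt_top[of "cball 0 (real k)"] by (simp add: less_top)
  moreover have "(\<Union>k::nat. cball (0::'a) (real k)) = UNIV"
    using real_arch_simple by auto
  ultimately show "\<exists>A. countable A \<and> A \<subseteq> sets M \<and> \<Union> A = space M \<and> (\<forall>a\<in>A. emeasure M a \<noteq> \<infinity>)"
    by (intro exI[of _ "range (\<lambda>k::nat. cball (0::'a) (real k))"]) auto
qed

sublocale chart: pair_sigma_finite M "lborel :: real measure" ..

lemma lborel_eq_chart: "lborel = distr (M \<Otimes>\<^sub>M lborel) borel (\<lambda>z. fst z + snd z *\<^sub>R u)"
proof (rule measure_eqI)
  fix X :: "'a set" assume "X \<in> sets lborel"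
  then have X[measurable]: "X \<in> sets borel" by simp
  have "emeasure (distr (M \<Otimes>\<^sub>M lborel) borel (\<lambda>z. fst z + snd z *\<^sub>R u)) X
      = emeasure (M \<Otimes>\<^sub>M lborel) {z \<in> space (M \<Otimes>\<^sub>M lborel). fst z + snd z *\<^sub>R u \<in> X}"
    by (subst emeasure_distr) (auto simp: case_prod_beta vimage_def Int_def conj_commute)
  also have "\<dots> = (\<integral>\<^sup>+x. emeasure lborel (Pair x -` {z \<in> space (M \<Otimes>\<^sub>M lborel). fst z + snd z *\<^sub>R u \<in> X}) \<partial>M)"
    by (rule lborel.emeasure_pair_measure_alt) measurable
  also have "\<dots> = emeasure lborel X"
    unfolding slices[OF X] by (simp add: space_pair_measure vimage_def)
  finally show "emeasure lborel X = emeasure (distr (M \<Otimes>\<^sub>M lborel) borel (\<lambda>z. fst z + snd z *\<^sub>R u)) X" ..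
qed simp

lemma integral_chart:
  fixes f :: "'a \<Rightarrow> real"
  assumes f: "integrable lborel f"
  shows "(\<integral>y. f y \<partial>lborel) = (\<integral>x. (\<integral>s. f (x + s *\<^sub>R u) \<partial>lborel) \<partial>M)"
    and "integrable (M \<Otimes>\<^sub>M lborel) (\<lambda>z. f (fst z + snd z *\<^sub>R u))"
proof -
  have m[measurable]: "f \<in> borel_measurable borel" using f by simp
  have "integrable (distr (M \<Otimes>\<^sub>M lborel) borel (\<lambda>z. fst z + snd z *\<^sub>R u)) f"
    using f unfolding lborel_eq_chart[symmetric] .
  then show i: "integrable (M \<Otimes>\<^sub>M lborel) (\<lambda>z. f (fst z + snd z *\<^sub>R u))"
    by (subst (asm) integrable_distr_eq) auto
  have e: "(\<integral>y. f y \<partial>lborel) = (\<integral>z. f (fst z + snd z *\<^sub>R u) \<partial>(M \<Otimes>\<^sub>M lborel))"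
    by (subst lborel_eq_chart, subst integral_distr) (auto simp: case_prod_beta)
  show "(\<integral>y. f y \<partial>lborel) = (\<integral>x. (\<integral>s. f (x + s *\<^sub>R u) \<partial>lborel) \<partial>M)"
    unfolding e using chart.integral_fst'[OF i] by simp
qed

text \<open>A homothety with centre on the hyperplane multiplies the volume of a cylinder by
  \<open>\<bar>k\<bar> ^ DIM('a)\<close> and its height by \<open>\<bar>k\<bar>\<close>. For \<open>k = - 1\<close> it is the reflection in the centre.\<close>

lemma emeasure_homothety:
  assumes A[measurable]: "A \<in> sets borel" and p: "u \<bullet> p = c" and k: "k \<noteq> 0"
  shows "emeasure M {y. p + k *\<^sub>R (y - p) \<in> A} = ennreal (\<bar>k\<bar> / \<bar>k\<bar> ^ DIM('a)) * emeasure M A"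
proof -
  let ?h = "\<lambda>y. p + k *\<^sub>R (y - p)"
  define Z where "Z = {z. foot z \<in> A \<and> min 0 k \<le> u \<bullet> z - c \<and> u \<bullet> z - c \<le> max 0 k}"
  have Zm[measurable]: "Z \<in> sets borel" unfolding Z_def by measurable
  have u: "u \<bullet> ?h y - c = k * (u \<bullet> y - c)" for y
    using p by (simp add: inner_add_right inner_diff_right algebra_simps)
  have f: "foot (?h y) = ?h (foot y)" for y
    unfolding foot_def u by (simp add: algebra_simps)
  have ch: "(0 \<le> t \<and> t \<le> 1) \<longleftrightarrow> (min 0 k \<le> k * t \<and> k * t \<le> max 0 k)" for t
  proof (cases "k > 0")
    case True
    then have "k * t \<le> k \<longleftrightarrow> t \<le> 1" using mult_le_cancel_left_pos[of k t 1] by simp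
    with True show ?thesis by (simp add: zero_le_mult_iff)
  next
    case False
    with k have "k < 0" by simp
    then have "k \<le> k * t \<longleftrightarrow> t \<le> 1" using mult_le_cancel_left_neg[of k 1 t] by simp
    with \<open>k < 0\<close> show ?thesis by (auto simp: mult_le_0_iff)
  qed
  have "emeasure M {y. ?h y \<in> A} = emeasure lborel {y. ?h (foot y) \<in> A \<and> 0 \<le> u \<bullet> y - c \<and> u \<bullet> y - c \<le> 1}"
    by (subst emeasure_unit_cylinder) auto
  also have "{y. ?h (foot y) \<in> A \<and> 0 \<le> u \<bullet> y - c \<and> u \<bullet> y - c \<le> 1} = {y. ?h y \<in> Z}"
    unfolding Z_def mem_Collect_eq u f ch ..
  finally have 1: "emeasure M {y. ?h y \<in> A} = emeasure lborel {y. ?h y \<in> Z}" .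
  have "emeasure lborel Z = emeasure (density (distr lborel borel (\<lambda>x. (p - k *\<^sub>R p) + k *\<^sub>R x)) (\<lambda>_. \<bar>k\<bar>^DIM('a))) Z"
    using lborel_affine[OF k, of "p - k *\<^sub>R p"] by simp
  also have "\<dots> = ennreal (\<bar>k\<bar>^DIM('a)) * emeasure (distr lborel borel (\<lambda>x. (p - k *\<^sub>R p) + k *\<^sub>R x)) Z"
    by (subst emeasure_density_const) auto
  also have "\<dots> = ennreal (\<bar>k\<bar>^DIM('a)) * emeasure lborel {y. ?h y \<in> Z}"
    by (subst emeasure_distr) (auto simp: vimage_def algebra_simps)
  finally have 2: "emeasure lborel Z = ennreal (\<bar>k\<bar>^DIM('a)) * emeasure lborel {y. ?h y \<in> Z}" .
  have 3: "emeasure lborel Z = emeasure M A * ennreal \<bar>k\<bar>"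
    unfolding Z_def by (subst emeasure_cylinder) (auto simp: min_def max_def)
  have "ennreal (\<bar>k\<bar> / \<bar>k\<bar> ^ DIM('a)) * emeasure M A = ennreal (1 / \<bar>k\<bar> ^ DIM('a)) * (emeasure M A * ennreal \<bar>k\<bar>)"
  proof -
    have "ennreal (\<bar>k\<bar> / \<bar>k\<bar> ^ DIM('a)) = ennreal (1 / \<bar>k\<bar> ^ DIM('a)) * ennreal \<bar>k\<bar>"
      by (subst ennreal_mult''[symmetric]) auto
    then show ?thesis by (simp add: mult.assoc mult.commute[of "emeasure M A"])
  qed
  also have "\<dots> = ennreal (1 / \<bar>k\<bar> ^ DIM('a)) * (ennreal (\<bar>k\<bar>^DIM('a)) * emeasure lborel {y. ?h y \<in> Z})"
    using 2 3 by simp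
  also have "\<dots> = emeasure lborel {y. ?h y \<in> Z}"
    using k by (simp add: ennreal_mult'' [symmetric] flip: mult.assoc)
  finally show ?thesis using 1 by simp
qed

lemma integral_homothety:
  fixes f :: "'a \<Rightarrow> real"
  assumes f[measurable]: "f \<in> borel_measurable borel" and p: "u \<bullet> p = c" and k: "k \<noteq> 0"
  shows "(\<integral>y. f (p + k *\<^sub>R (y - p)) \<partial>M) = (\<bar>k\<bar> / \<bar>k\<bar> ^ DIM('a)) * (\<integral>y. f y \<partial>M)"
proof -
  let ?h = "\<lambda>y. p + k *\<^sub>R (y - p)" and ?q = "\<bar>k\<bar> / \<bar>k\<bar> ^ DIM('a)"
  have "distr M borel ?h = density M (\<lambda>_. ennreal ?q)"
  proof (rule measure_eqI)
    fix A :: "'a set" assume "A \<in> sets (distr M borel ?h)"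
    then have A[measurable]: "A \<in> sets borel" by simp
    have "emeasure (distr M borel ?h) A = emeasure M {y. ?h y \<in> A}"
      by (subst emeasure_distr) (auto simp: vimage_def)
    also have "\<dots> = emeasure (density M (\<lambda>_. ennreal ?q)) A"
      unfolding emeasure_homothety[OF A p k] by (subst emeasure_density_const) auto
    finally show "emeasure (distr M borel ?h) A = emeasure (density M (\<lambda>_. ennreal ?q)) A" .
  qed simp
  then have "(\<integral>y. f y \<partial>distr M borel ?h) = (\<integral>y. f y \<partial>density M (\<lambda>_. ennreal ?q))" by simp
  then show ?thesis
    by (subst (asm) integral_distr, measurable) (subst (asm) integral_density, auto)
qed

lemma integral_reflect:
  fixes f :: "'a \<Rightarrow> real"
  assumes f: "f \<in> borel_measurable borel" and p: "u \<bullet> p = c"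
  shows "(\<integral>y. f (2 *\<^sub>R p - y) \<partial>M) = (\<integral>y. f y \<partial>M)"
proof -
  have "p + (-1) *\<^sub>R (y - p) = 2 *\<^sub>R p - y" for y :: 'a
    by (simp add: scaleR_2)
  then show ?thesis
    using integral_homothety[OF f p, of "-1"] by (simp only:) simp
qed

text \<open>The intersection with a second hyperplane is null because the cylinder over it lies in a
  hyperplane of the whole space.\<close>

lemma AE_off_hyperplane:
  assumes p: "u \<bullet> p = c" "w \<bullet> p \<noteq> d"
  shows "AE x in M. w \<bullet> x \<noteq> d"
proof -
  define w' where "w' = w - (w \<bullet> u) *\<^sub>R u"
  have wf: "w \<bullet> foot y = w' \<bullet> y + c * (w \<bullet> u)" for y
    by (simp add: foot_def w'_def inner_diff_right inner_diff_left algebra_simps)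
  show ?thesis
  proof (cases "w' = 0")
    case True
    then have "w = (w \<bullet> u) *\<^sub>R u" by (simp add: w'_def)
    then have "w \<bullet> x = ((w \<bullet> u) *\<^sub>R u) \<bullet> x" for x by (rule arg_cong)
    then have wx: "w \<bullet> x = (w \<bullet> u) * (u \<bullet> x)" for x unfolding inner_scaleR_left .
    show ?thesis
      using on_hyperplane
    proof eventually_elim
      case (elim x)
      then show ?case using wx[of x] wx[of p] p by simp
    qed
  next
    case False
    let ?N = "{x. w \<bullet> x = d}"
    have Nm: "?N \<in> sets borel" by measurable
    have "emeasure M ?N \<le> emeasure lborel {y. w' \<bullet> y = d - c * (w \<bullet> u)}"
      unfolding emeasure_unit_cylinder[OF Nm] by (intro emeasure_mono) (auto simp: wf)
    also have "\<dots> = 0"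
      using negligible_hyperplane[of w' "d - c * (w \<bullet> u)"] False
      by (simp add: negligible_iff_null_sets null_sets_completion_iff null_sets_def)
    finally have "?N \<in> null_sets M" using Nm by (auto simp: null_sets_def)
    then show ?thesis by (rule AE_I') auto
  qed
qed

lemma emeasure_ball_pos:
  assumes p: "u \<bullet> p = c" and r: "0 < r"
  shows "0 < emeasure M (ball p r)"
proof -
  define q where "q = min r 1 / 2"
  have q: "0 < q" "q \<le> 1/2" "q < r" using r by (auto simp: q_def)
  have "ball (p + q *\<^sub>R u) q \<subseteq> {y. foot y \<in> ball p r \<and> 0 \<le> u \<bullet> y - c \<and> u \<bullet> y - c \<le> 1}"
  proof
    fix y assume "y \<in> ball (p + q *\<^sub>R u) q"
    then have y: "norm (y - (p + q *\<^sub>R u)) < q" by (simp add: dist_norm norm_minus_commute)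
    have "foot y = foot (y - q *\<^sub>R u)"
      by (simp add: foot_def inner_diff_right algebra_simps)
    then have "norm (foot y - p) < r"
      using norm_foot_le[OF p, of "y - q *\<^sub>R u"] y q by (simp add: algebra_simps)
    moreover have "\<bar>u \<bullet> (y - (p + q *\<^sub>R u))\<bar> < q"
      using Cauchy_Schwarz_ineq2[of u "y - (p + q *\<^sub>R u)"] y unit by simp
    then have "\<bar>u \<bullet> y - c - q\<bar> < q" using p by (simp add: inner_diff_right inner_add_right algebra_simps)
    ultimately show "y \<in> {y. foot y \<in> ball p r \<and> 0 \<le> u \<bullet> y - c \<and> u \<bullet> y - c \<le> 1}"
      using q by (auto simp: dist_norm norm_minus_commute)
  qed
  moreover have [measurable]: "ball p r \<in> sets borel" using open_ball borel_open by blast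
  have "{y. foot y \<in> ball p r \<and> 0 \<le> u \<bullet> y - c \<and> u \<bullet> y - c \<le> 1} \<in> sets borel" by measurable
  ultimately have "emeasure lborel (ball (p + q *\<^sub>R u) q) \<le> emeasure M (ball p r)"
    by (subst emeasure_unit_cylinder) (auto intro: emeasure_mono)
  moreover have "emeasure lborel (ball (p + q *\<^sub>R u) q) \<noteq> 0"
    using content_ball_pos[OF q(1), of "p + q *\<^sub>R u"] by (auto simp: measure_def)
  ultimately show ?thesis by (metis le_zero_eq not_gr_zero)
qed

lemma integrable_bounded_support:
  fixes f :: "'a \<Rightarrow> real"
  assumes [measurable]: "f \<in> borel_measurable borel" and bd: "\<And>x. u \<bullet> x = c \<Longrightarrow> \<bar>f x\<bar> \<le> b"
    and S: "bounded S" "S \<in> sets borel" and supp: "\<And>x. u \<bullet> x = c \<Longrightarrow> x \<notin> S \<Longrightarrow> f x = 0"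
  shows "integrable M f"
proof (rule Bochner_Integration.integrable_bound)
  show "integrable M (\<lambda>x. b * indicator S x)"
    using emeasure_bounded_lt_top[OF S] S by simp
  show "AE x in M. norm (f x) \<le> norm (b * indicator S x)"
    using on_hyperplane
  proof eventually_elim
    case (elim x)
    then show ?case using bd[of x] supp[of x] by (auto simp: indicator_def)
  qed
qed simp

end

text \<open>A unit normal of a facet completes an orthonormal basis of its direction space to one of the
  whole space, which turns the product measure into a slicing formula.\<close>

lemma hyperplane_chart_affine_volume:
  fixes F :: "'a::euclidean_space set"
  assumes "F \<noteq> {}" and u: "norm u = 1" and sub: "\<And>x. x \<in> F \<Longrightarrow> u \<bullet> x = c"
    and dimF: "aff_dim F = int DIM('a) - 1"
  shows "hyperplane_chart u c (affine_volume F)"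
proof -
  define p where "p = (SOME p. p \<in> F)"
  define V where "V = {x - y |x y. x \<in> F \<and> y \<in> F}"
  define B where "B = (SOME B. pairwise orthogonal B \<and> (\<forall>b\<in>B. norm b = 1) \<and> span B = span V)"
  have p: "p \<in> F" unfolding p_def using assms(1) some_in_eq by blast
  have "\<exists>B. pairwise orthogonal B \<and> (\<forall>b\<in>B. norm b = 1) \<and> span B = span V"
    by (metis orthonormal_basis_subspace subspace_span)
  then have B: "pairwise orthogonal B" "\<And>b. b \<in> B \<Longrightarrow> norm b = 1" "span B = span V"
    using someI_ex[of "\<lambda>B. pairwise orthogonal B \<and> (\<forall>b\<in>B. norm b = 1) \<and> span B = span V"]
    unfolding B_def[symmetric] by blast+
  have B0: "0 \<notin> B" using B(2) by force
  have ind: "independent B" using B(1) B0 by (rule pairwise_orthogonal_independent)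
  have fin: "finite B" using ind by (rule independent_imp_finite)
  have "span V = span ((\<lambda>x. x - p) ` F)"
    unfolding span_eq
  proof
    show "(\<lambda>x. x - p) ` F \<subseteq> span V" using p by (auto simp: V_def intro!: span_base)
    have "x - y \<in> span ((\<lambda>x. x - p) ` F)" if "x \<in> F" "y \<in> F" for x y
    proof -
      have "(x - p) - (y - p) \<in> span ((\<lambda>x. x - p) ` F)"
        using that by (intro span_diff span_base) auto
      then show ?thesis by simp
    qed
    then show "V \<subseteq> span ((\<lambda>x. x - p) ` F)" by (auto simp: V_def)
  qed
  then have "int (card B) = int (dim ((\<lambda>x. x - p) ` F))"
    using ind B(3) by (metis dim_eq_card dim_span)
  also have "\<dots> = aff_dim F"
    using p by (metis aff_dim_eq_dim_subtract hull_inc)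
  finally have card: "card B = DIM('a) - 1" using dimF by simp
  have uV: "u \<bullet> v = 0" if "v \<in> span B" for v
  proof -
    have "v \<in> span V" using that B(3) by simp
    then show ?thesis
    proof (induction rule: span_induct_alt)
      case (step k x y)
      then show ?case using sub by (auto simp: V_def inner_add_right inner_diff_right)
    qed simp
  qed
  have uB: "u \<notin> B"
    using uV[of u] u by (auto simp: norm_eq_1 dest: span_base)
  let ?O = "insert u B"
  have orth: "pairwise orthogonal ?O"
    using B(1) uV span_base[of _ B] by (auto simp: pairwise_insert orthogonal_def inner_commute)
  have cardO: "card ?O = DIM('a)"
    using uB fin card by simp
  have vol: "affine_volume F = distr (\<Pi>\<^sub>M b\<in>B. lborel) borel (\<lambda>f. p + (\<Sum>b\<in>B. f b *\<^sub>R b))"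
    unfolding affine_volume_def Let_def p_def B_def V_def ..
  have meas[measurable]: "(\<lambda>f. p + (\<Sum>b\<in>B. f b *\<^sub>R b)) \<in> (\<Pi>\<^sub>M b\<in>B. lborel :: real measure) \<rightarrow>\<^sub>M borel"
    by measurable
  have "(\<lambda>f. p + (\<Sum>b\<in>Q. f b *\<^sub>R b)) \<in> (\<Pi>\<^sub>M b\<in>Q. lborel :: real measure) \<rightarrow>\<^sub>M borel" for Q
    by measurable
  note measO = this[of ?O]
  interpret product_sigma_finite "\<lambda>_::'a. lborel :: real measure" ..
  show ?thesis
  proof
    show "norm u = 1" by (rule u)
    show "sets (affine_volume F) = sets borel" by (simp add: vol)
    have "u \<bullet> (p + (\<Sum>b\<in>B. f b *\<^sub>R b)) = c" for f
      using sub[OF p] uV[of "\<Sum>b\<in>B. f b *\<^sub>R b"]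
      by (simp add: inner_add_right span_sum span_scale span_base)
    then show "AE x in affine_volume F. u \<bullet> x = c"
      unfolding vol by (subst AE_distr_iff) auto
    fix X :: "'a set" assume X[measurable]: "X \<in> sets borel"
    have "emeasure lborel X = emeasure (distr lborel borel ((+) p)) X"
      using lborel_distr_plus[of p] by (simp cong: distr_cong)
    also have "\<dots> = emeasure (distr (\<Pi>\<^sub>M b\<in>?O. lborel) borel (\<lambda>f. p + (\<Sum>b\<in>?O. f b *\<^sub>R b))) X"
      using B(2) u fin
      by (subst lborel_eq_orthonormal_coordinates[OF _ orth _ cardO]) (auto simp: distr_distr comp_def)
    also have "\<dots> = (\<integral>\<^sup>+f. indicator X (p + (\<Sum>b\<in>?O. f b *\<^sub>R b)) \<partial>(\<Pi>\<^sub>M b\<in>?O. lborel))"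
      using measO by (subst nn_integral_indicator[symmetric], simp, subst nn_integral_distr) auto
    also have "\<dots> = (\<integral>\<^sup>+f. \<integral>\<^sup>+s. indicator X (p + (\<Sum>b\<in>?O. (f(u := s)) b *\<^sub>R b)) \<partial>lborel \<partial>(\<Pi>\<^sub>M b\<in>B. lborel))"
      using fin uB by (subst product_nn_integral_insert) auto
    also have "\<dots> = (\<integral>\<^sup>+f. emeasure lborel {s. (p + (\<Sum>b\<in>B. f b *\<^sub>R b)) + s *\<^sub>R u \<in> X} \<partial>(\<Pi>\<^sub>M b\<in>B. lborel))"
    proof (rule nn_integral_cong)
      fix f
      have "(\<Sum>b\<in>?O. (f(u := s)) b *\<^sub>R b) = s *\<^sub>R u + (\<Sum>b\<in>B. f b *\<^sub>R b)" for s
        using fin uB by (auto intro!: sum.cong)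
      then have eq: "(\<integral>\<^sup>+s. indicator X (p + (\<Sum>b\<in>?O. (f(u := s)) b *\<^sub>R b)) \<partial>lborel)
          = (\<integral>\<^sup>+s. indicator {s. (p + (\<Sum>b\<in>B. f b *\<^sub>R b)) + s *\<^sub>R u \<in> X} s \<partial>lborel)"
        by (intro nn_integral_cong) (auto simp: indicator_def algebra_simps)
      then show "(\<integral>\<^sup>+s. indicator X (p + (\<Sum>b\<in>?O. (f(u := s)) b *\<^sub>R b)) \<partial>lborel)
          = emeasure lborel {s. (p + (\<Sum>b\<in>B. f b *\<^sub>R b)) + s *\<^sub>R u \<in> X}"
      proof -
        have "{s. (p + (\<Sum>b\<in>B. f b *\<^sub>R b)) + s *\<^sub>R u \<in> X} \<in> sets borel" by measurable
        then show ?thesis unfolding eq by simp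
      qed
    qed
    also have "\<dots> = (\<integral>\<^sup>+x. emeasure lborel {s. x + s *\<^sub>R u \<in> X} \<partial>affine_volume F)"
    proof -
      have "(\<lambda>x. emeasure lborel {s. x + s *\<^sub>R u \<in> X}) \<in> borel_measurable borel"
      proof -
        have "{z :: 'a \<times> real. fst z + snd z *\<^sub>R u \<in> X} \<in> sets (borel \<Otimes>\<^sub>M lborel)"
        proof -
          have "(\<lambda>z :: 'a \<times> real. fst z + snd z *\<^sub>R u) \<in> borel \<Otimes>\<^sub>M lborel \<rightarrow>\<^sub>M borel" by measurable
          from measurable_sets[OF this X] show ?thesis by (simp add: vimage_def space_pair_measure)
        qed
        from lborel.measurable_emeasure_Pair[OF this] show ?thesis by (simp add: vimage_def)
      qed
      then show ?thesis unfolding vol by (subst nn_integral_distr) auto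
    qed
    finally show "emeasure lborel X = (\<integral>\<^sup>+x. emeasure lborel {s. x + s *\<^sub>R u \<in> X} \<partial>affine_volume F)" .
  qed
qed


section \<open>First variation of a polytope under moving half-spaces\<close>

text \<open>The signed indicator of the points between 0 and \<open>h\<close>; it records how far a face has
  been moved, outwards or inwards.\<close>

lemma integral_signed_interval:
  fixes h :: real
  defines "k \<equiv> \<lambda>s. indicator {..h} s - indicator {..0} s :: real"
  shows "integrable lborel k" and "(\<integral>s. k s \<partial>lborel) = h"
proof -
  have "(LBINT s. indicator {0<..h} s - indicator {h<..0} s :: real) = h"
    by (cases "0 \<le> h") auto
  moreover have "integrable lborel (\<lambda>s. indicator {0<..h} s - indicator {h<..0} s :: real)"
    by (intro Bochner_Integration.integrable_diff integrable_real_indicator emeasure_bounded_finite) auto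
  moreover have "k = (\<lambda>s. indicator {0<..h} s - indicator {h<..0} s)"
    by (auto simp: k_def indicator_def)
  ultimately show "integrable lborel k" "(\<integral>s. k s \<partial>lborel) = h" by auto
qed

lemma set_integrable_compact:
  fixes f :: "'a::euclidean_space \<Rightarrow> real"
  assumes "compact K" "continuous_on UNIV f"
  shows "set_integrable lborel K f"
  using borel_integrable_compact[OF assms(1), of f] assms(2)
  by (simp add: set_integrable_def indicator_scaleR_eq_if continuous_on_subset)

text \<open>A polytope with interior point \<open>x0\<close>, given by irredundant inequalities with unit normals, and
  the volumes of the bounding hyperplanes.\<close>

locale polytope_halfspaces =
  fixes I :: "'i set" and u :: "'i \<Rightarrow> 'a::euclidean_space" and c :: "'i \<Rightarrow> real"
    and M :: "'i \<Rightarrow> 'a measure" and P :: "'a set" and x0 :: 'a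
  assumes fin: "finite I"
    and P_eq: "P = {x. \<forall>i\<in>I. u i \<bullet> x \<le> c i}"
    and bdd: "bounded P"
    and chart: "\<And>i. i \<in> I \<Longrightarrow> hyperplane_chart (u i) (c i) (M i)"
    and centre: "\<And>i. i \<in> I \<Longrightarrow> u i \<bullet> x0 < c i"
    and facet_point: "\<And>i. i \<in> I \<Longrightarrow> \<exists>p. u i \<bullet> p = c i \<and> (\<forall>j\<in>I - {i}. u j \<bullet> p < c j)"
begin

definition face :: "'i \<Rightarrow> 'a set" where
  "face i = {x \<in> P. u i \<bullet> x = c i}"

lemma mem_P: "x \<in> P \<longleftrightarrow> (\<forall>i\<in>I. u i \<bullet> x \<le> c i)"
  by (subst P_eq) simp

lemma mem_face: "x \<in> face i \<longleftrightarrow> (\<forall>j\<in>I. u j \<bullet> x \<le> c j) \<and> u i \<bullet> x = c i"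
  by (simp add: face_def mem_P)

text \<open>Every half-space is moved and tilted at a constant rate. It remains a half-space because
  the rate is an affine function of the position.\<close>

definition deformed :: "('i \<Rightarrow> 'a) \<Rightarrow> ('i \<Rightarrow> real) \<Rightarrow> real \<Rightarrow> 'a set" where
  "deformed a b t = {x. \<forall>i\<in>I. u i \<bullet> x \<le> c i + t * (a i \<bullet> x + b i)}"

lemma deformed_0 [simp]: "deformed a b 0 = P"
  by (simp add: deformed_def P_eq)

lemma norm_u [simp]: "i \<in> I \<Longrightarrow> norm (u i) = 1"
  using chart by (auto simp: hyperplane_chart_def)

lemma closed_deformed: "closed (deformed a b t)"
proof -
  have "deformed a b t = (\<Inter>i\<in>I. {x. u i \<bullet> x \<le> c i + t * (a i \<bullet> x + b i)})"
    by (auto simp: deformed_def)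
  moreover have "closed {x. u i \<bullet> x \<le> c i + t * (a i \<bullet> x + b i)}" for i
    by (intro closed_Collect_le continuous_intros)
  ultimately show ?thesis by auto
qed

lemma convex_deformed: "convex (deformed a b t)"
proof -
  have "deformed a b t = (\<Inter>i\<in>I. {x. (u i - t *\<^sub>R a i) \<bullet> x \<le> c i + t * b i})"
    by (auto simp: deformed_def algebra_simps inner_diff_left)
  then show ?thesis by (auto intro!: convex_INT convex_halfspace_le)
qed

lemma compact_P: "compact P"
  using closed_deformed[of _ _ 0] bdd by (simp add: compact_eq_bounded_closed)

lemma slack:
  obtains \<eta> where "0 < \<eta>" "\<And>i. i \<in> I \<Longrightarrow> u i \<bullet> x0 + \<eta> \<le> c i"
proof -
  define \<eta> where "\<eta> = Min (insert 1 ((\<lambda>i. c i - u i \<bullet> x0) ` I))"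
  have "0 < \<eta>" unfolding \<eta>_def using fin centre by (subst Min_gr_iff) auto
  moreover have "u i \<bullet> x0 + \<eta> \<le> c i" if "i \<in> I" for i
  proof -
    have "\<eta> \<le> c i - u i \<bullet> x0" unfolding \<eta>_def using fin that by (intro Min_le) auto
    then show ?thesis by simp
  qed
  ultimately show ?thesis by (rule that)
qed

lemma P_in_cball:
  obtains R where "1 \<le> R" "P \<subseteq> cball x0 R"
proof -
  obtain e where "\<forall>x\<in>P. dist x0 x \<le> e" using bdd bounded_any_center[of P x0] by auto
  then show ?thesis by (intro that[of "max 1 e"]) auto
qed

text \<open>If \<open>x\<close> satisfies the deformed inequalities, then a point of the segment from \<open>x0\<close> to \<open>x\<close>
  satisfies the original ones, and for small \<open>t\<close> the position of that point does not
  depend on the size of \<open>x\<close> so strongly that \<open>x\<close> could escape to infinity.\<close>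

lemma deformed_bounded:
  obtains R where "P \<subseteq> cball x0 R" "\<forall>\<^sub>F t in at_right 0. deformed a b t \<subseteq> cball x0 R"
proof -
  obtain \<eta> where \<eta>: "0 < \<eta>" "\<And>i. i \<in> I \<Longrightarrow> u i \<bullet> x0 + \<eta> \<le> c i" by (rule slack) blast
  obtain R where R: "1 \<le> R" "P \<subseteq> cball x0 R" by (rule P_in_cball)
  define A where "A = 1 + (\<Sum>i\<in>I. norm (a i) + \<bar>a i \<bullet> x0 + b i\<bar>)"
  have A: "norm (a i) \<le> A" "\<bar>a i \<bullet> x0 + b i\<bar> \<le> A" if "i \<in> I" for i
    using member_le_sum[OF that, of "\<lambda>i. norm (a i) + \<bar>a i \<bullet> x0 + b i\<bar>"] fin
    by (auto simp: A_def) (smt (verit) norm_ge_zero)+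
  have A1: "1 \<le> A" unfolding A_def by (simp add: sum_nonneg)
  have main: "dist x0 x \<le> 4 * R" if t: "0 < t" "t < \<eta> / (2 * R * A)" and x: "x \<in> deformed a b t" for t x
  proof -
    define D where "D = dist x0 x"
    \<comment> \<open>the largest \<open>\<theta>\<close> for which the slack \<open>\<eta>\<close> at \<open>x0\<close> compensates the violation at \<open>x\<close>\<close>
    define \<theta> where "\<theta> = \<eta> / (\<eta> + t * A * D + t * A)"
    have D0: "0 \<le> D" by (simp add: D_def)
    have tA: "0 < t * A" using t A1 by simp
    have den: "0 < \<eta> + t * A * D + t * A" using \<eta> tA D0 by (simp add: add_pos_nonneg add_nonneg_pos)
    have th: "0 < \<theta>" using \<eta> den by (simp add: \<theta>_def)
    have thle: "\<theta> * (\<eta> + t * A * D + t * A) = \<eta>" using den by (simp add: \<theta>_def)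
    have "x0 + \<theta> *\<^sub>R (x - x0) \<in> P"
      unfolding P_eq
    proof safe
      fix i assume i: "i \<in> I"
      have "a i \<bullet> x + b i = a i \<bullet> (x - x0) + (a i \<bullet> x0 + b i)" by (simp add: inner_diff_right)
      also have "\<dots> \<le> norm (a i) * norm (x - x0) + A"
        using norm_cauchy_schwarz[of "a i" "x - x0"] A(2)[OF i] by linarith
      also have "\<dots> \<le> A * D + A"
        using A(1)[OF i] by (simp add: D_def dist_norm norm_minus_commute mult_right_mono)
      finally have "t * (a i \<bullet> x + b i) \<le> t * (A * D + A)" using t by simp
      moreover have "u i \<bullet> x \<le> c i + t * (a i \<bullet> x + b i)" using x i by (auto simp: deformed_def)
      ultimately have ux: "u i \<bullet> x \<le> c i + t * A * D + t * A" by (simp add: algebra_simps)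
      have "u i \<bullet> (x0 + \<theta> *\<^sub>R (x - x0)) = u i \<bullet> x0 + \<theta> * (u i \<bullet> x - u i \<bullet> x0)"
        by (simp add: inner_add_right inner_diff_right)
      also have "\<dots> \<le> u i \<bullet> x0 + \<theta> * (c i + t * A * D + t * A - u i \<bullet> x0)"
        using ux th by (intro add_left_mono mult_left_mono) auto
      also have "\<dots> = u i \<bullet> x0 + \<theta> * (c i - u i \<bullet> x0 - \<eta>) + \<eta>"
        using thle by (simp add: algebra_simps)
      also have "\<dots> \<le> u i \<bullet> x0 + 1 * (c i - u i \<bullet> x0 - \<eta>) + \<eta>"
      proof -
        have "\<theta> \<le> 1" using tA D0 \<eta> den t A1 unfolding \<theta>_def by (subst divide_le_eq_1) auto
        then show ?thesis using \<eta>(2)[OF i] by (intro add_mono mult_right_mono) auto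
      qed
      finally show "u i \<bullet> (x0 + \<theta> *\<^sub>R (x - x0)) \<le> c i" by simp
    qed
    then have "dist x0 (x0 + \<theta> *\<^sub>R (x - x0)) \<le> R" using R by auto
    then have "\<theta> * D \<le> R" using th by (simp add: dist_norm D_def norm_minus_commute)
    then have "\<eta> * D \<le> R * (\<eta> + t * A * D + t * A)"
      using den by (simp add: \<theta>_def field_simps)
    also have "\<dots> = R * \<eta> + (t * (R * A)) * D + t * (R * A)" by (simp add: algebra_simps)
    finally have 1: "\<eta> * D \<le> R * \<eta> + (t * (R * A)) * D + t * (R * A)" .
    have tRA: "t * (R * A) \<le> \<eta> / 2"
      using t R A1 by (simp add: field_simps)
    then have "(t * (R * A)) * D \<le> \<eta> / 2 * D" using D0 by (rule mult_right_mono)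
    with 1 tRA have "\<eta> * D \<le> R * \<eta> + \<eta> / 2 * D + \<eta> / 2" by linarith
    then have "\<eta> * D \<le> \<eta> * (2 * R + 1)" by (simp add: algebra_simps)
    then have "D \<le> 2 * R + 1" using \<eta>(1) by simp
    then show ?thesis using R(1) by (simp add: D_def)
  qed
  show ?thesis
  proof (rule that)
    show "P \<subseteq> cball x0 (4 * R)" using R by auto
    have "0 < \<eta> / (2 * R * A)" using \<eta> R A1 by simp
    then show "\<forall>\<^sub>F t in at_right 0. deformed a b t \<subseteq> cball x0 (4 * R)"
      unfolding eventually_at_right_field using main by (intro exI[of _ "\<eta> / (2 * R * A)"]) auto
  qed
qed

lemma deformed_compact: "\<forall>\<^sub>F t in at_right 0. compact (deformed a b t)"
proof -
  obtain R where "\<forall>\<^sub>F t in at_right 0. deformed a b t \<subseteq> cball x0 R" by (rule deformed_bounded)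
  then show ?thesis
    by eventually_elim (metis closed_deformed bounded_subset bounded_cball compact_eq_bounded_closed)
qed

text \<open>The slices of the difference of the two bodies in direction \<open>u i\<close> are rescaled by \<open>1 / t\<close>.
  Then the integrands converge almost everywhere: off the other hyperplanes each of the remaining
  inequalities eventually has the truth value that it has on the hyperplane of \<open>i\<close>.\<close>

lemma move_one_halfspace:
  fixes f :: "'a \<Rightarrow> real"
  assumes i: "i \<in> I" and a0: "a i = 0" and b0: "b i = 0" and perp: "\<alpha> \<bullet> u i = 0"
    and f: "continuous_on UNIV f"
  shows "((\<lambda>t. ((LINT x:deformed (a(i := \<alpha>)) (b(i := \<beta>)) t|lborel. f x)
              - (LINT x:deformed a b t|lborel. f x)) / t)
           \<longlongrightarrow> (LINT x:face i|M i. f x * (\<alpha> \<bullet> x + \<beta>))) (at_right 0)"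
proof -
  interpret hyperplane_chart "u i" "c i" "M i" using i by (rule chart)
  let ?a = "a(i := \<alpha>)" and ?b = "b(i := \<beta>)"
  define h where "h x = \<alpha> \<bullet> x + \<beta>" for x
  have hs: "h (x + s *\<^sub>R u i) = h x" for x s using perp by (simp add: h_def inner_add_right)
  obtain R1 where R1: "\<forall>\<^sub>F t in at_right 0. deformed a b t \<subseteq> cball x0 R1" "P \<subseteq> cball x0 R1" by (rule deformed_bounded)
  obtain R2 where R2: "\<forall>\<^sub>F t in at_right 0. deformed ?a ?b t \<subseteq> cball x0 R2" by (rule deformed_bounded)
  define R where "R = max R1 R2"
  \<comment> \<open>a cutoff that makes the integrands bounded and does not affect the bodies\<close>
  define \<kappa> where "\<kappa> y = max 0 (min 1 (R + 1 - dist x0 y))" for y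
  define F where "F y = f y * \<kappa> y" for y
  have Fc: "continuous_on UNIV F" unfolding F_def \<kappa>_def using f by (intro continuous_intros)
  have [measurable]: "F \<in> borel_measurable borel" "h \<in> borel_measurable borel" "f \<in> borel_measurable borel"
    using Fc f unfolding h_def by (auto intro!: borel_measurable_continuous_onI continuous_intros)
  have Ff: "F y = f y" if "y \<in> cball x0 R" for y using that by (simp add: F_def \<kappa>_def)
  have F0: "F y = 0" if "y \<notin> cball x0 (R + 1)" for y using that by (simp add: F_def \<kappa>_def)
  obtain C where C: "\<And>y. \<bar>F y\<bar> \<le> C"
  proof -
    have "bounded (F ` cball x0 (R + 1))"
      using Fc by (intro compact_imp_bounded compact_continuous_image) (auto intro: continuous_on_subset)
    then obtain C where "\<forall>y\<in>cball x0 (R + 1). \<bar>F y\<bar> \<le> C"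
      unfolding bounded_iff ball_simps(9) real_norm_def by blast
    then have "\<bar>F y\<bar> \<le> max C 0" for y
      using F0[of y] by (cases "y \<in> cball x0 (R + 1)") (auto simp: le_max_iff_disj simp del: mem_cball)
    then show ?thesis by (rule that)
  qed
  have C0: "0 \<le> C" using C[of x0] by linarith
  define Q where "Q t = {x. \<forall>j\<in>I - {i}. u j \<bullet> x \<le> c j + t * (a j \<bullet> x + b j)}" for t
  have Qm[measurable]: "Q t \<in> sets borel" for t
  proof -
    have "Q t = (\<Inter>j\<in>I - {i}. {x. u j \<bullet> x \<le> c j + t * (a j \<bullet> x + b j)})" by (auto simp: Q_def)
    then have "closed (Q t)" by (auto intro!: closed_INT closed_Collect_le continuous_intros)
    then show ?thesis by simp
  qed
  have D: "deformed a b t = Q t \<inter> {x. u i \<bullet> x - c i \<le> 0}"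
    "deformed ?a ?b t = Q t \<inter> {x. u i \<bullet> x - c i \<le> t * h x}" for t
    using i a0 b0 by (auto simp: deformed_def Q_def h_def algebra_simps)
  define \<Phi> where "\<Phi> t y = F y * indicator (Q t) y * (indicator {s. s \<le> t * h y} (u i \<bullet> y - c i) - indicator {..0} (u i \<bullet> y - c i))" for t y
  \<comment> \<open>\<open>\<Phi>\<close> in the coordinates \<open>x + t s u i\<close>, in which the moving face stays at distance of order 1\<close>
  define G where "G t z = F (fst z + (t * snd z) *\<^sub>R u i) * indicator (Q t) (fst z + (t * snd z) *\<^sub>R u i)
      * (indicator {..h (fst z)} (snd z) - indicator {..0} (snd z))" for t and z :: "'a \<times> real"
  define q where "q = foot x0"
  have q: "u i \<bullet> q = c i" by (simp add: q_def)
  define R' where "R' = R + 1 + dist x0 q"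
  define H where "H = norm \<alpha> * R' + \<bar>h q\<bar>"
  have near: "x \<in> cball q R'" if "u i \<bullet> x = c i" "x + s *\<^sub>R u i \<in> cball x0 (R + 1)" for x s
  proof -
    have "norm (x - q) \<le> norm (x + s *\<^sub>R u i - q)"
      using norm_foot_le[OF q, of "x + s *\<^sub>R u i"] foot_shift[OF that(1)] by simp
    also have "\<dots> = dist (x + s *\<^sub>R u i) q" by (simp add: dist_norm)
    also have "\<dots> \<le> dist (x + s *\<^sub>R u i) x0 + dist x0 q" by (rule dist_triangle)
    finally show ?thesis using that(2) by (simp add: R'_def dist_norm norm_minus_commute)
  qed
  have hH: "\<bar>h x\<bar> \<le> H" if "x \<in> cball q R'" for x
  proof -
    have "h x = \<alpha> \<bullet> (x - q) + h q" by (simp add: h_def inner_diff_right)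
    moreover have "\<bar>\<alpha> \<bullet> (x - q)\<bar> \<le> norm \<alpha> * norm (x - q)" by (rule Cauchy_Schwarz_ineq2)
    moreover have "norm \<alpha> * norm (x - q) \<le> norm \<alpha> * R'"
      using that by (intro mult_left_mono) (auto simp: dist_norm norm_minus_commute)
    ultimately show ?thesis unfolding H_def by linarith
  qed
  define W where "W z = C * (indicator (cball q R') (fst z) * indicator {-H..H} (snd z))" for z :: "'a \<times> real"
  have Wi: "integrable (M i \<Otimes>\<^sub>M lborel) W"
  proof -
    have "emeasure (M i \<Otimes>\<^sub>M lborel) (cball q R' \<times> {-H..H}) = emeasure (M i) (cball q R') * emeasure lborel {-H..H}"
      by (rule lborel.emeasure_pair_measure_Times) auto
    also have "\<dots> < \<infinity>"
      using emeasure_bounded_lt_top[of "cball q R'"] by (auto simp: ennreal_mult_less_top emeasure_lborel_Icc_eq)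
    finally have "integrable (M i \<Otimes>\<^sub>M lborel) (indicator (cball q R' \<times> {-H..H}) :: _ \<Rightarrow> real)"
      by (intro integrable_real_indicator) auto
    then have "integrable (M i \<Otimes>\<^sub>M lborel) (\<lambda>z. C * indicator (cball q R' \<times> {-H..H}) z)" by simp
    moreover have "(\<lambda>z. C * indicator (cball q R' \<times> {-H..H}) z) = W"
      by (auto simp: W_def indicator_times fun_eq_iff)
    ultimately show ?thesis by simp
  qed
  have AEz: "AE z in M i \<Otimes>\<^sub>M (lborel :: real measure). S (fst z)" if "AE x in M i. S x" "Measurable.pred borel S" for S
  proof -
    have "AE x in M i. AE s in (lborel :: real measure). S x"
      using that(1) by (auto elim: eventually_mono)
    moreover have "{z \<in> space (M i \<Otimes>\<^sub>M (lborel :: real measure)). S (fst z)} \<in> sets (M i \<Otimes>\<^sub>M lborel)"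
      using that(2) by measurable
    ultimately show ?thesis using chart.AE_pair_measure[of "\<lambda>z. S (fst z)"] by simp
  qed
  have onh: "AE z in M i \<Otimes>\<^sub>M (lborel :: real measure). u i \<bullet> fst z = c i"
    by (rule AEz[OF on_hyperplane]) measurable
  have GW: "AE z in M i \<Otimes>\<^sub>M lborel. norm (G t z) \<le> W z" for t
    using onh
  proof eventually_elim
    case (elim z)
    obtain x s where z: "z = (x, s)" by (cases z)
    show ?case
    proof (cases "G t z = 0")
      case True
      then show ?thesis using C0 by (simp add: W_def)
    next
      case False
      then have F': "F (x + (t * s) *\<^sub>R u i) \<noteq> 0" and k: "indicator {..h x} s - indicator {..0} s \<noteq> (0::real)"
        by (auto simp: G_def z)
      have x: "x \<in> cball q R'"
        using F0 F' elim z near[of x "t * s"] by auto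
      have "\<bar>s\<bar> \<le> \<bar>h x\<bar>" using k by (cases "s \<le> h x"; cases "s \<le> 0") auto
      then have "s \<in> {-H..H}" using hH[OF x] by auto
      then have "W z = C" using x by (simp add: W_def z)
      moreover have "norm (G t z) \<le> \<bar>F (x + (t * s) *\<^sub>R u i)\<bar> * 1 * 1"
        unfolding G_def z real_norm_def abs_mult
        by (intro mult_mono) (auto simp: indicator_def)
      ultimately show ?thesis using C[of "x + (t * s) *\<^sub>R u i"] by simp
    qed
  qed
  have ind: "(\<lambda>z :: 'a \<times> real. indicator {..h (fst z)} (snd z) - indicator {..0} (snd z) :: real)
      = (\<lambda>z. (if snd z \<le> h (fst z) then 1 else 0) - (if snd z \<le> 0 then 1 else 0))"
    by (auto simp: fun_eq_iff)
  have [measurable]: "(\<lambda>z :: 'a \<times> real. indicator {..h (fst z)} (snd z) - indicator {..0} (snd z) :: real)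
      \<in> borel_measurable (M i \<Otimes>\<^sub>M lborel)"
    unfolding ind by measurable
  have Gm[measurable]: "G t \<in> borel_measurable (M i \<Otimes>\<^sub>M lborel)" for t
    unfolding G_def by measurable
  have Gi: "integrable (M i \<Otimes>\<^sub>M lborel) (G t)" for t
    by (rule Bochner_Integration.integrable_bound[OF Wi Gm])
      (use GW[of t] in \<open>auto elim!: eventually_mono intro: order_trans\<close>)
  have quot: "((LINT x:deformed ?a ?b t|lborel. f x) - (LINT x:deformed a b t|lborel. f x)) / t
      = (\<integral>z. G t z \<partial>(M i \<Otimes>\<^sub>M lborel))"
    if t: "0 < t" and sub: "deformed a b t \<subseteq> cball x0 R1" "deformed ?a ?b t \<subseteq> cball x0 R2" for t
  proof -
    have cmp: "compact (deformed a b t)" "compact (deformed ?a ?b t)"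
      using sub closed_deformed bounded_subset[OF bounded_cball] by (auto simp: compact_eq_bounded_closed)
    have i1: "integrable lborel (\<lambda>x. indicator (deformed a b t) x * f x)"
         "integrable lborel (\<lambda>x. indicator (deformed ?a ?b t) x * f x)"
      using set_integrable_compact[OF cmp(1) f] set_integrable_compact[OF cmp(2) f] by (auto simp: set_integrable_def)
    have eq: "indicator (deformed ?a ?b t) y * f y - indicator (deformed a b t) y * f y = \<Phi> t y" for y
    proof -
      have "indicator (deformed ?a ?b t) y * f y = indicator (deformed ?a ?b t) y * F y"
        using sub Ff[of y] by (auto simp: indicator_def R_def)
      moreover have "indicator (deformed a b t) y * f y = indicator (deformed a b t) y * F y"
        using sub Ff[of y] by (auto simp: indicator_def R_def)
      ultimately show ?thesis unfolding \<Phi>_def D by (auto simp: indicator_def)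
    qed
    have \<Phi>i: "integrable lborel (\<Phi> t)"
      using Bochner_Integration.integrable_diff[OF i1(2,1)] unfolding eq .
    have "(LINT x:deformed ?a ?b t|lborel. f x) - (LINT x:deformed a b t|lborel. f x) = (\<integral>y. \<Phi> t y \<partial>lborel)"
      using Bochner_Integration.integral_diff[OF i1(2,1)] unfolding eq by (simp add: set_lebesgue_integral_def)
    also have "\<dots> = (\<integral>x. (\<integral>s. \<Phi> t (x + s *\<^sub>R u i) \<partial>lborel) \<partial>M i)"
      by (rule integral_chart(1)[OF \<Phi>i])
    also have "\<dots> = (\<integral>x. t * (\<integral>s. G t (x, s) \<partial>lborel) \<partial>M i)"
    proof (rule integral_cong_AE)
      show "AE x in M i. (\<integral>s. \<Phi> t (x + s *\<^sub>R u i) \<partial>lborel) = t * (\<integral>s. G t (x, s) \<partial>lborel)"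
        using on_hyperplane
      proof eventually_elim
        case (elim x)
        have "(\<integral>s. \<Phi> t (x + s *\<^sub>R u i) \<partial>lborel) = t * (\<integral>s. \<Phi> t (x + (0 + t * s) *\<^sub>R u i) \<partial>lborel)"
          using lborel_integral_real_affine[of t "\<lambda>s. \<Phi> t (x + s *\<^sub>R u i)" 0] t by simp
        also have "(\<lambda>s. \<Phi> t (x + (0 + t * s) *\<^sub>R u i)) = (\<lambda>s. G t (x, s))"
        proof
          fix s
          have "u i \<bullet> (x + (0 + t * s) *\<^sub>R u i) - c i = t * s"
            using elim by (simp add: inner_add_right)
          moreover have "t * s \<le> t * h x \<longleftrightarrow> s \<le> h x" "t * s \<le> 0 \<longleftrightarrow> s \<le> 0"
            using t by (auto simp: mult_le_0_iff)
          ultimately show "\<Phi> t (x + (0 + t * s) *\<^sub>R u i) = G t (x, s)"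
            unfolding \<Phi>_def G_def hs by (simp add: indicator_def)
        qed
        finally show ?case .
      qed
      have [measurable]: "\<Phi> t \<in> borel_measurable borel" using \<Phi>i by simp
      show "(\<lambda>x. \<integral>s. \<Phi> t (x + s *\<^sub>R u i) \<partial>lborel) \<in> borel_measurable (M i)" by measurable
      show "(\<lambda>x. t * (\<integral>s. G t (x, s) \<partial>lborel)) \<in> borel_measurable (M i)" by measurable
    qed
    also have "\<dots> = t * (\<integral>z. G t z \<partial>(M i \<Otimes>\<^sub>M lborel))"
      using chart.integral_fst'[OF Gi] by simp
    finally show ?thesis using t by simp
  qed
  define L where "L z = F (fst z) * indicator (face i) (fst z) * (indicator {..h (fst z)} (snd z) - indicator {..0} (snd z))" for z :: "'a \<times> real"
  have facem[measurable]: "face i \<in> sets borel"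
  proof -
    have "closed (P \<inter> {x. u i \<bullet> x = c i})"
      using compact_P by (intro closed_Int compact_imp_closed closed_hyperplane)
    moreover have "face i = P \<inter> {x. u i \<bullet> x = c i}" by (auto simp: face_def)
    ultimately show ?thesis by simp
  qed
  have off: "AE z in M i \<Otimes>\<^sub>M (lborel :: real measure). \<forall>j\<in>I - {i}. u j \<bullet> fst z \<noteq> c j"
  proof -
    have "AE x in M i. \<forall>j\<in>I - {i}. u j \<bullet> x \<noteq> c j"
    proof (rule AE_finite_allI)
      fix j assume j: "j \<in> I - {i}"
      obtain p where "u i \<bullet> p = c i" "u j \<bullet> p < c j" using facet_point[OF i] j by blast
      then show "AE x in M i. u j \<bullet> x \<noteq> c j" by (intro AE_off_hyperplane[of p]) auto
    qed (use fin in auto)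
    then show ?thesis using fin by (intro AEz) measurable
  qed
  have lim: "(\<lambda>n. G (S n) z) \<longlonglongrightarrow> L z"
    if S: "S \<longlonglongrightarrow> 0" and z: "u i \<bullet> fst z = c i" "\<forall>j\<in>I - {i}. u j \<bullet> fst z \<noteq> c j" for S z
  proof -
    obtain x s where [simp]: "z = (x, s)" by (cases z)
    have pt: "(\<lambda>n. x + (S n * s) *\<^sub>R u i) \<longlonglongrightarrow> x + (0 * s) *\<^sub>R u i"
      by (intro tendsto_intros S)
    then have pt: "(\<lambda>n. x + (S n * s) *\<^sub>R u i) \<longlonglongrightarrow> x" by simp
    have "(\<lambda>n. F (x + (S n * s) *\<^sub>R u i)) \<longlonglongrightarrow> F x"
      using Fc pt by (metis UNIV_I continuous_on_eq_continuous_at isCont_tendsto_compose open_UNIV)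
    moreover have "(\<lambda>n. indicator (Q (S n)) (x + (S n * s) *\<^sub>R u i) :: real) \<longlonglongrightarrow> indicator (face i) x"
    proof (rule tendsto_eventually)
      have ev: "\<forall>\<^sub>F n in sequentially. (u j \<bullet> (x + (S n * s) *\<^sub>R u i) \<le> c j + S n * (a j \<bullet> (x + (S n * s) *\<^sub>R u i) + b j)) = (u j \<bullet> x \<le> c j)"
        if j: "j \<in> I - {i}" for j
      proof -
        have "(\<lambda>n. c j + S n * (a j \<bullet> (x + (S n * s) *\<^sub>R u i) + b j) - u j \<bullet> (x + (S n * s) *\<^sub>R u i)) \<longlonglongrightarrow> c j + 0 * (a j \<bullet> x + b j) - u j \<bullet> x"
          by (intro tendsto_intros S pt)
        then have l: "(\<lambda>n. c j + S n * (a j \<bullet> (x + (S n * s) *\<^sub>R u i) + b j) - u j \<bullet> (x + (S n * s) *\<^sub>R u i)) \<longlonglongrightarrow> c j - u j \<bullet> x" by simp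
        show ?thesis
        proof (cases "u j \<bullet> x < c j")
          case True
          then have "0 < c j - u j \<bullet> x" by simp
          from order_tendstoD(1)[OF l this] show ?thesis
            by eventually_elim (use True in auto)
        next
          case False
          moreover have ne: "u j \<bullet> x \<noteq> c j" using z(2) j by simp
          ultimately have "c j - u j \<bullet> x < 0" by simp
          from order_tendstoD(2)[OF l this] show ?thesis
            by eventually_elim (use False ne in auto)
        qed
      qed
      have "\<forall>\<^sub>F n in sequentially. \<forall>j\<in>I - {i}. (u j \<bullet> (x + (S n * s) *\<^sub>R u i) \<le> c j + S n * (a j \<bullet> (x + (S n * s) *\<^sub>R u i) + b j)) = (u j \<bullet> x \<le> c j)"
        using fin ev by (intro eventually_ball_finite) auto
      then show "\<forall>\<^sub>F n in sequentially. indicator (Q (S n)) (x + (S n * s) *\<^sub>R u i) = (indicator (face i) x :: real)"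
      proof eventually_elim
        case (elim n)
        have "x + (S n * s) *\<^sub>R u i \<in> Q (S n) \<longleftrightarrow> (\<forall>j\<in>I - {i}. u j \<bullet> x \<le> c j)"
          using elim unfolding Q_def by blast
        also have "\<dots> \<longleftrightarrow> x \<in> face i" using z i by (auto simp: mem_face)
        finally show ?case by (simp add: indicator_def)
      qed
    qed
    ultimately show ?thesis
      unfolding G_def L_def by (auto intro!: tendsto_intros)
  qed
  have Lm[measurable]: "L \<in> borel_measurable (M i \<Otimes>\<^sub>M lborel)" unfolding L_def by measurable
  have conv: "(\<lambda>n. \<integral>z. G (S n) z \<partial>(M i \<Otimes>\<^sub>M lborel)) \<longlonglongrightarrow> (\<integral>z. L z \<partial>(M i \<Otimes>\<^sub>M lborel))"
    if S: "S \<longlonglongrightarrow> 0" for S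
  proof (rule integral_dominated_convergence[OF Lm Gm Wi])
    show "AE z in M i \<Otimes>\<^sub>M lborel. (\<lambda>n. G (S n) z) \<longlonglongrightarrow> L z"
      using onh off by eventually_elim (rule lim[OF S])
  qed (rule GW)
  have Li: "integrable (M i \<Otimes>\<^sub>M lborel) L"
  proof (rule Bochner_Integration.integrable_bound[OF Wi Lm])
    show "AE z in M i \<Otimes>\<^sub>M lborel. norm (L z) \<le> norm (W z)"
      using onh
    proof eventually_elim
      case (elim z)
      have "norm (L z) \<le> norm (F (fst z) * 1 * (indicator {..h (fst z)} (snd z) - indicator {..0} (snd z)))"
        unfolding L_def norm_mult by (intro mult_right_mono mult_left_mono) (auto simp: indicator_def)
      also have "\<dots> \<le> norm (W z)"
      proof (cases "F (fst z) = 0 \<or> indicator {..h (fst z)} (snd z) - indicator {..0} (snd z) = (0::real)")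
        case False
        then have "fst z \<in> cball q R'" using F0[of "fst z"] near[of "fst z" 0] elim by auto
        moreover have "\<bar>snd z\<bar> \<le> \<bar>h (fst z)\<bar>" using False
          by (cases "snd z \<le> h (fst z)"; cases "snd z \<le> 0") auto
        moreover have "snd z \<in> {-H..H}"
          using hH[OF \<open>fst z \<in> cball q R'\<close>] \<open>\<bar>snd z\<bar> \<le> \<bar>h (fst z)\<bar>\<close> by auto
        ultimately have "W z = C" by (simp add: W_def)
        moreover have "norm (F (fst z) * 1 * (indicator {..h (fst z)} (snd z) - indicator {..0} (snd z))) \<le> \<bar>F (fst z)\<bar>"
          by (auto simp: indicator_def)
        ultimately show ?thesis using C[of "fst z"] C0 unfolding real_norm_def by linarith
      qed auto
      finally show ?case .
    qed
  qed
  have "(\<integral>z. L z \<partial>(M i \<Otimes>\<^sub>M lborel)) = (\<integral>x. (\<integral>s. L (x, s) \<partial>lborel) \<partial>M i)"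
    using chart.integral_fst'[OF Li] by simp
  also have "\<dots> = (\<integral>x. F x * indicator (face i) x * h x \<partial>M i)"
    unfolding L_def using integral_signed_interval by simp
  also have "\<dots> = (LINT x:face i|M i. f x * (\<alpha> \<bullet> x + \<beta>))"
    unfolding set_lebesgue_integral_def
  proof (rule Bochner_Integration.integral_cong)
    fix x
    have "F x = f x" if "x \<in> face i" using that R1(2) by (intro Ff) (auto simp: face_def R_def)
    then show "F x * indicator (face i) x * h x = indicator (face i) x *\<^sub>R (f x * (\<alpha> \<bullet> x + \<beta>))"
      by (auto simp: indicator_def h_def)
  qed simp
  finally have Lval: "(\<integral>z. L z \<partial>(M i \<Otimes>\<^sub>M lborel)) = (LINT x:face i|M i. f x * (\<alpha> \<bullet> x + \<beta>))" .
  have "((\<lambda>t. \<integral>z. G t z \<partial>(M i \<Otimes>\<^sub>M lborel)) \<longlongrightarrow> (LINT x:face i|M i. f x * (\<alpha> \<bullet> x + \<beta>))) (at_right 0)"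
    using conv unfolding Lval[symmetric] by (intro tendsto_at_right_sequentially[of 0 1]) auto
  then show ?thesis
  proof (rule Lim_transform_eventually)
    show "\<forall>\<^sub>F t in at_right 0. (\<integral>z. G t z \<partial>(M i \<Otimes>\<^sub>M lborel)) =
        ((LINT x:deformed ?a ?b t|lborel. f x) - (LINT x:deformed a b t|lborel. f x)) / t"
      using R1(1) R2 eventually_at_right_less[of 0] by eventually_elim (rule quot[symmetric])
  qed
qed

text \<open>The half-spaces are moved one after the other. When one of them moves, those moved before are
  already in their new position, but this does not affect the limit.\<close>

theorem first_variation:
  fixes f :: "'a \<Rightarrow> real"
  assumes perp: "\<And>i. i \<in> I \<Longrightarrow> a i \<bullet> u i = 0" and f: "continuous_on UNIV f"
  shows "((\<lambda>t. ((LINT x:deformed a b t|lborel. f x) - (LINT x:P|lborel. f x)) / t)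
           \<longlongrightarrow> (\<Sum>i\<in>I. LINT x:face i|M i. f x * (a i \<bullet> x + b i))) (at_right 0)"
proof -
  define A B where "A G i = (if i \<in> G then a i else 0)" and "B G i = (if i \<in> G then b i else 0)" for G i
  have "((\<lambda>t. ((LINT x:deformed (A G) (B G) t|lborel. f x) - (LINT x:P|lborel. f x)) / t)
           \<longlongrightarrow> (\<Sum>i\<in>G. LINT x:face i|M i. f x * (a i \<bullet> x + b i))) (at_right 0)" if "G \<subseteq> I" for G
    using finite_subset[OF that fin] that
  proof (induction G rule: finite_induct)
    case empty
    have "deformed (A {}) (B {}) t = P" for t by (simp add: deformed_def P_eq A_def B_def)
    then show ?case by simp
  next
    case (insert i G)
    have upd: "A (insert i G) = (A G)(i := a i)" "B (insert i G) = (B G)(i := b i)"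
      by (auto simp: A_def B_def)
    have "((\<lambda>t. ((LINT x:deformed (A (insert i G)) (B (insert i G)) t|lborel. f x)
              - (LINT x:deformed (A G) (B G) t|lborel. f x)) / t)
           \<longlongrightarrow> (LINT x:face i|M i. f x * (a i \<bullet> x + b i))) (at_right 0)"
      unfolding upd using insert perp f by (intro move_one_halfspace) (auto simp: A_def B_def)
    from tendsto_add[OF this insert.IH] insert show ?case
      by (simp add: diff_divide_distrib)
  qed
  from this[of I] have "((\<lambda>t. ((LINT x:deformed (A I) (B I) t|lborel. f x) - (LINT x:P|lborel. f x)) / t)
           \<longlongrightarrow> (\<Sum>i\<in>I. LINT x:face i|M i. f x * (a i \<bullet> x + b i))) (at_right 0)" by simp
  moreover have "deformed (A I) (B I) = deformed a b"
    by (auto simp: deformed_def A_def B_def fun_eq_iff)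
  ultimately show ?thesis by simp
qed

end


section \<open>Convex bodies close to a polytope\<close>

lemma emeasure_lborel_reflect:
  fixes A :: "'a::euclidean_space set"
  assumes [measurable]: "A \<in> sets borel"
  shows "emeasure lborel {y. 2 *\<^sub>R x - y \<in> A} = emeasure lborel A"
proof -
  have "lborel = density (distr lborel borel ((-) (2 *\<^sub>R x))) (\<lambda>_. 1)"
    using lborel_affine[of "-1" "2 *\<^sub>R x"] by simp
  then have "emeasure lborel A = emeasure (density (distr lborel borel ((-) (2 *\<^sub>R x))) (\<lambda>_. 1)) A"
    by (rule arg_cong)
  also have "\<dots> = emeasure (distr lborel borel ((-) (2 *\<^sub>R x))) A"
    by (simp only: density_1)
  also have "\<dots> = emeasure lborel {y. 2 *\<^sub>R x - y \<in> A}"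
    by (subst emeasure_distr) (auto simp: vimage_def)
  finally show ?thesis ..
qed

text \<open>A convex set missing \<open>x\<close> contains at most one of any two points symmetric about \<open>x\<close>.\<close>

lemma half_ball_outside_convex:
  fixes K :: "'a::euclidean_space set"
  assumes K: "convex K" "K \<in> sets borel" and x: "x \<notin> K"
  shows "measure lborel (ball x r) \<le> 2 * measure lborel (ball x r - K)"
proof -
  have [measurable]: "ball x r \<in> sets borel" "K \<in> sets borel" using open_ball borel_open K by blast+
  have fin: "emeasure lborel A < \<infinity>" if "A \<subseteq> ball x r" for A
    using emeasure_bounded_finite[OF bounded_subset[OF bounded_ball that]] .
  have sub: "{y. 2 *\<^sub>R x - y \<in> ball x r \<inter> K} \<subseteq> ball x r - K"
  proof safe
    fix y assume "2 *\<^sub>R x - y \<in> ball x r"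
    moreover have "x - (2 *\<^sub>R x - y) = - (x - y)" by (simp add: scaleR_2)
    then have "dist x (2 *\<^sub>R x - y) = dist x y" by (simp only: dist_norm norm_minus_cancel)
    ultimately show "y \<in> ball x r" by simp
  next
    fix y assume "2 *\<^sub>R x - y \<in> K" "y \<in> K"
    then have "(1/2) *\<^sub>R (2 *\<^sub>R x - y) + (1/2) *\<^sub>R y \<in> K"
      using K(1) by (intro convexD) auto
    then show False using x by (simp add: algebra_simps)
  qed
  have "emeasure lborel (ball x r \<inter> K) = emeasure lborel {y. 2 *\<^sub>R x - y \<in> ball x r \<inter> K}"
    by (rule emeasure_lborel_reflect[symmetric]) measurable
  also have "\<dots> \<le> emeasure lborel (ball x r - K)"
    using sub by (intro emeasure_mono) auto
  finally have "emeasure lborel (ball x r \<inter> K) \<le> emeasure lborel (ball x r - K)" .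
  then have "measure lborel (ball x r \<inter> K) \<le> measure lborel (ball x r - K)"
    unfolding measure_def using fin[of "ball x r - K"] by (intro enn2real_mono) auto
  moreover have "measure lborel (ball x r) = measure lborel (ball x r \<inter> K) + measure lborel (ball x r - K)"
    using measure_Un2[of "ball x r \<inter> K" lborel "ball x r - K"] fin[of "ball x r \<inter> K"] fin[of "ball x r - K"]
    by (subst measure_Union[symmetric]) (auto simp: Int_Diff_Un)
  ultimately show ?thesis by simp
qed

text \<open>A ramp from 0 at depth \<open>2 d / 3\<close> to 1 at depth \<open>d / 3\<close>.\<close>

definition cut :: "real \<Rightarrow> real \<Rightarrow> real" where
  "cut d s = max 0 (min 1 (3 / d * s + 2))"

lemma cut_simps:
  assumes "0 < d"
  shows "s \<le> - 2 * d / 3 \<Longrightarrow> cut d s = 0" "- d / 3 \<le> s \<Longrightarrow> cut d s = 1"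
  using assms by (auto simp: cut_def field_simps)

lemma continuous_cut [continuous_intros]:
  "continuous_on S f \<Longrightarrow> continuous_on S (\<lambda>x. cut d (f x))"
  unfolding cut_def by (intro continuous_intros)

lemma cut_measurable [measurable]: "cut d \<in> borel_measurable borel"
  unfolding cut_def by measurable

context polytope_halfspaces
begin

text \<open>The weak derivative enters as an arbitrary functional \<open>D\<close>: what follows depends on its
  values only, and not on its being given by a measure.\<close>

definition perturbs :: "(real \<Rightarrow> 'a set) \<Rightarrow> (('a \<Rightarrow> real) \<Rightarrow> real) \<Rightarrow> bool" where
  "perturbs K D \<longleftrightarrow> (\<forall>\<^sub>F t in at_right 0. compact (K t) \<and> convex (K t)) \<and>
     (\<forall>f. continuous_on UNIV f \<longrightarrow>
        ((\<lambda>t. ((LINT x:K t|lborel. f x) - (LINT x:P|lborel. f x)) / t) \<longlongrightarrow> D f) (at_right 0))"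

lemma perturbs_ev: "perturbs K D \<Longrightarrow> \<forall>\<^sub>F t in at_right 0. compact (K t) \<and> convex (K t)"
  by (simp add: perturbs_def)

lemma perturbs_lim:
  fixes f :: "'a \<Rightarrow> real"
  shows "perturbs K D \<Longrightarrow> continuous_on UNIV f \<Longrightarrow>
    ((\<lambda>t. ((LINT x:K t|lborel. f x) - (LINT x:P|lborel. f x)) / t) \<longlongrightarrow> D f) (at_right 0)"
  by (simp add: perturbs_def)

lemma perturbs_tendsto:
  fixes f :: "'a \<Rightarrow> real"
  assumes "perturbs K D" "continuous_on UNIV f"
  shows "((\<lambda>t. LINT x:K t|lborel. f x) \<longlongrightarrow> (LINT x:P|lborel. f x)) (at_right 0)"
proof -
  have "((\<lambda>t. t * (((LINT x:K t|lborel. f x) - (LINT x:P|lborel. f x)) / t) + (LINT x:P|lborel. f x)) \<longlongrightarrow> 0 * D f + (LINT x:P|lborel. f x)) (at_right 0)"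
    by (intro tendsto_intros perturbs_lim[OF assms])
  then have l: "((\<lambda>t. t * (((LINT x:K t|lborel. f x) - (LINT x:P|lborel. f x)) / t) + (LINT x:P|lborel. f x)) \<longlongrightarrow> (LINT x:P|lborel. f x)) (at_right 0)"
    by simp
  have "\<forall>\<^sub>F t in at_right 0. t * (((LINT x:K t|lborel. f x) - (LINT x:P|lborel. f x)) / t) + (LINT x:P|lborel. f x) = (LINT x:K t|lborel. f x)"
    using eventually_at_right_less[of 0] by eventually_elim simp
  from Lim_transform_eventually[OF l this] show ?thesis .
qed

lemma perturbs_linear:
  assumes K: "perturbs K D" and f: "continuous_on UNIV f" and g: "continuous_on UNIV g"
  shows "D (\<lambda>x. f x + g x) = D f + D g" "D (\<lambda>x. k * f x) = k * D f"
proof -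
  have int: "set_integrable lborel S h" if "compact S" "continuous_on UNIV h" for S and h :: "'a \<Rightarrow> real"
    using that by (rule set_integrable_compact)
  have ne: "at_right (0::real) \<noteq> bot" by simp
  have "((\<lambda>t. ((LINT x:K t|lborel. f x) - (LINT x:P|lborel. f x)) / t + ((LINT x:K t|lborel. g x) - (LINT x:P|lborel. g x)) / t) \<longlongrightarrow> D f + D g) (at_right 0)"
    by (intro tendsto_intros perturbs_lim[OF K] f g)
  then have "((\<lambda>t. ((LINT x:K t|lborel. f x + g x) - (LINT x:P|lborel. f x + g x)) / t) \<longlongrightarrow> D f + D g) (at_right 0)"
  proof (rule Lim_transform_eventually)
    show "\<forall>\<^sub>F t in at_right 0. ((LINT x:K t|lborel. f x) - (LINT x:P|lborel. f x)) / t + ((LINT x:K t|lborel. g x) - (LINT x:P|lborel. g x)) / t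
        = ((LINT x:K t|lborel. f x + g x) - (LINT x:P|lborel. f x + g x)) / t"
      using perturbs_ev[OF K]
      by eventually_elim (use int compact_P f g in \<open>simp add: set_integral_add diff_divide_distrib add_divide_distrib\<close>)
  qed
  then show "D (\<lambda>x. f x + g x) = D f + D g"
    using perturbs_lim[OF K continuous_on_add[OF f g]] tendsto_unique[OF ne] by blast
  have "((\<lambda>t. k * (((LINT x:K t|lborel. f x) - (LINT x:P|lborel. f x)) / t)) \<longlongrightarrow> k * D f) (at_right 0)"
    by (intro tendsto_intros perturbs_lim[OF K] f)
  then have "((\<lambda>t. ((LINT x:K t|lborel. k * f x) - (LINT x:P|lborel. k * f x)) / t) \<longlongrightarrow> k * D f) (at_right 0)"
    by (simp add: right_diff_distrib)
  then show "D (\<lambda>x. k * f x) = k * D f"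
    using perturbs_lim[OF K continuous_on_mult_left[OF f]] tendsto_unique[OF ne] by blast
qed

text \<open>Missing a point at distance \<open>\<eta>\<close> from the complement of \<open>P\<close> costs at least half of the
  integral of the product of the slacks over a ball of radius \<open>\<eta> / 2\<close>, uniformly in the point.\<close>

lemma perturbs_contains_inner:
  assumes K: "perturbs K D" and \<eta>: "0 < \<eta>"
  shows "\<forall>\<^sub>F t in at_right 0. {x. \<forall>i\<in>I. u i \<bullet> x \<le> c i - \<eta>} \<subseteq> K t"
proof -
  define f where "f x = (\<Prod>i\<in>I. max 0 (c i - u i \<bullet> x))" for x
  have fc: "continuous_on UNIV f" unfolding f_def by (intro continuous_intros)
  have [measurable]: "f \<in> borel_measurable borel" using fc by (rule borel_measurable_continuous_onI)
  have f0: "0 \<le> f x" for x unfolding f_def by (intro prod_nonneg) auto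
  have fP: "f x = 0" if x: "x \<notin> P" for x
  proof -
    obtain i where "i \<in> I" "u i \<bullet> x > c i" using x by (auto simp: mem_P not_le)
    then show ?thesis unfolding f_def using fin by (intro prod_zero) (auto intro!: bexI[of _ i])
  qed
  define r where "r = \<eta> / 2"
  have r: "0 < r" using \<eta> by (simp add: r_def)
  define v where "v = r ^ card I * (measure lborel (ball x0 r) / 2)"
  have v: "0 < v" unfolding v_def using r content_ball_pos[OF r, of x0] by simp
  have loss: "v \<le> (LINT x:P|lborel. f x) - (LINT x:K|lborel. f x)"
    if K: "compact K" "convex K" and x: "\<forall>i\<in>I. u i \<bullet> x \<le> c i - \<eta>" "x \<notin> K" for K x
  proof -
    have [measurable]: "K \<in> sets borel" "P \<in> sets borel" "ball x r \<in> sets borel"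
      using K compact_P borel_compact open_ball borel_open by blast+
    have inball: "r ^ card I \<le> f y \<and> y \<in> P" if "y \<in> ball x r" for y
    proof -
      have s: "r \<le> c i - u i \<bullet> y" if i: "i \<in> I" for i
      proof -
        have "\<bar>u i \<bullet> (y - x)\<bar> \<le> norm (u i) * norm (y - x)" by (rule Cauchy_Schwarz_ineq2)
        also have "\<dots> \<le> r" using i \<open>y \<in> ball x r\<close> by (simp add: dist_norm norm_minus_commute)
        finally have "u i \<bullet> y \<le> u i \<bullet> x + r" by (simp add: inner_diff_right)
        moreover have "u i \<bullet> x \<le> c i - 2 * r" using x(1) i by (simp add: r_def)
        ultimately show ?thesis by linarith
      qed
      have "(\<Prod>i\<in>I. r) \<le> f y" unfolding f_def using s r by (intro prod_mono) force
      moreover have "y \<in> P" using s r by (force simp: mem_P)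
      ultimately show ?thesis by simp
    qed
    have i1: "integrable lborel (\<lambda>x. indicator P x * f x)" "integrable lborel (\<lambda>x. indicator K x * f x)"
      using set_integrable_compact[OF compact_P fc] set_integrable_compact[OF K(1) fc] by (auto simp: set_integrable_def)
    have "measure lborel (ball x r) = measure lborel (ball x0 r)"
      by (metis content_ball_conv_unit_ball r less_imp_le)
    then have "v = r ^ card I * (measure lborel (ball x r) / 2)" by (simp add: v_def)
    also have "\<dots> \<le> r ^ card I * measure lborel (ball x r - K)"
      using half_ball_outside_convex[OF K(2) _ x(2), of r] r by (intro mult_left_mono) auto
    also have "\<dots> = (\<integral>y. r ^ card I * indicator (ball x r - K) y \<partial>lborel)" by simp
    also have "\<dots> \<le> (\<integral>y. indicator P y * f y - indicator K y * f y \<partial>lborel)"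
    proof (rule integral_mono)
      show "integrable lborel (\<lambda>y. r ^ card I * indicator (ball x r - K) y)"
        by (intro integrable_mult_right integrable_real_indicator emeasure_bounded_finite) (auto intro: bounded_subset[OF bounded_ball])
      show "integrable lborel (\<lambda>y. indicator P y * f y - indicator K y * f y)"
        by (intro Bochner_Integration.integrable_diff i1)
      show "r ^ card I * indicator (ball x r - K) y \<le> indicator P y * f y - indicator K y * f y" for y
        using inball[of y] f0[of y] fP[of y] by (cases "y \<in> P"; cases "y \<in> K"; cases "y \<in> ball x r") auto
    qed
    also have "\<dots> = (LINT x:P|lborel. f x) - (LINT x:K|lborel. f x)"
      using i1 by (subst Bochner_Integration.integral_diff) (auto simp: set_lebesgue_integral_def)
    finally show ?thesis .
  qed
  have "\<forall>\<^sub>F t in at_right 0. (LINT x:P|lborel. f x) - v < (LINT x:K t|lborel. f x)"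
    using v by (intro order_tendstoD(1)[OF perturbs_tendsto[OF K fc]]) simp
  then show ?thesis using perturbs_ev[OF K]
  proof eventually_elim
    case (elim t)
    show ?case
    proof
      fix x assume "x \<in> {x. \<forall>i\<in>I. u i \<bullet> x \<le> c i - \<eta>}"
      then show "x \<in> K t" using loss[of "K t" x] elim by fastforce
    qed
  qed
qed

text \<open>A far away point of \<open>K t\<close> would force a ball of fixed size into a shell disjoint
  from \<open>P\<close>.\<close>

lemma perturbs_bounded:
  assumes K: "perturbs K D"
  obtains R where "\<forall>\<^sub>F t in at_right 0. K t \<subseteq> cball x0 R"
proof -
  obtain \<eta> where \<eta>: "0 < \<eta>" "\<And>i. i \<in> I \<Longrightarrow> u i \<bullet> x0 + \<eta> \<le> c i" by (rule slack) blast
  obtain R0 where R0: "1 \<le> R0" "P \<subseteq> cball x0 R0" by (rule P_in_cball)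
  define \<rho> where "\<rho> = min 1 (\<eta> / 2)"
  have \<rho>: "0 < \<rho>" "\<rho> \<le> 1" using \<eta> by (auto simp: \<rho>_def)
  define S where "S = R0 + 1"
  define f where "f x = max 0 (1 - \<bar>norm (x - x0) - S\<bar>)" for x
  have fc: "continuous_on UNIV f" unfolding f_def by (intro continuous_intros)
  have f0: "0 \<le> f x" for x by (simp add: f_def)
  have fP: "f x = 0" if "x \<in> P" for x
  proof -
    have "norm (x - x0) \<le> R0" using R0(2) that by (auto simp: dist_norm norm_minus_commute)
    then show ?thesis by (simp add: f_def S_def)
  qed
  have P0: "(LINT x:P|lborel. f x) = 0"
    unfolding set_lebesgue_integral_def using fP by (intro integral_eq_zero_AE AE_I2) (auto simp: indicator_def)
  define v where "v = measure lborel (ball x0 (\<rho> / 2)) / 2"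
  have v: "0 < v" unfolding v_def using content_ball_pos[of "\<rho> / 2" x0] \<rho> by simp
  have gain: "v \<le> (LINT x:K|lborel. f x)"
    if K: "compact K" "convex K" and inner: "ball x0 \<rho> \<subseteq> K" and y: "y \<in> K" "2 * S < norm (y - x0)" for K y
  proof -
    have "0 < 2 * S" using R0(1) by (simp add: S_def)
    then have ny: "0 < norm (y - x0)" using y(2) by (rule less_trans)
    define l where "l = S / norm (y - x0)"
    have l: "0 < l" "l \<le> 1 / 2" using y(2) ny R0(1) by (auto simp: l_def S_def field_simps)
    define m where "m = x0 + l *\<^sub>R (y - x0)"
    have nm: "norm (m - x0) = S" using ny \<open>0 < 2 * S\<close> by (simp add: m_def l_def)
    have inK: "x \<in> K \<and> 1 / 2 \<le> f x" if x: "x \<in> ball m (\<rho> / 2)" for x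
    proof
      define w where "w = x0 + (1 / (1 - l)) *\<^sub>R (x - m)"
      have nx: "norm (x - m) < \<rho> / 2" using x by (simp add: dist_norm norm_minus_commute)
      have "1 / (1 - l) \<le> 2" using l by (simp add: field_simps)
      then have "norm ((1 / (1 - l)) *\<^sub>R (x - m)) \<le> 2 * norm (x - m)"
        using l by (simp only: norm_scaleR) (intro mult_right_mono, auto)
      then have "w \<in> ball x0 \<rho>" using nx by (simp add: w_def dist_norm)
      then have "(1 - l) *\<^sub>R w + l *\<^sub>R y \<in> K" using inner y l K(2) by (intro convexD) auto
      moreover have "(1 - l) *\<^sub>R w + l *\<^sub>R y = x" using l
        by (simp add: w_def m_def scaleR_add_right scaleR_diff_right scaleR_diff_left)
      ultimately show "x \<in> K" by simp
      have "\<bar>norm (x - x0) - norm (m - x0)\<bar> \<le> norm ((x - x0) - (m - x0))" by (rule norm_triangle_ineq3)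
      then have "\<bar>norm (x - x0) - S\<bar> \<le> 1 / 2" using nx nm \<rho> by simp
      then show "1 / 2 \<le> f x" by (simp add: f_def)
    qed
    have i1: "integrable lborel (\<lambda>x. indicator K x * f x)"
      using set_integrable_compact[OF K(1) fc] by (auto simp: set_integrable_def)
    have "measure lborel (ball m (\<rho> / 2)) = measure lborel (ball x0 (\<rho> / 2))"
      using \<rho> by (metis content_ball_conv_unit_ball half_gt_zero less_imp_le)
    then have "v = (\<integral>x. 1 / 2 * indicator (ball m (\<rho> / 2)) x \<partial>lborel)" by (simp add: v_def)
    also have "\<dots> \<le> (\<integral>x. indicator K x * f x \<partial>lborel)"
    proof (rule integral_mono)
      have "ball m (\<rho> / 2) \<in> sets borel" using open_ball borel_open by blast
      then show "integrable lborel (\<lambda>x. 1 / 2 * indicator (ball m (\<rho> / 2)) x :: real)"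
        by (intro integrable_mult_right integrable_real_indicator emeasure_bounded_finite) auto
      show "1 / 2 * indicator (ball m (\<rho> / 2)) x \<le> indicator K x * f x" for x
        using inK[of x] f0[of x] by (cases "x \<in> ball m (\<rho> / 2)") (auto simp: indicator_def simp del: mem_ball)
    qed (rule i1)
    finally show ?thesis by (simp add: set_lebesgue_integral_def)
  qed
  have inner: "{x. \<forall>i\<in>I. u i \<bullet> x \<le> c i - \<eta> / 2} \<supseteq> ball x0 \<rho>"
  proof safe
    fix x i assume x: "x \<in> ball x0 \<rho>" and i: "i \<in> I"
    have "\<bar>u i \<bullet> (x - x0)\<bar> \<le> norm (u i) * norm (x - x0)" by (rule Cauchy_Schwarz_ineq2)
    also have "\<dots> \<le> \<eta> / 2" using i x by (simp add: dist_norm norm_minus_commute \<rho>_def)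
    finally show "u i \<bullet> x \<le> c i - \<eta> / 2" using \<eta>(2)[OF i] unfolding inner_diff_right by linarith
  qed
  have "\<forall>\<^sub>F t in at_right 0. (LINT x:K t|lborel. f x) < v"
    using v P0 by (intro order_tendstoD(2)[OF perturbs_tendsto[OF K fc]]) simp
  moreover have "\<forall>\<^sub>F t in at_right 0. {x. \<forall>i\<in>I. u i \<bullet> x \<le> c i - \<eta> / 2} \<subseteq> K t"
    using \<eta> by (intro perturbs_contains_inner[OF K]) simp
  ultimately have "\<forall>\<^sub>F t in at_right 0. K t \<subseteq> cball x0 (2 * S)"
    using perturbs_ev[OF K]
  proof eventually_elim
    case (elim t)
    show ?case
    proof
      fix y assume y: "y \<in> K t"
      have "\<not> 2 * S < norm (y - x0)"
        using gain[of "K t" y] elim inner y by (meson not_le order_trans)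
      then show "y \<in> cball x0 (2 * S)" by (simp add: dist_norm norm_minus_commute)
    qed
  qed
  then show ?thesis by (rule that)
qed

text \<open>Compact convex sets exhausting the relative interior of a facet. Above them the
  surface of a body close to \<open>P\<close> is the graph of a concave function.\<close>

definition core :: "'i \<Rightarrow> real \<Rightarrow> 'a set" where
  "core i d = {x. u i \<bullet> x = c i \<and> (\<forall>j\<in>I - {i}. u j \<bullet> x \<le> c j - d)}"

lemma core_subset_face: "0 < d \<Longrightarrow> i \<in> I \<Longrightarrow> core i d \<subseteq> face i"
  by (force simp: core_def mem_face)

lemma core_antimono: "d' \<le> d \<Longrightarrow> core i d \<subseteq> core i d'"
  by (force simp: core_def)

lemma convex_core: "convex (core i d)"
proof -
  have "core i d = {x. u i \<bullet> x = c i} \<inter> (\<Inter>j\<in>I - {i}. {x. u j \<bullet> x \<le> c j - d})"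
    by (auto simp: core_def)
  then show ?thesis by (auto intro!: convex_Int convex_hyperplane convex_INT convex_halfspace_le)
qed

lemma closed_core: "closed (core i d)"
proof -
  have "core i d = {x. u i \<bullet> x = c i} \<inter> (\<Inter>j\<in>I - {i}. {x. u j \<bullet> x \<le> c j - d})"
    by (auto simp: core_def)
  then show ?thesis by (auto intro!: closed_Int closed_hyperplane closed_INT closed_halfspace_le)
qed

lemma compact_core: "0 < d \<Longrightarrow> i \<in> I \<Longrightarrow> compact (core i d)"
  using core_subset_face[of d i] closed_core bdd
  by (auto simp: compact_eq_bounded_closed face_def intro: bounded_subset)

lemma core_measurable [measurable]: "core i d \<in> sets borel"
  using closed_core by (rule borel_closed)

text \<open>\<open>\<phi>\<close> is extended constantly in the normal direction and cut off below the hyperplane, so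
  that the extension does not see the other facets.\<close>

definition lift :: "'i \<Rightarrow> real \<Rightarrow> ('a \<Rightarrow> real) \<Rightarrow> 'a \<Rightarrow> real" where
  "lift i d \<phi> y = \<phi> (y - (u i \<bullet> y - c i) *\<^sub>R u i) * cut d (u i \<bullet> y - c i)"

lemma continuous_lift:
  assumes "continuous_on UNIV \<phi>"
  shows "continuous_on UNIV (lift i d \<phi>)"
  unfolding lift_def
  by (intro continuous_intros continuous_on_compose2[OF assms]) auto

text \<open>The upper end of the chord of \<open>K\<close> through \<open>x\<close> in the normal direction, as \<open>height_top\<close> shows
  over the core. The chord is measured with the weight \<^const>\<open>cut\<close>, and the subtracted constant
  is the contribution of its part below the hyperplane. Defined by an integral, the height is
  measurable.\<close>

definition height :: "'i \<Rightarrow> real \<Rightarrow> 'a set \<Rightarrow> 'a \<Rightarrow> real" where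
  "height i d K x = (\<integral>s. indicator K (x + s *\<^sub>R u i) * cut d s \<partial>lborel)
     - ((\<integral>s. indicator {- 2 * d / 3..- d / 3} s * cut d s \<partial>lborel) + d / 3)"

text \<open>The chords through the core reach through the region in which \<^const>\<open>cut\<close> increases, so
  that only their upper ends depend on the body.\<close>

definition thick :: "'i \<Rightarrow> real \<Rightarrow> 'a set \<Rightarrow> bool" where
  "thick i d K \<longleftrightarrow> compact K \<and> convex K \<and> (\<forall>x\<in>core i d. \<forall>s\<in>{d/3..2*d/3}. x - s *\<^sub>R u i \<in> K)"

lemma below_core:
  assumes i: "i \<in> I" and x: "x \<in> core i d" and s: "d/3 \<le> s" "s \<le> 2*d/3" and j: "j \<in> I"
  shows "u j \<bullet> (x - s *\<^sub>R u i) \<le> c j - d/3"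
proof (cases "j = i")
  case True
  interpret hyperplane_chart "u i" "c i" "M i" using i by (rule chart)
  show ?thesis using x s True by (simp add: core_def inner_diff_right)
next
  case False
  have "0 \<le> s" using s by linarith
  have "\<bar>u j \<bullet> u i\<bar> \<le> norm (u j) * norm (u i)" by (rule Cauchy_Schwarz_ineq2)
  then have "- (u j \<bullet> u i) \<le> 1" using i j by simp
  then have "s * - (u j \<bullet> u i) \<le> s * 1" using \<open>0 \<le> s\<close> by (rule mult_left_mono)
  moreover have "u j \<bullet> x \<le> c j - d" using x j False by (auto simp: core_def)
  ultimately show ?thesis using s unfolding inner_diff_right inner_scaleR_right by linarith
qed

lemma perturbs_thick:
  assumes K: "perturbs K D" and i: "i \<in> I" and d: "0 < d"
  shows "\<forall>\<^sub>F t in at_right 0. thick i d (K t)"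
proof -
  have "\<forall>\<^sub>F t in at_right 0. {x. \<forall>j\<in>I. u j \<bullet> x \<le> c j - d/3} \<subseteq> K t"
    using d by (intro perturbs_contains_inner[OF K]) simp
  then show ?thesis using perturbs_ev[OF K]
    by eventually_elim (use below_core[OF i] in \<open>auto simp: thick_def\<close>)
qed

lemma thick_P:
  assumes i: "i \<in> I" and d: "0 < d"
  shows "thick i d P"
  using below_core[OF i] compact_P d convex_deformed[of "\<lambda>_. 0" "\<lambda>_. 0" 0]
  by (auto simp: thick_def mem_P) (smt (verit) divide_pos_pos)

lemma height_top:
  assumes i: "i \<in> I" and d: "0 < d" and K: "thick i d K" and x: "x \<in> core i d"
  shows "x + height i d K x *\<^sub>R u i \<in> K" and "x + s *\<^sub>R u i \<in> K \<Longrightarrow> s \<le> height i d K x"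
proof -
  interpret hyperplane_chart "u i" "c i" "M i" using i by (rule chart)
  define S where "S = {s. x + s *\<^sub>R u i \<in> K}"
  have cK: "compact K" "convex K" using K by (auto simp: thick_def)
  have low: "s \<in> S" if "- 2 * d / 3 \<le> s" "s \<le> - d / 3" for s
    using K x that by (auto simp: thick_def S_def dest!: bspec[of _ _ x] bspec[of _ _ "- s"])
  have clS: "closed S"
  proof -
    have "S = (\<lambda>s. x + s *\<^sub>R u i) -` K" by (auto simp: S_def)
    moreover have "closed ((\<lambda>s. x + s *\<^sub>R u i) -` K)"
      using compact_imp_closed[OF cK(1)] by (intro closed_vimage continuous_intros) auto
    ultimately show ?thesis by simp
  qed
  have bS: "bdd_above S"
  proof -
    obtain B where B: "\<And>y. y \<in> K \<Longrightarrow> norm y \<le> B" using compact_imp_bounded[OF cK(1)] by (auto simp: bounded_iff)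
    have "s \<le> B + norm x" if "s \<in> S" for s
    proof -
      have "\<bar>s\<bar> = norm ((x + s *\<^sub>R u i) - x)" using i by simp
      also have "\<dots> \<le> norm (x + s *\<^sub>R u i) + norm x" by (rule norm_triangle_ineq4)
      also have "\<dots> \<le> B + norm x" using B that by (simp add: S_def)
      finally show ?thesis by simp
    qed
    then show ?thesis by (rule bdd_aboveI)
  qed
  have neS: "S \<noteq> {}" using low[of "- d / 3"] d by auto
  define T where "T = Sup S"
  have TS: "T \<in> S" unfolding T_def by (rule closed_contains_Sup[OF neS bS clS])
  have leT: "s \<le> T" if "s \<in> S" for s unfolding T_def using that bS by (rule cSup_upper)
  have T: "- d / 3 \<le> T" using low[of "- d / 3"] d by (intro leT) simp
  have cvS: "s \<in> S" if "- 2 * d / 3 \<le> s" "s \<le> T" for s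
  proof -
    have "convex S"
    proof -
      have "(v * a + w * b) \<in> S" if "a \<in> S" "b \<in> S" "0 \<le> v" "0 \<le> w" "v + w = 1" for a b v w
      proof -
        have "v *\<^sub>R (x + a *\<^sub>R u i) + w *\<^sub>R (x + b *\<^sub>R u i) \<in> K"
          using that cK(2) by (intro convexD) (auto simp: S_def)
        moreover have w: "w = 1 - v" using that by simp
        have "v *\<^sub>R (x + a *\<^sub>R u i) + w *\<^sub>R (x + b *\<^sub>R u i) = x + (v * a + w * b) *\<^sub>R u i"
          unfolding w by (simp add: algebra_simps)
        ultimately show ?thesis by (simp add: S_def)
      qed
      then show ?thesis by (intro convexI) auto
    qed
    then have "is_interval S" by (simp add: is_interval_convex_1)
    moreover have "- 2 * d / 3 \<in> S" using d by (intro low) auto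
    ultimately show ?thesis using TS that by (metis is_interval_1)
  qed
  have "(\<integral>s. indicator K (x + s *\<^sub>R u i) * cut d s \<partial>lborel)
      = (\<integral>s. indicator {- 2 * d / 3..- d / 3} s * cut d s + indicator {- d / 3<..T} s \<partial>lborel)"
  proof (rule Bochner_Integration.integral_cong)
    fix s
    consider "s \<le> - 2 * d / 3" | "- 2 * d / 3 < s" "s \<le> - d / 3" | "- d / 3 < s" by linarith
    then show "indicator K (x + s *\<^sub>R u i) * cut d s = indicator {- 2 * d / 3..- d / 3} s * cut d s + indicator {- d / 3<..T} s"
    proof cases
      case 1
      then have "cut d s = 0" using d by (intro cut_simps)
      then show ?thesis using 1 d by (auto simp: indicator_def field_simps)
    next
      case 2
      then show ?thesis using low[of s] by (auto simp: indicator_def S_def)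
    next
      case 3
      then have "cut d s = 1" using d by (intro cut_simps) auto
      moreover have "s \<in> S \<longleftrightarrow> s \<le> T" using leT cvS[of s] 3 d by force
      ultimately show ?thesis using 3 by (auto simp: indicator_def S_def)
    qed
  qed simp
  also have "\<dots> = (\<integral>s. indicator {- 2 * d / 3..- d / 3} s * cut d s \<partial>lborel) + (\<integral>s. indicator {- d / 3<..T} s \<partial>lborel)"
  proof (rule Bochner_Integration.integral_add)
    have "set_integrable lborel {- 2 * d / 3..- d / 3} (cut d)"
      by (rule set_integrable_compact) (auto intro: continuous_cut continuous_on_id)
    then show "integrable lborel (\<lambda>s. indicator {- 2 * d / 3..- d / 3} s * cut d s)" by (simp add: set_integrable_def)
    show "integrable lborel (indicator {- d / 3<..T} :: real \<Rightarrow> real)"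
      by (intro integrable_real_indicator emeasure_bounded_finite) auto
  qed
  also have "(\<integral>s. indicator {- d / 3<..T} s \<partial>lborel) = T + d / 3" using T by simp
  finally have h: "height i d K x = T" by (simp add: height_def)
  show "x + height i d K x *\<^sub>R u i \<in> K" using TS h by (simp add: S_def)
  show "s \<le> height i d K x" if "x + s *\<^sub>R u i \<in> K" using leT[of s] that h by (simp add: S_def)
qed

lemma height_eqI:
  assumes "i \<in> I" "0 < d" "thick i d K" "x \<in> core i d"
    and "x + T *\<^sub>R u i \<in> K" "\<And>s. x + s *\<^sub>R u i \<in> K \<Longrightarrow> s \<le> T"
  shows "height i d K x = T"
  using height_top[OF assms(1-4)] assms(5,6) by (meson antisym)

lemma height_P:
  assumes i: "i \<in> I" and d: "0 < d" and x: "x \<in> core i d"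
  shows "height i d P x = 0"
proof (rule height_eqI[OF i d thick_P[OF i d] x])
  interpret hyperplane_chart "u i" "c i" "M i" using i by (rule chart)
  show "x + 0 *\<^sub>R u i \<in> P" using core_subset_face[OF d i] x by (auto simp: face_def)
  show "s \<le> 0" if "x + s *\<^sub>R u i \<in> P" for s
    using that i x by (auto simp: mem_P core_def inner_add_right dest!: bspec[of _ _ i])
qed

lemma concave_height:
  assumes i: "i \<in> I" and d: "0 < d" and K: "thick i d K"
  shows "concave_on (core i d) (height i d K)"
  unfolding concave_on_iff
proof (intro conjI ballI allI impI convex_core)
  fix x y v w :: real and a b assume ab: "a \<in> core i d" "b \<in> core i d" and vw: "0 \<le> v" "0 \<le> w" "v + w = 1"
  let ?h = "height i d K"
  have "v *\<^sub>R (a + ?h a *\<^sub>R u i) + w *\<^sub>R (b + ?h b *\<^sub>R u i) \<in> K"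
    using K vw height_top(1)[OF i d K] ab by (intro convexD) (auto simp: thick_def)
  moreover have "v *\<^sub>R (a + ?h a *\<^sub>R u i) + w *\<^sub>R (b + ?h b *\<^sub>R u i) = (v *\<^sub>R a + w *\<^sub>R b) + (v * ?h a + w * ?h b) *\<^sub>R u i"
    by (simp add: algebra_simps)
  moreover have "v *\<^sub>R a + w *\<^sub>R b \<in> core i d" using convexD[OF convex_core ab vw] .
  ultimately show "v * ?h a + w * ?h b \<le> ?h (v *\<^sub>R a + w *\<^sub>R b)"
    using height_top(2)[OF i d K] by metis
qed

lemma height_measurable:
  assumes i: "i \<in> I" and K: "compact K"
  shows "height i d K \<in> borel_measurable borel"
proof -
  have Km[measurable]: "K \<in> sets borel" using K by (rule borel_compact)
  have "(\<lambda>x. \<integral>s. indicator K (x + s *\<^sub>R u i) * cut d s \<partial>lborel) \<in> borel_measurable borel" by measurable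
  then show ?thesis unfolding height_def by measurable
qed

lemma height_bounded:
  assumes i: "i \<in> I" and d: "0 < d" and K: "thick i d K"
  shows "\<exists>b. \<forall>x\<in>core i d. \<bar>height i d K x\<bar> \<le> b"
proof -
  have "bounded K" "bounded (core i d)" using K compact_core[OF d i] by (auto simp: thick_def compact_imp_bounded)
  then obtain B B' where B: "\<And>y. y \<in> K \<Longrightarrow> norm y \<le> B" and B': "\<And>y. y \<in> core i d \<Longrightarrow> norm y \<le> B'"
    unfolding bounded_iff by blast
  have "\<bar>height i d K x\<bar> \<le> B + B'" if x: "x \<in> core i d" for x
  proof -
    have "\<bar>height i d K x\<bar> = norm ((x + height i d K x *\<^sub>R u i) - x)" using i by simp
    also have "\<dots> \<le> norm (x + height i d K x *\<^sub>R u i) + norm x" by (rule norm_triangle_ineq4)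
    finally show ?thesis using B[OF height_top(1)[OF i d K x]] B'[OF x] by simp
  qed
  then show ?thesis by blast
qed

text \<open>Fubini's theorem in the normal direction: the region below the core where
  the cutoff increases from \<open>0\<close> to \<open>1\<close> lies inside every thick body, so its contributions to \<open>K\<close>
  and to \<open>P\<close> cancel and the identity is exact, not only true to first order.\<close>

lemma slice_integral:
  assumes i: "i \<in> I" and d: "0 < d" and K: "thick i d K"
    and \<phi>: "continuous_on UNIV \<phi>" and supp: "\<And>x. u i \<bullet> x = c i \<Longrightarrow> x \<notin> core i d \<Longrightarrow> \<phi> x = 0"
  shows "(LINT y:K|lborel. lift i d \<phi> y) - (LINT y:P|lborel. lift i d \<phi> y) = (\<integral>x. \<phi> x * height i d K x \<partial>M i)"
proof -
  interpret hyperplane_chart "u i" "c i" "M i" using i by (rule chart)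
  have \<phi>m[measurable]: "\<phi> \<in> borel_measurable borel" using \<phi> by (rule borel_measurable_continuous_onI)
  define k where "k = (\<integral>s. indicator {- 2 * d / 3..- d / 3} s * cut d s \<partial>lborel) + d / 3"
  have main: "(LINT y:K|lborel. lift i d \<phi> y) = (\<integral>x. \<phi> x * height i d K x \<partial>M i) + k * (\<integral>x. \<phi> x \<partial>M i)"
    if K: "thick i d K" for K
  proof -
    have cK: "compact K" using K by (simp add: thick_def)
    have [measurable]: "height i d K \<in> borel_measurable borel" using i cK by (rule height_measurable)
    have int: "integrable lborel (\<lambda>y. indicator K y * lift i d \<phi> y)"
      using set_integrable_compact[OF cK continuous_lift[OF \<phi>]] by (simp add: set_integrable_def)
    have "(LINT y:K|lborel. lift i d \<phi> y) = (\<integral>x. (\<integral>s. indicator K (x + s *\<^sub>R u i) * lift i d \<phi> (x + s *\<^sub>R u i) \<partial>lborel) \<partial>M i)"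
      using integral_chart(1)[OF int] by (simp add: set_lebesgue_integral_def)
    also have "\<dots> = (\<integral>x. \<phi> x * height i d K x + k * \<phi> x \<partial>M i)"
    proof (rule integral_cong_AE)
      from chart.integrable_fst'[OF integral_chart(2)[OF int]]
      show "(\<lambda>x. \<integral>s. indicator K (x + s *\<^sub>R u i) * lift i d \<phi> (x + s *\<^sub>R u i) \<partial>lborel) \<in> borel_measurable (M i)" by simp
      show "(\<lambda>x. \<phi> x * height i d K x + k * \<phi> x) \<in> borel_measurable (M i)" by measurable
      show "AE x in M i. (\<integral>s. indicator K (x + s *\<^sub>R u i) * lift i d \<phi> (x + s *\<^sub>R u i) \<partial>lborel) = \<phi> x * height i d K x + k * \<phi> x"
        using on_hyperplane
      proof eventually_elim
        case (elim x)
        have "lift i d \<phi> (x + s *\<^sub>R u i) = \<phi> x * cut d s" for s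
          using elim by (simp add: lift_def inner_add_right)
        then have "(\<integral>s. indicator K (x + s *\<^sub>R u i) * lift i d \<phi> (x + s *\<^sub>R u i) \<partial>lborel)
            = \<phi> x * (\<integral>s. indicator K (x + s *\<^sub>R u i) * cut d s \<partial>lborel)"
          by (subst integral_mult_right_zero[symmetric]) (simp add: ac_simps)
        then show ?case by (simp add: height_def k_def algebra_simps)
      qed
    qed
    also have "\<dots> = (\<integral>x. \<phi> x * height i d K x \<partial>M i) + (\<integral>x. k * \<phi> x \<partial>M i)"
    proof (rule Bochner_Integration.integral_add)
      obtain b where b: "\<And>x. x \<in> core i d \<Longrightarrow> \<bar>height i d K x\<bar> \<le> b" using height_bounded[OF i d K] by blast
      have "bounded (\<phi> ` core i d)"
        using \<phi> compact_core[OF d i] by (intro compact_imp_bounded compact_continuous_image) (auto intro: continuous_on_subset)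
      then obtain b' where b': "\<And>x. x \<in> core i d \<Longrightarrow> \<bar>\<phi> x\<bar> \<le> b'" by (auto simp: bounded_iff)
      have bc: "bounded (core i d)" using compact_core[OF d i] by (rule compact_imp_bounded)
      have "\<bar>\<phi> x\<bar> \<le> \<bar>b'\<bar>" if "u i \<bullet> x = c i" for x
        using supp[OF that] b'[of x] by (cases "x \<in> core i d") auto
      then show "integrable (M i) (\<lambda>x. k * \<phi> x)"
        by (intro integrable_mult_right integrable_bounded_support[OF \<phi>m _ bc]) (use supp in auto)
      have "\<bar>\<phi> x * height i d K x\<bar> \<le> \<bar>b'\<bar> * \<bar>b\<bar>" if "u i \<bullet> x = c i" for x
        using supp[OF that] b'[of x] b[of x] unfolding abs_mult
        by (cases "x \<in> core i d") (auto intro!: mult_mono)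
      then show "integrable (M i) (\<lambda>x. \<phi> x * height i d K x)"
        by (intro integrable_bounded_support[OF _ _ bc]) (use supp in auto)
    qed
    finally show ?thesis by simp
  qed
  have "(\<integral>x. \<phi> x * height i d P x \<partial>M i) = 0"
  proof (rule integral_eq_zero_AE)
    show "AE x in M i. \<phi> x * height i d P x = 0"
      using on_hyperplane
    proof eventually_elim
      case (elim x)
      then show ?case using supp[of x] height_P[OF i d, of x] by (cases "x \<in> core i d") auto
    qed
  qed
  then show ?thesis using main[OF K] main[OF thick_P[OF i d]] by simp
qed

lemma height_limit:
  assumes K: "perturbs K D" and i: "i \<in> I" and d: "0 < d"
    and \<phi>: "continuous_on UNIV \<phi>" and supp: "\<And>x. u i \<bullet> x = c i \<Longrightarrow> x \<notin> core i d \<Longrightarrow> \<phi> x = 0"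
  shows "((\<lambda>t. (\<integral>x. \<phi> x * height i d (K t) x \<partial>M i) / t) \<longlongrightarrow> D (lift i d \<phi>)) (at_right 0)"
  using perturbs_lim[OF K continuous_lift[OF \<phi>, of i d]]
proof (rule Lim_transform_eventually)
  show "\<forall>\<^sub>F t in at_right 0. ((LINT x:K t|lborel. lift i d \<phi> x) - (LINT x:P|lborel. lift i d \<phi> x)) / t
      = (\<integral>x. \<phi> x * height i d (K t) x \<partial>M i) / t"
    using perturbs_thick[OF K i d] by eventually_elim (simp add: slice_integral[OF i d _ \<phi> supp])
qed

end


section \<open>Concave test functions on a facet\<close>

text \<open>A continuous weight, symmetric about \<open>v\<close>, with which concave functions are averaged near
  \<open>v\<close>.\<close>

definition tent :: "'a::real_normed_vector \<Rightarrow> real \<Rightarrow> 'a \<Rightarrow> real" where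
  "tent v r y = max 0 (1 - norm (y - v) / r)"

lemma tent_nonneg [simp]: "0 \<le> tent v r y" by (simp add: tent_def)

lemma tent_outside: "0 < r \<Longrightarrow> y \<notin> cball v r \<Longrightarrow> tent v r y = 0"
  by (simp add: tent_def dist_norm norm_minus_commute)

lemma tent_le_1: "0 < r \<Longrightarrow> tent v r y \<le> 1" by (simp add: tent_def)

lemma continuous_tent: "0 < r \<Longrightarrow> continuous_on S (tent v r)"
  unfolding tent_def by (intro continuous_intros) auto

lemma tent_reflect: "tent v r (2 *\<^sub>R v - y) = tent v r y"
proof -
  have "2 *\<^sub>R v - y - v = - (y - v)" by (simp add: scaleR_2)
  then have "norm (2 *\<^sub>R v - y - v) = norm (y - v)" by (simp only: norm_minus_cancel)
  then show ?thesis by (simp add: tent_def)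
qed

text \<open>The points \<open>p \<plusminus> r e\<close>, for \<open>e\<close> a projected basis vector, surround \<open>p\<close>
  in the hyperplane, and nearby points are convex combinations of them with affine weights.\<close>

definition vert :: "'a::euclidean_space \<Rightarrow> 'a \<Rightarrow> real \<Rightarrow> 'a \<times> real \<Rightarrow> 'a" where
  "vert u p r j = p + (snd j * r) *\<^sub>R (fst j - (u \<bullet> fst j) *\<^sub>R u)"

definition wt :: "'a::euclidean_space \<Rightarrow> real \<Rightarrow> 'a \<times> real \<Rightarrow> 'a \<Rightarrow> real" where
  "wt p r j x = 1 / (2 * DIM('a)) + snd j / (2 * r) * (fst j \<bullet> (x - p))"

abbreviation dirs :: "('a::euclidean_space \<times> real) set" where
  "dirs \<equiv> Basis \<times> {-1, 1}"

lemma sum_dirs: "(\<Sum>j\<in>(dirs :: ('a::euclidean_space \<times> real) set). f j) = (\<Sum>e\<in>Basis. f (e, -1) + f (e, 1))"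
proof -
  have "sum f dirs = (\<Sum>(e, s)\<in>(Basis :: 'a set) \<times> {-1, 1 :: real}. f (e, s))" by (simp add: case_prod_beta)
  also have "\<dots> = (\<Sum>e\<in>Basis. \<Sum>s\<in>{-1, 1 :: real}. f (e, s))" by (rule sum.cartesian_product[symmetric])
  finally show ?thesis by simp
qed

lemma finite_dirs [simp]: "finite (dirs :: ('a::euclidean_space \<times> real) set)"
  by (intro finite_cartesian_product) auto

context hyperplane_chart
begin

lemma u_vert: "u \<bullet> p = c \<Longrightarrow> u \<bullet> vert u p r j = c"
  by (simp add: vert_def inner_add_right inner_diff_right)

lemma vert_near:
  assumes "j \<in> dirs" "0 \<le> r"
  shows "norm (vert u p r j - p) \<le> r"
proof -
  obtain e \<sigma> where j: "j = (e, \<sigma>)" "e \<in> Basis" "\<bar>\<sigma>\<bar> = 1" using assms by auto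
  have e: "e \<bullet> e = 1" using j by (simp add: inner_Basis)
  have "(norm (e - (u \<bullet> e) *\<^sub>R u))\<^sup>2 = 1 - (u \<bullet> e)\<^sup>2"
    unfolding power2_norm_eq_inner
    by (simp add: inner_diff_left inner_diff_right e inner_commute[of e u] power2_eq_square)
  also have "\<dots> \<le> 1\<^sup>2" by simp
  finally have "norm (e - (u \<bullet> e) *\<^sub>R u) \<le> 1" by (rule power2_le_imp_le) simp
  then have "\<bar>\<sigma> * r\<bar> * norm (e - (u \<bullet> e) *\<^sub>R u) \<le> r * 1"
    using j assms(2) by (intro mult_mono) (auto simp: abs_mult)
  then show ?thesis by (simp add: vert_def j)
qed

lemma sum_wt:
  fixes x p :: 'a
  shows "(\<Sum>j\<in>dirs. wt p r j x) = 1"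
proof -
  have "(\<Sum>j\<in>dirs. wt p r j x) = (\<Sum>e\<in>(Basis :: 'a set). 1 / DIM('a))"
    unfolding sum_dirs by (intro sum.cong) (auto simp: wt_def)
  then show ?thesis by simp
qed

lemma sum_wt_vert:
  assumes p: "u \<bullet> p = c" and x: "u \<bullet> x = c" and r: "r \<noteq> 0"
  shows "(\<Sum>j\<in>dirs. wt p r j x *\<^sub>R vert u p r j) = x"
proof -
  have "(\<Sum>j\<in>dirs. wt p r j x *\<^sub>R vert u p r j)
      = (\<Sum>j\<in>dirs. wt p r j x *\<^sub>R p) + (\<Sum>j\<in>dirs. (wt p r j x * (snd j * r)) *\<^sub>R (fst j - (u \<bullet> fst j) *\<^sub>R u))"
    by (simp add: vert_def scaleR_add_right sum.distrib)
  also have "(\<Sum>j\<in>dirs. wt p r j x *\<^sub>R p) = p"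
    by (simp only: scaleR_sum_left[symmetric] sum_wt scaleR_one)
  also have "(\<Sum>j\<in>dirs. (wt p r j x * (snd j * r)) *\<^sub>R (fst j - (u \<bullet> fst j) *\<^sub>R u))
      = (\<Sum>e\<in>Basis. ((x - p) \<bullet> e) *\<^sub>R (e - (u \<bullet> e) *\<^sub>R u))"
    unfolding sum_dirs
  proof (rule sum.cong)
    fix e :: 'a assume "e \<in> Basis"
    have "wt p r (e, -1) x * (-1 * r) + wt p r (e, 1) x * (1 * r) = (x - p) \<bullet> e"
      using r by (simp add: wt_def field_simps inner_commute)
    then show "(wt p r (e, - 1) x * (snd (e, - 1) * r)) *\<^sub>R (fst (e, - 1) - (u \<bullet> fst (e, - 1)) *\<^sub>R u) +
         (wt p r (e, 1) x * (snd (e, 1) * r)) *\<^sub>R (fst (e, 1) - (u \<bullet> fst (e, 1)) *\<^sub>R u) =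
         ((x - p) \<bullet> e) *\<^sub>R (e - (u \<bullet> e) *\<^sub>R u)"
      by (simp only: fst_conv snd_conv scaleR_add_left[symmetric])
  qed simp
  also have "\<dots> = (\<Sum>e\<in>Basis. ((x - p) \<bullet> e) *\<^sub>R e) - (\<Sum>e\<in>Basis. ((x - p) \<bullet> e) * (u \<bullet> e)) *\<^sub>R u"
    by (simp add: scaleR_diff_right sum_subtractf scaleR_sum_left)
  also have "\<dots> = (x - p) - ((x - p) \<bullet> u) *\<^sub>R u"
    by (simp only: euclidean_representation euclidean_inner[of "x - p" u])
  also have "(x - p) \<bullet> u = 0" using p x by (simp add: inner_commute[of _ u] inner_diff_right)
  finally show ?thesis by simp
qed

lemma affine_sum_wt:
  fixes p :: 'a
  obtains a b where "\<And>x. (\<Sum>j\<in>dirs. e j * wt p r j x) = a \<bullet> x + b"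
proof
  fix x
  have "(\<Sum>j\<in>dirs. e j * wt p r j x)
      = (\<Sum>j\<in>dirs. e j / (2 * DIM('a)) + (e j * snd j / (2 * r)) * (fst j \<bullet> (x - p)))"
    unfolding wt_def by (intro sum.cong) (auto simp: field_simps)
  also have "\<dots> = (\<Sum>j\<in>dirs. e j / (2 * DIM('a))) + (\<Sum>j\<in>dirs. (e j * snd j / (2 * r)) *\<^sub>R fst j) \<bullet> (x - p)"
    by (simp add: sum.distrib inner_sum_left)
  finally show "(\<Sum>j\<in>dirs. e j * wt p r j x) = (\<Sum>j\<in>dirs. (e j * snd j / (2 * r)) *\<^sub>R fst j) \<bullet> x
      + ((\<Sum>j\<in>dirs. e j / (2 * DIM('a))) - (\<Sum>j\<in>dirs. (e j * snd j / (2 * r)) *\<^sub>R fst j) \<bullet> p)"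
    by (simp add: inner_diff_right)
qed

lemma wt_nonneg:
  fixes x p :: 'a
  assumes j: "j \<in> dirs" and r: "0 < r" and x: "norm (x - p) \<le> r / DIM('a)"
  shows "0 \<le> wt p r j x"
proof -
  obtain e \<sigma> where j': "j = (e, \<sigma>)" "e \<in> Basis" "\<bar>\<sigma>\<bar> = 1" using j by auto
  have "\<bar>\<sigma> * (e \<bullet> (x - p))\<bar> \<le> norm (x - p)"
    using Basis_le_norm[OF j'(2), of "x - p"] j'(3) by (simp add: abs_mult inner_commute)
  then have "- (r / DIM('a)) \<le> \<sigma> * (e \<bullet> (x - p))" using x by linarith
  then have "- (r / DIM('a)) / (2 * r) \<le> \<sigma> * (e \<bullet> (x - p)) / (2 * r)"
    using r by (intro divide_right_mono) auto
  moreover have "- (r / DIM('a)) / (2 * r) = - (1 / (2 * real DIM('a)))" using r by simp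
  ultimately show ?thesis by (simp add: wt_def j')
qed

lemma continuous_wt [continuous_intros]:
  fixes p :: 'a
  shows "continuous_on S (wt p r j)"
  unfolding wt_def by (intro continuous_intros)

lemma integral_tent_pos:
  assumes p: "u \<bullet> p = c" and r: "0 < r"
  shows "0 < (\<integral>y. tent p r y \<partial>M)" "integrable M (tent p r)"
proof -
  have m[measurable]: "tent p r \<in> borel_measurable borel"
    using r by (intro borel_measurable_continuous_onI continuous_tent)
  show i: "integrable M (tent p r)"
    by (rule integrable_bounded_support[where b = 1 and S = "cball p r"])
      (use r tent_le_1 tent_outside in auto)
  have b: "ball p (r/2) \<in> sets borel" using open_ball borel_open by blast
  have e: "emeasure M (ball p (r/2)) < \<infinity>" using b by (intro emeasure_bounded_lt_top) auto
  have "0 < measure M (ball p (r/2))"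
    using emeasure_ball_pos[OF p, of "r/2"] r e by (auto simp: measure_def enn2real_positive_iff less_top)
  then have "(0 :: real) < (\<integral>y. 1/2 * indicator (ball p (r/2)) y \<partial>M)" using b by simp
  also have "\<dots> \<le> (\<integral>y. tent p r y \<partial>M)"
  proof (rule integral_mono[OF _ i])
    show "integrable M (\<lambda>y. 1/2 * indicator (ball p (r/2)) y :: real)"
      using b e by (intro integrable_mult_right integrable_real_indicator) auto
    show "1/2 * indicator (ball p (r/2)) y \<le> tent p r y" for y
    proof (cases "y \<in> ball p (r/2)")
      case True
      then have "norm (y - p) / r \<le> 1 / 2" using r by (simp add: dist_norm norm_minus_commute field_simps)
      then have "1 / 2 \<le> 1 - norm (y - p) / r" by linarith
      also have "\<dots> \<le> tent p r y" by (simp add: tent_def)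
      finally show ?thesis using True by simp
    qed simp
  qed
  finally show "0 < (\<integral>y. tent p r y \<partial>M)" .
qed

text \<open>Jensen's inequality for a symmetric weight: average over reflected pairs of points.\<close>

lemma tent_average_le:
  fixes g :: "'a \<Rightarrow> real"
  assumes p: "u \<bullet> p = c" and r: "0 < r" and g: "g \<in> borel_measurable borel"
    and bd: "\<And>x. x \<in> C \<Longrightarrow> \<bar>g x\<bar> \<le> b" and conc: "concave_on C g"
    and sub: "\<And>x. u \<bullet> x = c \<Longrightarrow> x \<in> cball p r \<Longrightarrow> x \<in> C"
  shows "(\<integral>y. tent p r y * g y \<partial>M) \<le> g p * (\<integral>y. tent p r y \<partial>M)"
proof -
  have m[measurable]: "tent p r \<in> borel_measurable borel" "g \<in> borel_measurable borel"
    using r g by (auto intro: borel_measurable_continuous_onI continuous_tent)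
  let ?R = "\<lambda>y. 2 *\<^sub>R p - y"
  have Rc: "?R y \<in> cball p r \<longleftrightarrow> y \<in> cball p r" for y
  proof -
    have "p - ?R y = - (p - y)" by (simp add: scaleR_2)
    then have "dist p (?R y) = dist p y" by (simp only: dist_norm norm_minus_cancel)
    then show ?thesis by simp
  qed
  have uR: "u \<bullet> ?R y = c" if "u \<bullet> y = c" for y using p that by (simp add: inner_diff_right)
  have 0: "0 \<le> b" using bd[of p] sub[OF p] r by fastforce
  have i1: "integrable M (\<lambda>y. tent p r y * g y)"
  proof (rule integrable_bounded_support[where b = b and S = "cball p r"])
    show "\<bar>tent p r x * g x\<bar> \<le> b" if "u \<bullet> x = c" for x
    proof (cases "x \<in> cball p r")
      case True
      then have "\<bar>tent p r x\<bar> * \<bar>g x\<bar> \<le> 1 * b"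
        using tent_le_1[OF r, of p x] bd[of x] sub[OF that] by (intro mult_mono) auto
      then show ?thesis by (simp add: abs_mult)
    next
      case False
      then show ?thesis using tent_outside[OF r, of x p] 0 by simp
    qed
  qed (use r tent_outside in auto)
  have i2: "integrable M (\<lambda>y. tent p r y * g (?R y))"
  proof (rule integrable_bounded_support[where b = b and S = "cball p r"])
    show "\<bar>tent p r x * g (?R x)\<bar> \<le> b" if "u \<bullet> x = c" for x
    proof (cases "x \<in> cball p r")
      case True
      then have "\<bar>tent p r x\<bar> * \<bar>g (?R x)\<bar> \<le> 1 * b"
        using tent_le_1[OF r, of p x] bd[of "?R x"] sub[of "?R x"] Rc[of x] uR[OF that] by (intro mult_mono) auto
      then show ?thesis by (simp add: abs_mult)
    next
      case False
      then show ?thesis using tent_outside[OF r, of x p] 0 by simp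
    qed
  qed (use r tent_outside in auto)
  have "(\<integral>y. tent p r (?R y) * g (?R y) \<partial>M) = (\<integral>y. tent p r y * g y \<partial>M)"
    by (rule integral_reflect[OF _ p, of "\<lambda>y. tent p r y * g y"]) simp
  then have "2 * (\<integral>y. tent p r y * g y \<partial>M) = (\<integral>y. tent p r y * g y \<partial>M) + (\<integral>y. tent p r y * g (?R y) \<partial>M)"
    unfolding tent_reflect by simp
  also have "\<dots> = (\<integral>y. tent p r y * g y + tent p r y * g (?R y) \<partial>M)"
    using i1 i2 by simp
  also have "\<dots> \<le> (\<integral>y. tent p r y * (2 * g p) \<partial>M)"
  proof (rule integral_mono_AE)
    show "integrable M (\<lambda>y. tent p r y * g y + tent p r y * g (?R y))" using i1 i2 by simp
    show "integrable M (\<lambda>y. tent p r y * (2 * g p))" using integral_tent_pos(2)[OF p r] by simp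
    show "AE y in M. tent p r y * g y + tent p r y * g (?R y) \<le> tent p r y * (2 * g p)"
      using on_hyperplane
    proof eventually_elim
      case (elim y)
      show ?case
      proof (cases "y \<in> cball p r")
        case True
        have yC: "y \<in> C" "?R y \<in> C" using sub[OF elim True] sub[OF uR[OF elim]] Rc[of y] True by auto
        have "(1/2) * g y + (1/2) * g (?R y) \<le> g ((1/2) *\<^sub>R y + (1/2) *\<^sub>R ?R y)"
          using conc yC unfolding concave_on_iff by (metis field_sum_of_halves half_gt_zero_iff less_eq_real_def zero_less_one)
        also have "(1/2) *\<^sub>R y + (1/2) *\<^sub>R ?R y = p" by (simp add: algebra_simps)
        finally have "g y + g (?R y) \<le> 2 * g p" by simp
        then have "tent p r y * (g y + g (?R y)) \<le> tent p r y * (2 * g p)" by (intro mult_left_mono) auto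
        then show ?thesis by (simp add: distrib_left)
      next
        case False
        then show ?thesis using tent_outside[OF r, of y p] by simp
      qed
    qed
  qed
  also have "\<dots> = 2 * (g p * (\<integral>y. tent p r y \<partial>M))" by simp
  finally show ?thesis by simp
qed

text \<open>For \<open>x\<close> close to \<open>p\<close> the weights are nonnegative, and this is Jensen's inequality for the
  representation of \<open>x\<close> by the surrounding points.\<close>

lemma concave_ge_weighted_vertices:
  fixes g :: "'a \<Rightarrow> real"
  assumes conc: "concave_on C g" and p: "u \<bullet> p = c" and x: "u \<bullet> x = c" and r: "0 < r"
    and near: "norm (x - p) \<le> r / DIM('a)"
    and sub: "\<And>x. u \<bullet> x = c \<Longrightarrow> x \<in> cball p r \<Longrightarrow> x \<in> C"
  shows "(\<Sum>j\<in>dirs. wt p r j x * g (vert u p r j)) \<le> g x"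
proof -
  have vC: "vert u p r j \<in> C" if "j \<in> dirs" for j
    using sub[OF u_vert[OF p]] vert_near[OF that, of r p] r by (simp add: dist_norm norm_minus_commute)
  have "(\<Sum>j\<in>dirs. wt p r j x * g (vert u p r j)) \<le> g (\<Sum>j\<in>dirs. wt p r j x *\<^sub>R vert u p r j)"
  proof -
    have "- g (\<Sum>j\<in>dirs. wt p r j x *\<^sub>R vert u p r j) \<le> (\<Sum>j\<in>dirs. wt p r j x * - g (vert u p r j))"
      by (rule convex_on_sum[OF finite_dirs _ conc[unfolded concave_on_def] sum_wt])
        (use vC wt_nonneg[OF _ r near] in auto)
    then show ?thesis by (simp add: sum_negf)
  qed
  then show ?thesis unfolding sum_wt_vert[OF p x less_imp_neq[OF r, symmetric]] .
qed

end

context polytope_halfspaces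
begin

lemma core_neighbourhood:
  assumes i: "i \<in> I"
  obtains p r where "u i \<bullet> p = c i" "0 < r" "\<And>x. u i \<bullet> x = c i \<Longrightarrow> x \<in> cball p (2 * r) \<Longrightarrow> x \<in> core i r"
proof -
  obtain p where p: "u i \<bullet> p = c i" "\<forall>j\<in>I - {i}. u j \<bullet> p < c j" using facet_point[OF i] by blast
  define m where "m = Min (insert 1 ((\<lambda>j. c j - u j \<bullet> p) ` (I - {i})))"
  have m: "0 < m" unfolding m_def using fin p by (subst Min_gr_iff) auto
  have "u j \<bullet> x \<le> c j - m / 3" if "x \<in> cball p (2 * (m / 3))" "j \<in> I - {i}" for x j
  proof -
    have "\<bar>u j \<bullet> (x - p)\<bar> \<le> norm (u j) * norm (x - p)" by (rule Cauchy_Schwarz_ineq2)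
    also have "\<dots> \<le> 2 * (m / 3)" using that by (simp add: dist_norm norm_minus_commute)
    finally have "u j \<bullet> x \<le> u j \<bullet> p + 2 * (m / 3)" unfolding inner_diff_right by linarith
    moreover have "m \<le> c j - u j \<bullet> p" unfolding m_def using fin that by (intro Min_le) auto
    ultimately show ?thesis by linarith
  qed
  then show ?thesis using m p by (intro that[of p "m / 3"]) (auto simp: core_def)
qed

text \<open>The heights above the facet are at least of order \<open>- t\<close> at finitely many points surrounding
  \<open>p\<close>, hence near \<open>p\<close>, by concavity. A point of \<open>K t\<close> far above the hyperplane would lift, by
  concavity again, the average height near \<open>p\<close>, which is of order \<open>t\<close>.\<close>

lemma perturbs_upper_bound_facet:
  assumes K: "perturbs K D" and i: "i \<in> I"
  shows "\<exists>C. \<forall>\<^sub>F t in at_right 0. \<forall>y\<in>K t. u i \<bullet> y \<le> c i + C * t"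
proof -
  interpret hyperplane_chart "u i" "c i" "M i" using i by (rule chart)
  obtain p d where p: "u i \<bullet> p = c i" and d: "0 < d"
    and nb: "\<And>x. u i \<bullet> x = c i \<Longrightarrow> x \<in> cball p (2 * d) \<Longrightarrow> x \<in> core i d"
    using core_neighbourhood[OF i] by blast
  have nb1: "x \<in> core i d" if "u i \<bullet> x = c i" "x \<in> cball q d" "norm (q - p) \<le> d" for x q
  proof (rule nb[OF that(1)])
    have "dist p x \<le> dist p q + dist q x" by (rule dist_triangle)
    then show "x \<in> cball p (2 * d)" using that(2,3) by (simp add: dist_norm norm_minus_commute)
  qed
  let ?h = "\<lambda>t. height i d (K t)"
  let ?v = "vert (u i) p d"
  have vn: "norm (?v j - p) \<le> d" if "j \<in> dirs" for j using vert_near[OF that] d by simp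
  define n where "n = real (DIM('a))"
  have n: "1 \<le> n" unfolding n_def using DIM_positive[where 'a = 'a] by linarith
  have lim: "((\<lambda>t. (\<integral>x. tent q s x * ?h t x \<partial>M i) / t) \<longlongrightarrow> D (lift i d (tent q s))) (at_right 0)"
    if "u i \<bullet> q = c i" "norm (q - p) \<le> d" "0 < s" "s \<le> d" for q s
  proof (rule height_limit[OF K i d])
    show "continuous_on UNIV (tent q s)" using that by (intro continuous_tent)
    show "tent q s x = 0" if "u i \<bullet> x = c i" "x \<notin> core i d" for x
      using nb1[OF that(1) _ \<open>norm (q - p) \<le> d\<close>] that(2) \<open>s \<le> d\<close> \<open>0 < s\<close> by (intro tent_outside) force+
  qed
  define Z where "Z q s = (\<integral>x. tent q s x \<partial>M i)" for q s
  have Zpos: "0 < Z q s" if "u i \<bullet> q = c i" "0 < s" for q s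
    unfolding Z_def using integral_tent_pos(1)[OF that] .
  define A where "A = 1 + (\<Sum>j\<in>dirs. \<bar>(D (lift i d (tent (?v j) d)) - 1) / Z (?v j) d\<bar>)"
  define s where "s = d / (2 * n)"
  have s: "0 < s" "s \<le> d" using d n by (auto simp: s_def field_simps)
  define B where "B = D (lift i d (tent p s)) + 1"
  obtain R where R: "\<forall>\<^sub>F t in at_right 0. K t \<subseteq> cball x0 R" by (rule perturbs_bounded[OF K])
  define R' where "R' = \<bar>R\<bar> + dist x0 p"
  \<comment> \<open>small enough that a point near \<open>p\<close> is the combination, with weight \<open>l\<close>, of the foot of any
    point of \<open>K t\<close> and of another point near \<open>p\<close>\<close>
  define l where "l = s / (s + R') / 2"
  have R': "0 \<le> R'" by (simp add: R'_def)
  have l: "0 < l" "l \<le> 1/2" using s R' by (auto simp: l_def field_simps)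
  have l': "l / (1 - l) * (s + R') \<le> s"
  proof -
    have "l / (1 - l) \<le> 2 * l" using l by (simp add: field_simps)
    then have "l / (1 - l) * (s + R') \<le> 2 * l * (s + R')" using s R' by (intro mult_right_mono) auto
    also have "\<dots> = s"
    proof -
      have "s + R' \<noteq> 0" using add_pos_nonneg[OF s(1) R'] by simp
      moreover have "2 * (z / 2) = z" for z :: real by simp
      then have "2 * l = s / (s + R')" unfolding l_def .
      ultimately show ?thesis using nonzero_eq_divide_eq[of "s + R'" "2 * l" s] by blast
    qed
    finally show ?thesis .
  qed
  define C where "C = (B / Z p s + A) / l"
  have evv: "\<forall>\<^sub>F t in at_right 0. \<forall>j\<in>dirs. D (lift i d (tent (?v j) d)) - 1 < (\<integral>x. tent (?v j) d x * ?h t x \<partial>M i) / t"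
  proof (intro eventually_ball_finite finite_dirs ballI)
    fix j :: "'a \<times> real" assume j: "j \<in> dirs"
    show "\<forall>\<^sub>F t in at_right 0. D (lift i d (tent (?v j) d)) - 1 < (\<integral>x. tent (?v j) d x * ?h t x \<partial>M i) / t"
      by (rule order_tendstoD(1)[OF lim[OF u_vert[OF p] vn[OF j] d order_refl]]) simp
  qed
  have evp: "\<forall>\<^sub>F t in at_right 0. (\<integral>x. tent p s x * ?h t x \<partial>M i) / t < B"
    unfolding B_def by (rule order_tendstoD(2)[OF lim[OF p _ s]]) (use d in auto)
  have "\<forall>\<^sub>F t in at_right 0. \<forall>y\<in>K t. u i \<bullet> y \<le> c i + C * t"
    using evv evp R perturbs_thick[OF K i d] eventually_at_right_less[of 0]
  proof eventually_elim
    case (elim t)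
    have t: "0 < t" using elim by simp
    have th: "thick i d (K t)" using elim by simp
    have conc: "concave_on (core i d) (?h t)" by (rule concave_height[OF i d th])
    obtain b where b: "\<And>x. x \<in> core i d \<Longrightarrow> \<bar>?h t x\<bar> \<le> b" using height_bounded[OF i d th] by blast
    have hm[measurable]: "?h t \<in> borel_measurable borel"
      using th by (intro height_measurable[OF i]) (simp add: thick_def)
    have hv: "- A * t \<le> ?h t (?v j)" if j: "j \<in> dirs" for j
    proof -
      let ?D = "D (lift i d (tent (?v j) d)) - 1" and ?Z = "Z (?v j) d"
      have Z0: "0 < ?Z" using d by (intro Zpos u_vert p)
      have "?D < (\<integral>x. tent (?v j) d x * ?h t x \<partial>M i) / t" using elim(1) j by (rule bspec)
      then have "?D * t \<le> (\<integral>x. tent (?v j) d x * ?h t x \<partial>M i)"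
        using t by (simp only: pos_less_divide_eq less_imp_le)
      also have "\<dots> \<le> ?h t (?v j) * ?Z"
        unfolding Z_def by (rule tent_average_le[OF u_vert[OF p] d hm b conc nb1[OF _ _ vn[OF j]]])
      finally have "?D / ?Z * t \<le> ?h t (?v j)" using Z0 by (simp add: field_simps)
      moreover have "\<bar>?D / ?Z\<bar> \<le> (\<Sum>j\<in>dirs. \<bar>(D (lift i d (tent (?v j) d)) - 1) / Z (?v j) d\<bar>)"
        by (rule member_le_sum[OF j]) auto
      then have "- A \<le> ?D / ?Z" unfolding A_def by linarith
      then have "- A * t \<le> ?D / ?Z * t" by (rule mult_right_mono[OF _ less_imp_le[OF t]])
      ultimately show ?thesis by linarith
    qed
    have hx: "- A * t \<le> ?h t x" if x: "u i \<bullet> x = c i" "norm (x - p) \<le> d / n" for x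
    proof -
      have "- A * t = (\<Sum>j\<in>dirs. wt p d j x * (- A * t))"
        by (simp only: sum_distrib_right[symmetric] sum_wt mult_1)
      also have "\<dots> \<le> (\<Sum>j\<in>dirs. wt p d j x * ?h t (?v j))"
        using hv wt_nonneg[OF _ d, of _ x p] x(2) by (intro sum_mono mult_left_mono) (auto simp: n_def)
      also have "\<dots> \<le> ?h t x"
        by (rule concave_ge_weighted_vertices[OF conc p x(1) d _ nb1[of _ p]])
          (use x(2) d in \<open>auto simp: n_def\<close>)
      finally show ?thesis .
    qed
    show ?case
    proof
      fix y assume y: "y \<in> K t"
      define \<tau> where "\<tau> = u i \<bullet> y - c i"
      have "norm (foot y - p) \<le> norm (y - p)" by (rule norm_foot_le[OF p])
      also have "\<dots> \<le> dist y x0 + dist x0 p" unfolding dist_norm[symmetric] by (rule dist_triangle)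
      also have "\<dots> \<le> R'" using elim(3) y by (auto simp: R'_def dist_commute)
      finally have zR: "norm (foot y - p) \<le> R'" .
      have hw: "- A * t + l * \<tau> \<le> ?h t w" if w: "u i \<bullet> w = c i" "w \<in> cball p s" for w
      proof -
        define x where "x = w + (l / (1 - l)) *\<^sub>R (w - foot y)"
        have nw: "norm (w - p) \<le> s" using w(2) by (simp add: dist_norm norm_minus_commute)
        have ux: "u i \<bullet> x = c i" using w by (simp add: x_def inner_add_right inner_diff_right)
        have "norm (w - foot y) \<le> s + R'"
          using norm_triangle_ineq4[of "w - p" "foot y - p"] nw zR by simp
        then have "norm (x - w) \<le> s"
          using l' l mult_left_mono[of "norm (w - foot y)" "s + R'" "l / (1 - l)"] by (simp add: x_def)
        then have "norm (x - p) \<le> d / n"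
          using norm_triangle_ineq[of "x - w" "w - p"] nw by (simp add: s_def field_simps)
        then have hxt: "- A * t \<le> ?h t x" by (rule hx[OF ux])
        have xc: "x \<in> core i d"
        proof (rule nb1[OF ux, of p])
          have "d / n \<le> d / 1" using n d by (intro divide_left_mono) auto
          then show "x \<in> cball p d" using \<open>norm (x - p) \<le> d / n\<close>
            by (simp add: dist_norm norm_minus_commute)
        qed (use d in simp)
        have wc: "w \<in> core i d" using w s d by (intro nb1[OF w(1), of p]) auto
        have "(1 - l) *\<^sub>R (x + ?h t x *\<^sub>R u i) + l *\<^sub>R y \<in> K t"
          using th height_top(1)[OF i d th xc] y l by (intro convexD) (auto simp: thick_def)
        moreover have "(1 - l) *\<^sub>R x = w - l *\<^sub>R foot y"
        proof -
          have "(1 - l) *\<^sub>R x = (1 - l) *\<^sub>R w + ((1 - l) * (l / (1 - l))) *\<^sub>R (w - foot y)"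
            by (simp only: x_def scaleR_add_right scaleR_scaleR)
          also have "(1 - l) * (l / (1 - l)) = l" using l by simp
          finally show ?thesis by (simp add: algebra_simps)
        qed
        moreover have "y = foot y + \<tau> *\<^sub>R u i" by (simp add: foot_def \<tau>_def)
        then have "l *\<^sub>R y = l *\<^sub>R foot y + (l * \<tau>) *\<^sub>R u i" by (metis scaleR_add_right scaleR_scaleR)
        ultimately have "(w - l *\<^sub>R foot y + ((1 - l) * ?h t x) *\<^sub>R u i) + (l *\<^sub>R foot y + (l * \<tau>) *\<^sub>R u i) \<in> K t"
          by (simp only: scaleR_add_right scaleR_scaleR)
        also have "(w - l *\<^sub>R foot y + ((1 - l) * ?h t x) *\<^sub>R u i) + (l *\<^sub>R foot y + (l * \<tau>) *\<^sub>R u i)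
            = w + ((1 - l) * ?h t x + l * \<tau>) *\<^sub>R u i"
          by (simp add: algebra_simps)
        finally have "w + ((1 - l) * ?h t x + l * \<tau>) *\<^sub>R u i \<in> K t" .
        then have "(1 - l) * ?h t x + l * \<tau> \<le> ?h t w" by (rule height_top(2)[OF i d th wc])
        moreover have "(1 - l) * (- A * t) \<le> (1 - l) * ?h t x" using l hxt by (intro mult_left_mono) auto
        moreover have "- A * t \<le> (1 - l) * (- A * t)"
        proof -
          have "0 \<le> A" unfolding A_def by (intro add_nonneg_nonneg sum_nonneg) auto
          then show ?thesis using l t by (simp add: algebra_simps)
        qed
        ultimately show ?thesis by linarith
      qed
      have "(- A * t + l * \<tau>) * Z p s = (\<integral>x. tent p s x * (- A * t + l * \<tau>) \<partial>M i)"
        unfolding Z_def by simp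
      also have "\<dots> \<le> (\<integral>x. tent p s x * ?h t x \<partial>M i)"
      proof (rule integral_mono_AE)
        show "integrable (M i) (\<lambda>x. tent p s x * (- A * t + l * \<tau>))"
          using integral_tent_pos(2)[OF p s(1)] by simp
        have [measurable]: "tent p s \<in> borel_measurable borel"
          using s by (intro borel_measurable_continuous_onI continuous_tent)
        show "integrable (M i) (\<lambda>x. tent p s x * ?h t x)"
        proof (rule integrable_bounded_support[where b = "\<bar>b\<bar>" and S = "cball p s"])
          fix x assume x: "u i \<bullet> x = c i"
          show "\<bar>tent p s x * ?h t x\<bar> \<le> \<bar>b\<bar>"
          proof (cases "x \<in> cball p s")
            case True
            then have "\<bar>tent p s x\<bar> * \<bar>?h t x\<bar> \<le> 1 * \<bar>b\<bar>"
              using tent_le_1[OF s(1), of p x] b[of x] nb1[OF x, of p] s d by (intro mult_mono) force+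
            then show ?thesis by (simp add: abs_mult)
          next
            case False
            then show ?thesis using tent_outside[OF s(1), of x p] by simp
          qed
        qed (use tent_outside[OF s(1)] in auto)
        show "AE x in M i. tent p s x * (- A * t + l * \<tau>) \<le> tent p s x * ?h t x"
          using on_hyperplane
        proof eventually_elim
          case (elim x)
          then show ?case using hw[OF elim] tent_outside[OF s(1), of x p]
            by (cases "x \<in> cball p s") (auto intro: mult_left_mono)
        qed
      qed
      also have "\<dots> \<le> B * t" using elim(2) t by (simp add: field_simps less_imp_le)
      finally have "- A * t + l * \<tau> \<le> B / Z p s * t"
        using Zpos[OF p s(1)] by (simp add: field_simps)
      then have "l * \<tau> \<le> (B / Z p s + A) * t" by (simp add: algebra_simps)
      then have "\<tau> \<le> C * t" using l by (simp add: C_def field_simps)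
      then show "u i \<bullet> y \<le> c i + C * t" by (simp add: \<tau>_def)
    qed
  qed
  then show ?thesis by blast
qed

text \<open>So \<open>K t\<close> is squeezed into the polytope with all facets moved outwards by \<open>C t\<close>, whose weak
  derivative is known.\<close>

lemma perturbs_le_surface:
  assumes K: "perturbs K D"
  obtains C where "0 \<le> C" "\<And>f. continuous_on UNIV f \<Longrightarrow> (\<And>x. 0 \<le> f x) \<Longrightarrow>
      D f \<le> C * (\<Sum>i\<in>I. LINT x:face i|M i. f x)"
proof -
  have "\<forall>i\<in>I. \<exists>C. \<forall>\<^sub>F t in at_right 0. \<forall>y\<in>K t. u i \<bullet> y \<le> c i + C * t"
    using perturbs_upper_bound_facet[OF K] by (rule ballI)
  from bchoice[OF this] obtain C where
    C: "\<forall>i\<in>I. \<forall>\<^sub>F t in at_right 0. \<forall>y\<in>K t. u i \<bullet> y \<le> c i + C i * t" by (rule exE)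
  define C' where "C' = (\<Sum>i\<in>I. \<bar>C i\<bar>)"
  have C': "C i \<le> C'" if "i \<in> I" for i
    unfolding C'_def using member_le_sum[OF that, of "\<lambda>i. \<bar>C i\<bar>"] fin by auto
  let ?Q = "deformed (\<lambda>_. 0) (\<lambda>_. C')"
  have ev: "\<forall>\<^sub>F t in at_right 0. \<forall>i\<in>I. \<forall>y\<in>K t. u i \<bullet> y \<le> c i + C i * t"
    using fin C by (intro eventually_ball_finite) auto
  have sub: "\<forall>\<^sub>F t in at_right 0. K t \<subseteq> ?Q t"
    using ev eventually_at_right_less[of 0]
  proof eventually_elim
    case (elim t)
    have "u i \<bullet> y \<le> c i + t * (0 \<bullet> y + C')" if "i \<in> I" "y \<in> K t" for i y
    proof -
      have "C i * t \<le> C' * t" using C'[OF that(1)] elim by (intro mult_right_mono) auto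
      moreover have "u i \<bullet> y \<le> c i + C i * t" using elim(1) that by blast
      ultimately show ?thesis by (simp add: mult.commute)
    qed
    then show ?case by (auto simp: deformed_def)
  qed
  show ?thesis
  proof (rule that)
    show "0 \<le> C'" unfolding C'_def by (intro sum_nonneg) auto
    fix f :: "'a \<Rightarrow> real" assume f: "continuous_on UNIV f" and f0: "\<And>x. 0 \<le> f x"
    have l1: "((\<lambda>t. ((LINT x:?Q t|lborel. f x) - (LINT x:P|lborel. f x)) / t)
        \<longlongrightarrow> (\<Sum>i\<in>I. LINT x:face i|M i. f x * (0 \<bullet> x + C'))) (at_right 0)"
      by (rule first_variation[OF _ f]) auto
    have "D f \<le> (\<Sum>i\<in>I. LINT x:face i|M i. f x * (0 \<bullet> x + C'))"
    proof (rule tendsto_le[OF _ l1 perturbs_lim[OF K f]])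
      show "\<forall>\<^sub>F t in at_right 0. ((LINT x:K t|lborel. f x) - (LINT x:P|lborel. f x)) / t
          \<le> ((LINT x:?Q t|lborel. f x) - (LINT x:P|lborel. f x)) / t"
        using sub perturbs_ev[OF K] deformed_compact[of "\<lambda>_. 0" "\<lambda>_. C'"] eventually_at_right_less[of 0]
      proof eventually_elim
        case (elim t)
        have "set_integrable lborel (K t) f" "set_integrable lborel (?Q t) f"
          using elim f by (auto intro: set_integrable_compact)
        then have "(LINT x:K t|lborel. f x) \<le> (LINT x:?Q t|lborel. f x)"
          unfolding set_lebesgue_integral_def set_integrable_def
          using elim(1) f0 by (intro integral_mono) (auto simp: indicator_def)
        then show ?case using elim by (intro divide_right_mono) auto
      qed
    qed simp
    also have "\<dots> = C' * (\<Sum>i\<in>I. LINT x:face i|M i. f x)"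
      by (simp add: sum_distrib_left mult.commute)
    finally show "D f \<le> C' * (\<Sum>i\<in>I. LINT x:face i|M i. f x)" .
  qed
qed


lemma integrable_core_product:
  fixes g :: "'a \<Rightarrow> real"
  assumes i: "i \<in> I" and d: "0 < d" and \<phi>: "continuous_on UNIV \<phi>"
    and supp: "\<And>x. u i \<bullet> x = c i \<Longrightarrow> x \<notin> core i d \<Longrightarrow> \<phi> x = 0"
    and g: "g \<in> borel_measurable borel" and bd: "\<And>x. x \<in> core i d \<Longrightarrow> \<bar>g x\<bar> \<le> b"
  shows "integrable (M i) (\<lambda>x. \<phi> x * g x)"
proof -
  interpret hyperplane_chart "u i" "c i" "M i" using i by (rule chart)
  have [measurable]: "\<phi> \<in> borel_measurable borel" using \<phi> by (rule borel_measurable_continuous_onI)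
  have "bounded (\<phi> ` core i d)"
    using \<phi> compact_core[OF d i] by (intro compact_imp_bounded compact_continuous_image) (auto intro: continuous_on_subset)
  then obtain b' where b': "\<forall>x\<in>core i d. \<bar>\<phi> x\<bar> \<le> b'" unfolding bounded_iff by auto
  have bc: "bounded (core i d)" using compact_core[OF d i] by (rule compact_imp_bounded)
  have "\<bar>\<phi> x * g x\<bar> \<le> \<bar>b'\<bar> * \<bar>b\<bar>" if x: "u i \<bullet> x = c i" for x
  proof (cases "x \<in> core i d")
    case True
    have "\<bar>\<phi> x\<bar> \<le> \<bar>b'\<bar>" "\<bar>g x\<bar> \<le> \<bar>b\<bar>" using b' bd True by force+
    then show ?thesis unfolding abs_mult by (intro mult_mono) auto
  qed (use supp[OF x] in simp)
  then show ?thesis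
    using g by (intro integrable_bounded_support[OF _ _ bc]) (use supp in auto)
qed

lemma lift_add: "lift i d (\<lambda>x. \<phi> x + \<psi> x) = (\<lambda>y. lift i d \<phi> y + lift i d \<psi> y)"
  by (rule ext) (simp add: lift_def algebra_simps)

lemma lift_cmult: "lift i d (\<lambda>x. k * \<phi> x) = (\<lambda>y. k * lift i d \<phi> y)"
  by (rule ext) (simp add: lift_def)

lemma perturbs_lift_add:
  assumes "perturbs K D" "continuous_on UNIV \<phi>" "continuous_on UNIV \<psi>"
  shows "D (lift i d (\<lambda>x. \<phi> x + \<psi> x)) = D (lift i d \<phi>) + D (lift i d \<psi>)"
  unfolding lift_add by (intro perturbs_linear[OF assms(1)] continuous_lift assms)

lemma perturbs_lift_cmult:
  assumes "perturbs K D" "continuous_on UNIV \<phi>"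
  shows "D (lift i d (\<lambda>x. k * \<phi> x)) = k * D (lift i d \<phi>)"
  unfolding lift_cmult using continuous_lift[OF assms(2)] by (intro perturbs_linear(2)[OF assms(1)])

lemma perturbs_lift_sum:
  assumes K: "perturbs K D" and J: "finite J" and \<phi>: "\<And>j. j \<in> J \<Longrightarrow> continuous_on UNIV (\<phi> j)"
  shows "D (lift i d (\<lambda>x. \<Sum>j\<in>J. \<phi> j x)) = (\<Sum>j\<in>J. D (lift i d (\<phi> j)))"
  using J \<phi>
proof (induction J rule: finite_induct)
  case empty
  show ?case using perturbs_lift_cmult[OF K continuous_on_const[of _ 0], of i d 0] by simp
next
  case (insert j J)
  then show ?case
    by (simp add: perturbs_lift_add[OF K] continuous_on_sum)
qed

text \<open>The heights are concave functions, and the derivative is a limit of integrals against their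
  positive multiples.\<close>

lemma perturbs_test_nonpos:
  assumes K: "perturbs K D" and i: "i \<in> I" and d: "0 < d" and \<phi>: "continuous_on UNIV \<phi>"
    and supp: "\<And>x. u i \<bullet> x = c i \<Longrightarrow> x \<notin> core i d \<Longrightarrow> \<phi> x = 0"
    and test: "\<And>g b. g \<in> borel_measurable borel \<Longrightarrow> (\<And>x. x \<in> core i d \<Longrightarrow> \<bar>g x\<bar> \<le> b) \<Longrightarrow>
        concave_on (core i d) g \<Longrightarrow> (\<integral>x. \<phi> x * g x \<partial>M i) \<le> 0"
  shows "D (lift i d \<phi>) \<le> 0"
proof (rule tendsto_upperbound[OF height_limit[OF K i d \<phi> supp]])
  show "\<forall>\<^sub>F t in at_right 0. (\<integral>x. \<phi> x * height i d (K t) x \<partial>M i) / t \<le> 0"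
    using perturbs_thick[OF K i d] eventually_at_right_less[of 0]
  proof eventually_elim
    case (elim t)
    obtain b where "\<And>x. x \<in> core i d \<Longrightarrow> \<bar>height i d (K t) x\<bar> \<le> b"
      using height_bounded[OF i d elim(1)] by blast
    then have "(\<integral>x. \<phi> x * height i d (K t) x \<partial>M i) \<le> 0"
      using elim(1) by (intro test[of _ b] concave_height[OF i d] height_measurable[OF i]) (auto simp: thick_def)
    then show ?case using elim(2) by (simp add: divide_nonpos_pos)
  qed
qed simp_all

text \<open>Over the smaller core both heights are the upper end of the same chord.\<close>

lemma perturbs_lift_indep:
  assumes K: "perturbs K D" and i: "i \<in> I" and d: "0 < d'" "d' \<le> d" and \<phi>: "continuous_on UNIV \<phi>"
    and supp: "\<And>x. u i \<bullet> x = c i \<Longrightarrow> x \<notin> core i d \<Longrightarrow> \<phi> x = 0"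
  shows "D (lift i d \<phi>) = D (lift i d' \<phi>)"
proof -
  interpret hyperplane_chart "u i" "c i" "M i" using i by (rule chart)
  have d0: "0 < d" using d by simp
  have [measurable]: "\<phi> \<in> borel_measurable borel" using \<phi> by (rule borel_measurable_continuous_onI)
  have supp': "\<phi> x = 0" if "u i \<bullet> x = c i" "x \<notin> core i d'" for x
    using supp[OF that(1)] that(2) core_antimono[OF d(2), of i] by blast
  have "\<forall>\<^sub>F t in at_right 0. (\<integral>x. \<phi> x * height i d (K t) x \<partial>M i) / t = (\<integral>x. \<phi> x * height i d' (K t) x \<partial>M i) / t"
    using perturbs_thick[OF K i d0] perturbs_thick[OF K i d(1)]
  proof eventually_elim
    case (elim t)
    have [measurable]: "height i d (K t) \<in> borel_measurable borel" "height i d' (K t) \<in> borel_measurable borel"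
      using elim by (auto intro!: height_measurable[OF i] simp: thick_def)
    have "(\<integral>x. \<phi> x * height i d (K t) x \<partial>M i) = (\<integral>x. \<phi> x * height i d' (K t) x \<partial>M i)"
    proof (rule integral_cong_AE)
      show "AE x in M i. \<phi> x * height i d (K t) x = \<phi> x * height i d' (K t) x"
        using on_hyperplane
      proof eventually_elim
        case (elim x)
        show ?case
        proof (cases "x \<in> core i d")
          case True
          then have x': "x \<in> core i d'" using core_antimono[OF d(2), of i] by blast
          have "height i d (K t) x = height i d' (K t) x"
            using height_top[OF i d(1) \<open>thick i d' (K t)\<close> x']
            by (intro height_eqI[OF i d0 \<open>thick i d (K t)\<close> True]) auto
          then show ?thesis by simp
        qed (use supp[OF elim] in simp)
      qed
    qed measurable
    then show ?case by simp
  qed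
  from Lim_transform_eventually[OF height_limit[OF K i d0 \<phi> supp] this]
  show ?thesis
    using height_limit[OF K i d(1) \<phi> supp'] by (intro tendsto_unique[of "at_right 0"]) auto
qed

text \<open>The bodies of a second family have the opposite derivative. A function whose integral
  against every concave function is at most 0 is a direction in which neither family can gain, so
  that its derivative vanishes. The derivative on functions near \<open>p\<close> is thereby
  determined by its values on finitely many tents, and interpolating those values by an affine
  function gives the density. A homothety with centre \<open>p\<close> carries this to the whole facet.\<close>

lemma reversible_affine_density:
  assumes K: "perturbs K D" and K': "perturbs K' D'"
    and opp: "\<And>f. continuous_on UNIV f \<Longrightarrow> D' f = - D f" and i: "i \<in> I"
  obtains a b where "a \<bullet> u i = 0"
    "\<And>d \<phi>. 0 < d \<Longrightarrow> continuous_on UNIV \<phi> \<Longrightarrow> (\<And>x. 0 \<le> \<phi> x) \<Longrightarrow>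
       (\<And>x. u i \<bullet> x = c i \<Longrightarrow> x \<notin> core i d \<Longrightarrow> \<phi> x = 0) \<Longrightarrow>
       D (lift i d \<phi>) = (\<integral>x. \<phi> x * (a \<bullet> x + b) \<partial>M i)"
proof -
  interpret hyperplane_chart "u i" "c i" "M i" using i by (rule chart)
  obtain p r where p: "u i \<bullet> p = c i" and r: "0 < r"
    and nb: "\<And>x. u i \<bullet> x = c i \<Longrightarrow> x \<in> cball p (2 * r) \<Longrightarrow> x \<in> core i r"
    using core_neighbourhood[OF i] by blast
  have nb1: "x \<in> core i r" if "u i \<bullet> x = c i" "x \<in> cball q r" "norm (q - p) \<le> r" for x q
  proof (rule nb[OF that(1)])
    have "dist p x \<le> dist p q + dist q x" by (rule dist_triangle)
    then show "x \<in> cball p (2 * r)" using that(2,3) by (simp add: dist_norm norm_minus_commute)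
  qed
  have zero: "D (lift i d f) = 0"
    if d: "0 < d" and f: "continuous_on UNIV f" and supp: "\<And>x. u i \<bullet> x = c i \<Longrightarrow> x \<notin> core i d \<Longrightarrow> f x = 0"
      and test: "\<And>g b. g \<in> borel_measurable borel \<Longrightarrow> (\<And>x. x \<in> core i d \<Longrightarrow> \<bar>g x\<bar> \<le> b) \<Longrightarrow>
        concave_on (core i d) g \<Longrightarrow> (\<integral>x. f x * g x \<partial>M i) \<le> 0" for f d
    using perturbs_test_nonpos[OF K i d f supp test] perturbs_test_nonpos[OF K' i d f supp test]
      opp[OF continuous_lift[OF f]] by force
  let ?v = "vert (u i) p r"
  have vn: "norm (?v j - p) \<le> r" if "j \<in> dirs" for j using vert_near[OF that] r by simp
  have uv: "u i \<bullet> ?v j = c i" for j by (rule u_vert[OF p])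
  define n where "n = real (DIM('a))"
  have n: "1 \<le> n" unfolding n_def using DIM_positive[where 'a = 'a] by linarith
  define s where "s = r / n"
  have s: "0 < s" "s \<le> r" using r n by (auto simp: s_def field_simps)
  have nbs: "x \<in> core i r" if "u i \<bullet> x = c i" "x \<in> cball p s" for x
    using nb1[OF that(1), of p] that(2) s r by auto
  define Z where "Z j = (\<integral>x. tent (?v j) r x \<partial>M i)" for j
  have Z: "0 < Z j" for j unfolding Z_def using integral_tent_pos(1)[OF uv r] .
  define e where "e j = D (lift i r (tent (?v j) r)) / Z j" for j
  define h where "h x = (\<Sum>j\<in>dirs. e j * wt p r j x)" for x
  obtain a b where h: "\<And>x. h x = a \<bullet> x + b"
    unfolding h_def by (rule affine_sum_wt[of e p r]) blast
  have hc: "continuous_on UNIV h" unfolding h by (intro continuous_intros)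
  have hm[measurable]: "h \<in> borel_measurable borel" using hc by (rule borel_measurable_continuous_onI)
  have tent_supp: "tent (?v j) r x = 0" if "j \<in> dirs" "u i \<bullet> x = c i" "x \<notin> core i r" for j x
    using nb1[OF that(2) _ vn[OF that(1)]] that(3) by (intro tent_outside[OF r]) auto
  have near: "D (lift i r \<phi>) = (\<integral>x. \<phi> x * h x \<partial>M i)"
    if \<phi>: "continuous_on UNIV \<phi>" and nn: "\<And>x. 0 \<le> \<phi> x"
      and supp: "\<And>x. u i \<bullet> x = c i \<Longrightarrow> x \<notin> cball p s \<Longrightarrow> \<phi> x = 0" for \<phi>
  proof -
    have supp': "\<phi> x = 0" if "u i \<bullet> x = c i" "x \<notin> core i r" for x using supp[OF that(1)] nbs[OF that(1)] that(2) by blast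
    define q where "q j = (\<integral>x. \<phi> x * wt p r j x \<partial>M i)" for j
    have wti: "integrable (M i) (\<lambda>x. \<phi> x * wt p r j x)" for j
    proof -
      have "bounded (wt p r j ` core i r)"
        using compact_core[OF r i] by (intro compact_imp_bounded compact_continuous_image continuous_wt)
      then obtain b where "\<forall>x\<in>core i r. \<bar>wt p r j x\<bar> \<le> b" unfolding bounded_iff by auto
      then show ?thesis
        using integrable_core_product[OF i r \<phi> supp' borel_measurable_continuous_onI[OF continuous_wt]] by blast
    qed
    have q: "0 \<le> q j" if j: "j \<in> dirs" for j
      unfolding q_def
    proof (rule integral_nonneg_AE)
      show "AE x in M i. 0 \<le> \<phi> x * wt p r j x"
        using on_hyperplane
      proof eventually_elim
        case (elim x)
        then show ?case
          using supp[of x] nn[of x] wt_nonneg[OF j r, of x p]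
          by (cases "x \<in> cball p s") (auto simp: dist_norm norm_minus_commute s_def n_def)
      qed
    qed
    \<comment> \<open>The tents average \<open>g\<close> to at most its values at the surrounding points, and the combination
      of these values with the weights is at most \<open>g\<close>.\<close>
    let ?f = "\<lambda>x. (\<Sum>j\<in>dirs. q j / Z j * tent (?v j) r x) + (- 1) * \<phi> x"
    have tc: "continuous_on UNIV (\<lambda>x. q j / Z j * tent (?v j) r x)" for j
      by (intro continuous_on_mult_left continuous_tent r)
    have "D (lift i r ?f) = 0"
    proof (rule zero[OF r])
      show "continuous_on UNIV ?f"
        by (rule continuous_on_add, rule continuous_on_sum, rule tc, rule continuous_on_mult_left, rule \<phi>)
      show "?f x = 0" if "u i \<bullet> x = c i" "x \<notin> core i r" for x
        using tent_supp[OF _ that] supp'[OF that] by simp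
      fix g b assume g: "g \<in> borel_measurable borel" and bd: "\<And>x. x \<in> core i r \<Longrightarrow> \<bar>g x\<bar> \<le> b"
        and conc: "concave_on (core i r) g"
      have ti: "integrable (M i) (\<lambda>x. tent (?v j) r x * g x)" if "j \<in> dirs" for j
        by (rule integrable_core_product[OF i r continuous_tent[OF r] tent_supp[OF that] g bd])
      have \<phi>i: "integrable (M i) (\<lambda>x. \<phi> x * g x)"
        by (rule integrable_core_product[OF i r \<phi> supp' g bd])
      have "(\<integral>x. ?f x * g x \<partial>M i) = (\<integral>x. (\<Sum>j\<in>dirs. q j / Z j * (tent (?v j) r x * g x)) - \<phi> x * g x \<partial>M i)"
      proof -
        have "?f x * g x = (\<Sum>j\<in>dirs. q j / Z j * tent (?v j) r x) * g x - \<phi> x * g x" for x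
          by (simp only: distrib_right mult_minus_left mult_1 diff_conv_add_uminus)
        then show ?thesis by (simp only: sum_distrib_right mult.assoc)
      qed
      also have "\<dots> = (\<Sum>j\<in>dirs. q j / Z j * (\<integral>x. tent (?v j) r x * g x \<partial>M i)) - (\<integral>x. \<phi> x * g x \<partial>M i)"
      proof -
        have "integrable (M i) (\<lambda>x. q j / Z j * (tent (?v j) r x * g x))" if "j \<in> dirs" for j
          using ti[OF that] by (rule integrable_mult_right)
        then show ?thesis using \<phi>i
          by (subst Bochner_Integration.integral_diff) (auto intro!: Bochner_Integration.integrable_sum simp del: times_divide_eq_left)
      qed
      also have "(\<Sum>j\<in>dirs. q j / Z j * (\<integral>x. tent (?v j) r x * g x \<partial>M i)) \<le> (\<Sum>j\<in>dirs. q j * g (?v j))"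
      proof (rule sum_mono)
        fix j :: "'a \<times> real" assume j: "j \<in> dirs"
        have "(\<integral>x. tent (?v j) r x * g x \<partial>M i) \<le> g (?v j) * Z j"
          unfolding Z_def by (rule tent_average_le[OF uv r g bd conc nb1[OF _ _ vn[OF j]]])
        then have "q j / Z j * (\<integral>x. tent (?v j) r x * g x \<partial>M i) \<le> q j / Z j * (g (?v j) * Z j)"
          using q[OF j] Z[of j] by (intro mult_left_mono) auto
        then show "q j / Z j * (\<integral>x. tent (?v j) r x * g x \<partial>M i) \<le> q j * g (?v j)"
          using Z[of j] by simp
      qed
      also have "(\<Sum>j\<in>dirs. q j * g (?v j)) = (\<integral>x. (\<Sum>j\<in>dirs. \<phi> x * wt p r j x * g (?v j)) \<partial>M i)"
        using wti by (subst Bochner_Integration.integral_sum) (auto simp: q_def)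
      also have "\<dots> \<le> (\<integral>x. \<phi> x * g x \<partial>M i)"
      proof (rule integral_mono_AE[OF _ \<phi>i])
        show "integrable (M i) (\<lambda>x. \<Sum>j\<in>dirs. \<phi> x * wt p r j x * g (?v j))"
          using wti by (intro Bochner_Integration.integrable_sum integrable_mult_left)
        show "AE x in M i. (\<Sum>j\<in>dirs. \<phi> x * wt p r j x * g (?v j)) \<le> \<phi> x * g x"
          using on_hyperplane
        proof eventually_elim
          case (elim x)
          show ?case
          proof (cases "x \<in> cball p s")
            case True
            then have nx: "norm (x - p) \<le> r / DIM('a)" by (simp add: dist_norm norm_minus_commute s_def n_def)
            have "(\<Sum>j\<in>dirs. wt p r j x * g (?v j)) \<le> g x"
              by (rule concave_ge_weighted_vertices[OF conc p elim r nx nb1[of _ p]]) (use r in auto)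
            then have "\<phi> x * (\<Sum>j\<in>dirs. wt p r j x * g (?v j)) \<le> \<phi> x * g x" using nn by (rule mult_left_mono)
            then show ?thesis by (simp only: sum_distrib_left mult.assoc)
          qed (use supp[OF elim] in simp)
        qed
      qed
      finally show "(\<integral>x. ?f x * g x \<partial>M i) \<le> 0" by simp
    qed
    moreover have "D (lift i r ?f) = (\<Sum>j\<in>dirs. q j / Z j * D (lift i r (tent (?v j) r))) + (- 1) * D (lift i r \<phi>)"
    proof -
      have "D (lift i r ?f) = D (lift i r (\<lambda>x. \<Sum>j\<in>dirs. q j / Z j * tent (?v j) r x)) + D (lift i r (\<lambda>x. (- 1) * \<phi> x))"
        by (rule perturbs_lift_add[OF K]) (intro continuous_on_sum tc continuous_on_mult_left \<phi>)+
      also have "D (lift i r (\<lambda>x. \<Sum>j\<in>dirs. q j / Z j * tent (?v j) r x)) = (\<Sum>j\<in>dirs. D (lift i r (\<lambda>x. q j / Z j * tent (?v j) r x)))"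
        by (rule perturbs_lift_sum[OF K finite_dirs tc])
      finally show ?thesis
        by (simp only: perturbs_lift_cmult[OF K \<phi>] perturbs_lift_cmult[OF K continuous_tent[OF r]])
    qed
    ultimately have "D (lift i r \<phi>) = (\<Sum>j\<in>dirs. q j / Z j * D (lift i r (tent (?v j) r)))" by simp
    also have "\<dots> = (\<Sum>j\<in>dirs. q j * e j)" by (simp add: e_def)
    also have "\<dots> = (\<integral>x. (\<Sum>j\<in>dirs. \<phi> x * wt p r j x * e j) \<partial>M i)"
      using wti by (subst Bochner_Integration.integral_sum) (auto simp: q_def)
    also have "\<dots> = (\<integral>x. \<phi> x * h x \<partial>M i)"
      by (simp add: h_def sum_distrib_left ac_simps)
    finally show ?thesis .
  qed
  have haff: "h ((1 - l) *\<^sub>R x + l *\<^sub>R y) = (1 - l) * h x + l * h y" for l x y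
    unfolding h by (simp add: inner_add_right algebra_simps)
  have conc_h: "concave_on S h" "concave_on S (\<lambda>x. - h x)" if "convex S" for S
  proof -
    have "h (v *\<^sub>R x + w *\<^sub>R y) = v * h x + w * h y" if "v + w = 1" for v w x y
    proof -
      have "v = 1 - w" using that by simp
      then show ?thesis using haff[of w x y] by simp
    qed
    then show "concave_on S h" "concave_on S (\<lambda>x. - h x)"
      using that by (simp_all add: concave_on_iff)
  qed
  have tent_h: "(\<integral>x. tent p s x * h x \<partial>M i) = h p * (\<integral>x. tent p s x \<partial>M i)"
  proof -
    have "bounded (h ` cball p s)"
      using hc by (intro compact_imp_bounded compact_continuous_image) (auto intro: continuous_on_subset)
    then obtain b where b: "\<forall>x\<in>cball p s. \<bar>h x\<bar> \<le> b" unfolding bounded_iff by auto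
    have "(\<integral>x. tent p s x * h x \<partial>M i) \<le> h p * (\<integral>x. tent p s x \<partial>M i)"
      by (rule tent_average_le[OF p s(1) hm, of "cball p s" b]) (use b conc_h in auto)
    moreover have "(\<integral>x. tent p s x * - h x \<partial>M i) \<le> - h p * (\<integral>x. tent p s x \<partial>M i)"
      by (rule tent_average_le[OF p s(1), of "\<lambda>x. - h x" "cball p s" b]) (use b conc_h in auto)
    ultimately show ?thesis by simp
  qed
  have main: "D (lift i d \<phi>) = (\<integral>x. \<phi> x * h x \<partial>M i)"
    if d: "0 < d" and \<phi>: "continuous_on UNIV \<phi>" and nn: "\<And>x. 0 \<le> \<phi> x"
      and supp: "\<And>x. u i \<bullet> x = c i \<Longrightarrow> x \<notin> core i d \<Longrightarrow> \<phi> x = 0" for d \<phi>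
  proof -
    have [measurable]: "\<phi> \<in> borel_measurable borel" using \<phi> by (rule borel_measurable_continuous_onI)
    define d' where "d' = min d r"
    have d': "0 < d'" "d' \<le> d" "d' \<le> r" using d r by (auto simp: d'_def)
    have sub: "core i d \<subseteq> core i d'" "core i r \<subseteq> core i d'" using d' by (auto intro!: core_antimono)
    obtain R where R: "\<forall>x\<in>core i d. dist p x \<le> R"
      using compact_imp_bounded[OF compact_core[OF d i]] bounded_any_center[of "core i d" p] by auto
    define l where "l = min 1 (s / (\<bar>R\<bar> + 1))"
    have l: "0 < l" "l \<le> 1" using s by (auto simp: l_def)
    have lR: "l * \<bar>R\<bar> \<le> s"
    proof -
      have "l * \<bar>R\<bar> \<le> s / (\<bar>R\<bar> + 1) * (\<bar>R\<bar> + 1)" using s by (intro mult_mono) (auto simp: l_def)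
      also have "\<dots> = s" by simp
      finally show ?thesis .
    qed
    let ?c = "\<lambda>x. p + l *\<^sub>R (x - p)"
    define \<phi>' where "\<phi>' y = \<phi> (p + (1 / l) *\<^sub>R (y - p))" for y
    define k where "k = \<bar>1 / l\<bar> / \<bar>1 / l\<bar> ^ DIM('a)"
    have k: "0 < k" using l by (simp add: k_def)
    have \<phi>'c: "continuous_on UNIV \<phi>'"
      unfolding \<phi>'_def by (intro continuous_on_compose2[OF \<phi>] continuous_intros) auto
    have \<phi>'nn: "0 \<le> \<phi>' y" for y using nn by (simp add: \<phi>'_def)
    have \<phi>'supp: "\<phi>' y = 0" if y: "u i \<bullet> y = c i" "y \<notin> cball p s" for y
      unfolding \<phi>'_def
    proof (rule supp)
      show "u i \<bullet> (p + (1 / l) *\<^sub>R (y - p)) = c i" using p y by (simp add: inner_add_right inner_diff_right)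
      show "p + (1 / l) *\<^sub>R (y - p) \<notin> core i d"
      proof
        assume "p + (1 / l) *\<^sub>R (y - p) \<in> core i d"
        then have "dist p (p + (1 / l) *\<^sub>R (y - p)) \<le> \<bar>R\<bar>" using R by force
        moreover have "dist p (p + z) = norm z" for z by (simp add: dist_norm)
        ultimately have "norm ((1 / l) *\<^sub>R (y - p)) \<le> \<bar>R\<bar>" by (simp only:)
        then have "norm (y - p) / l \<le> \<bar>R\<bar>" using l unfolding norm_scaleR by simp
        then have "norm (y - p) \<le> l * \<bar>R\<bar>" using l(1) by (simp add: pos_divide_le_eq mult.commute)
        then show False using lR y(2) by (simp add: dist_norm norm_minus_commute)
      qed
    qed
    have hom: "(\<integral>y. \<phi>' y * g y \<partial>M i) = k * (\<integral>x. \<phi> x * g (?c x) \<partial>M i)"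
      if [measurable]: "g \<in> borel_measurable borel" for g
    proof -
      have inv: "?c (p + (1 / l) *\<^sub>R (y - p)) = y" for y using l by simp
      have "(\<lambda>x. \<phi> x * g (?c x)) \<in> borel_measurable borel" by measurable
      from integral_homothety[OF this p, of "1 / l"] l show ?thesis
        unfolding inv by (simp add: \<phi>'_def k_def)
    qed
    define Zp where "Zp = (\<integral>x. tent p s x \<partial>M i)"
    have Zp: "0 < Zp" unfolding Zp_def using integral_tent_pos(1)[OF p s(1)] .
    define w where "w = (1 - l) * (\<integral>x. \<phi> x \<partial>M i) / Zp"
    have w: "0 \<le> w" unfolding w_def using l Zp nn by (intro divide_nonneg_pos mult_nonneg_nonneg) (auto intro: integral_nonneg)
    have ts: "tent p s x = 0" if "u i \<bullet> x = c i" "x \<notin> core i r" for x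
      using nbs[OF that(1)] that(2) by (intro tent_outside[OF s(1)]) auto
    have \<phi>'r: "\<phi>' x = 0" if "u i \<bullet> x = c i" "x \<notin> core i r" for x
      using nbs[OF that(1)] that(2) \<phi>'supp[OF that(1)] by blast
    have supp': "\<phi> x = 0" "tent p s x = 0" "\<phi>' x = 0" if "u i \<bullet> x = c i" "x \<notin> core i d'" for x
      using that sub supp[OF that(1)] ts[OF that(1)] \<phi>'r[OF that(1)] by blast+
    have pc: "p \<in> core i d'" using nbs[OF p] s sub by auto
    have tc: "continuous_on UNIV (tent p s)" by (rule continuous_tent[OF s(1)])
    have one: "integrable (M i) \<phi>"
      using integrable_core_product[OF i d \<phi> supp, of "\<lambda>_. 1" 1] by simp
    \<comment> \<open>This expresses that \<open>g\<close> at the contracted point \<open>?c x\<close> is at least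
      \<open>l * g x + (1 - l) * g p\<close>, integrated against \<open>\<phi>\<close>, with \<open>g p\<close> replaced by an average.\<close>
    let ?f = "\<lambda>x. (l * \<phi> x + w * tent p s x) + (- 1 / k) * \<phi>' x"
    have "D (lift i d' ?f) = 0"
    proof (rule zero[OF d'(1)])
      show "continuous_on UNIV ?f" by (intro continuous_intros \<phi> tc \<phi>'c)
      show "?f x = 0" if "u i \<bullet> x = c i" "x \<notin> core i d'" for x using supp'[OF that] by simp
      fix g b assume g[measurable]: "g \<in> borel_measurable borel" and bd: "\<And>x. x \<in> core i d' \<Longrightarrow> \<bar>g x\<bar> \<le> b"
        and conc: "concave_on (core i d') g"
      have cc: "?c x \<in> core i d' \<and> (1 - l) * g p + l * g x \<le> g (?c x)" if x: "x \<in> core i d'" for x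
      proof -
        have "(1 - l) *\<^sub>R p + l *\<^sub>R x = ?c x" by (simp add: algebra_simps)
        moreover have "(1 - l) *\<^sub>R p + l *\<^sub>R x \<in> core i d'"
          using convexD[OF convex_core pc x, of "1 - l" l] l by simp
        moreover have "(1 - l) * g p + l * g x \<le> g ((1 - l) *\<^sub>R p + l *\<^sub>R x)"
          using concave_onD[OF conc, of l p x] l pc x by simp
        ultimately show ?thesis by simp
      qed
      have i1: "integrable (M i) (\<lambda>x. \<phi> x * g x)"
        by (rule integrable_core_product[OF i d'(1) \<phi> supp'(1) g bd])
      have i2: "integrable (M i) (\<lambda>x. tent p s x * g x)"
        by (rule integrable_core_product[OF i d'(1) tc supp'(2) g bd])
      have i3: "integrable (M i) (\<lambda>x. \<phi>' x * g x)"
        by (rule integrable_core_product[OF i d'(1) \<phi>'c supp'(3) g bd])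
      have i4: "integrable (M i) (\<lambda>x. \<phi> x * g (?c x))"
        by (rule integrable_core_product[OF i d'(1) \<phi> supp'(1)]) (use cc bd in auto)
      have "(\<integral>x. ?f x * g x \<partial>M i) = (\<integral>x. (l * (\<phi> x * g x) + w * (tent p s x * g x)) + (- 1 / k) * (\<phi>' x * g x) \<partial>M i)"
        by (simp add: algebra_simps)
      also have "\<dots> = (l * (\<integral>x. \<phi> x * g x \<partial>M i) + w * (\<integral>x. tent p s x * g x \<partial>M i)) + (- 1 / k) * (\<integral>x. \<phi>' x * g x \<partial>M i)"
        using i1 i2 i3 by simp
      also have "\<dots> = l * (\<integral>x. \<phi> x * g x \<partial>M i) + w * (\<integral>x. tent p s x * g x \<partial>M i) - (\<integral>x. \<phi> x * g (?c x) \<partial>M i)"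
        using k by (simp add: hom[OF g])
      also have "w * (\<integral>x. tent p s x * g x \<partial>M i) \<le> w * (g p * Zp)"
        unfolding Zp_def using w sub nbs
        by (intro mult_left_mono tent_average_le[OF p s(1) g bd conc]) auto
      also have "w * (g p * Zp) = (1 - l) * g p * (\<integral>x. \<phi> x \<partial>M i)"
        using Zp by (simp add: w_def)
      also have "l * (\<integral>x. \<phi> x * g x \<partial>M i) + (1 - l) * g p * (\<integral>x. \<phi> x \<partial>M i)
          = (\<integral>x. l * (\<phi> x * g x) + (1 - l) * g p * \<phi> x \<partial>M i)"
        using i1 one by simp
      also have "\<dots> \<le> (\<integral>x. \<phi> x * g (?c x) \<partial>M i)"
      proof (rule integral_mono_AE[OF _ i4])
        show "integrable (M i) (\<lambda>x. l * (\<phi> x * g x) + (1 - l) * g p * \<phi> x)" using i1 one by simp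
        show "AE x in M i. l * (\<phi> x * g x) + (1 - l) * g p * \<phi> x \<le> \<phi> x * g (?c x)"
          using on_hyperplane
        proof eventually_elim
          case (elim x)
          show ?case
          proof (cases "x \<in> core i d'")
            case True
            then have "\<phi> x * ((1 - l) * g p + l * g x) \<le> \<phi> x * g (?c x)"
              using cc nn by (intro mult_left_mono) auto
            then show ?thesis by (simp add: algebra_simps)
          qed (use supp'(1)[OF elim] in simp)
        qed
      qed
      finally show "(\<integral>x. ?f x * g x \<partial>M i) \<le> 0" by simp
    qed
    moreover have "D (lift i d' ?f) = l * D (lift i d' \<phi>) + w * D (lift i d' (tent p s)) + (- 1 / k) * D (lift i d' \<phi>')"
    proof -
      have "D (lift i d' ?f) = D (lift i d' (\<lambda>x. l * \<phi> x + w * tent p s x)) + D (lift i d' (\<lambda>x. (- 1 / k) * \<phi>' x))"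
        by (rule perturbs_lift_add[OF K]) (intro continuous_intros \<phi> tc \<phi>'c)+
      also have "D (lift i d' (\<lambda>x. l * \<phi> x + w * tent p s x)) = D (lift i d' (\<lambda>x. l * \<phi> x)) + D (lift i d' (\<lambda>x. w * tent p s x))"
        by (rule perturbs_lift_add[OF K]) (intro continuous_intros \<phi> tc)+
      finally show ?thesis
        by (simp only: perturbs_lift_cmult[OF K \<phi>] perturbs_lift_cmult[OF K tc] perturbs_lift_cmult[OF K \<phi>'c])
    qed
    moreover have "D (lift i d' \<phi>) = D (lift i d \<phi>)"
      by (rule perturbs_lift_indep[OF K i d'(1,2) \<phi> supp, symmetric])
    moreover have "D (lift i d' (tent p s)) = h p * Zp"
    proof -
      have "D (lift i d' (tent p s)) = D (lift i r (tent p s))"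
        by (rule perturbs_lift_indep[OF K i d'(1,3) tc ts, symmetric])
      also have "\<dots> = (\<integral>x. tent p s x * h x \<partial>M i)"
        by (rule near[OF tc tent_nonneg tent_outside[OF s(1)]])
      finally show ?thesis by (simp add: tent_h Zp_def)
    qed
    moreover have "D (lift i d' \<phi>') = k * (\<integral>x. \<phi> x * h (?c x) \<partial>M i)"
    proof -
      have "D (lift i d' \<phi>') = D (lift i r \<phi>')"
        by (rule perturbs_lift_indep[OF K i d'(1,3) \<phi>'c \<phi>'r, symmetric])
      also have "\<dots> = (\<integral>x. \<phi>' x * h x \<partial>M i)" by (rule near[OF \<phi>'c \<phi>'nn \<phi>'supp])
      finally show ?thesis by (simp add: hom[OF hm])
    qed
    moreover have "(\<integral>x. \<phi> x * h (?c x) \<partial>M i) = l * (\<integral>x. \<phi> x * h x \<partial>M i) + (1 - l) * h p * (\<integral>x. \<phi> x \<partial>M i)"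
    proof -
      have "bounded (h ` core i d)"
        using hc compact_core[OF d i] by (intro compact_imp_bounded compact_continuous_image) (auto intro: continuous_on_subset)
      then obtain b where "\<forall>x\<in>core i d. \<bar>h x\<bar> \<le> b" unfolding bounded_iff by auto
      then have "integrable (M i) (\<lambda>x. \<phi> x * h x)"
        by (intro integrable_core_product[OF i d \<phi> supp hm]) auto
      moreover have "\<phi> x * h (?c x) = l * (\<phi> x * h x) + (1 - l) * h p * \<phi> x" for x
      proof -
        have "(1 - l) *\<^sub>R p + l *\<^sub>R x = ?c x" by (simp add: algebra_simps)
        then have hx: "h (?c x) = (1 - l) * h p + l * h x" using haff[of l p x] by simp
        show ?thesis unfolding hx by (simp add: algebra_simps)
      qed
      ultimately show ?thesis using one by simp
    qed
    ultimately have "l * D (lift i d \<phi>) + w * (h p * Zp) - (l * (\<integral>x. \<phi> x * h x \<partial>M i) + (1 - l) * h p * (\<integral>x. \<phi> x \<partial>M i)) = 0"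
      using k by simp
    moreover have "w * (h p * Zp) = (1 - l) * h p * (\<integral>x. \<phi> x \<partial>M i)" using Zp by (simp add: w_def)
    ultimately have "l * D (lift i d \<phi>) = l * (\<integral>x. \<phi> x * h x \<partial>M i)" by simp
    then show ?thesis using l by simp
  qed
  \<comment> \<open>On the hyperplane the normal component of the gradient only contributes a constant.\<close>
  show ?thesis
  proof (rule that[of "a - (a \<bullet> u i) *\<^sub>R u i" "b + (a \<bullet> u i) * c i"])
    show "(a - (a \<bullet> u i) *\<^sub>R u i) \<bullet> u i = 0" by (simp add: inner_diff_left)
    fix d :: real and \<phi> :: "'a \<Rightarrow> real"
    assume d: "0 < d" and \<phi>: "continuous_on UNIV \<phi>" and nn: "\<And>x. 0 \<le> \<phi> x"
      and supp: "\<And>x. u i \<bullet> x = c i \<Longrightarrow> x \<notin> core i d \<Longrightarrow> \<phi> x = 0"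
    have [measurable]: "\<phi> \<in> borel_measurable borel" using \<phi> by (rule borel_measurable_continuous_onI)
    have "(\<integral>x. \<phi> x * h x \<partial>M i) = (\<integral>x. \<phi> x * ((a - (a \<bullet> u i) *\<^sub>R u i) \<bullet> x + (b + (a \<bullet> u i) * c i)) \<partial>M i)"
    proof (rule integral_cong_AE)
      show "AE x in M i. \<phi> x * h x = \<phi> x * ((a - (a \<bullet> u i) *\<^sub>R u i) \<bullet> x + (b + (a \<bullet> u i) * c i))"
        using on_hyperplane by eventually_elim (simp add: h inner_diff_left)
    qed measurable
    then show "D (lift i d \<phi>) = (\<integral>x. \<phi> x * ((a - (a \<bullet> u i) *\<^sub>R u i) \<bullet> x + (b + (a \<bullet> u i) * c i)) \<partial>M i)"
      using main[OF d \<phi> nn supp] by simp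
  qed
qed

end


section \<open>The derivative of a reversible perturbation\<close>

definition clamp01 :: "real \<Rightarrow> real" where
  "clamp01 s = max 0 (min 1 s)"

lemma clamp01_bounds: "0 \<le> clamp01 s" "clamp01 s \<le> 1" by (auto simp: clamp01_def)

context polytope_halfspaces
begin

lemma face_compact: "compact (face i)"
proof -
  have "face i = P \<inter> {x. u i \<bullet> x = c i}" by (auto simp: face_def)
  then show ?thesis using compact_P by (auto intro: compact_Int_closed closed_hyperplane)
qed

lemma face_measurable [measurable]: "face i \<in> sets borel"
  using face_compact by (rule borel_compact)

lemma set_integrable_face:
  fixes f :: "'a \<Rightarrow> real"
  assumes i: "i \<in> I" and f: "continuous_on UNIV f"
  shows "set_integrable (M i) (face i) f"
proof -
  interpret hyperplane_chart "u i" "c i" "M i" using i by (rule chart)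
  have [measurable]: "f \<in> borel_measurable borel" using f by (rule borel_measurable_continuous_onI)
  have "bounded (f ` face i)"
    using f face_compact by (intro compact_imp_bounded compact_continuous_image) (auto intro: continuous_on_subset)
  then obtain b where b: "\<forall>x\<in>face i. \<bar>f x\<bar> \<le> b" unfolding bounded_iff by auto
  show ?thesis
    unfolding set_integrable_def
  proof (rule integrable_bounded_support[where b = "\<bar>b\<bar>" and S = "face i"])
    show "\<bar>indicator (face i) x *\<^sub>R f x\<bar> \<le> \<bar>b\<bar>" for x
      using b by (cases "x \<in> face i") force+
    show "bounded (face i)" using face_compact by (rule compact_imp_bounded)
  qed auto
qed

text \<open>A cutoff equal to 1 deep inside the facet of \<open>i\<close> and to 0 on all other facets.\<close>

definition cutoff :: "nat \<Rightarrow> 'i \<Rightarrow> 'a \<Rightarrow> real" where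
  "cutoff k i x = (\<Prod>j\<in>I - {i}. clamp01 (real (Suc k) * (c j - u j \<bullet> x) - 1))"

lemma continuous_cutoff: "continuous_on S (cutoff k i)"
  unfolding cutoff_def clamp01_def by (intro continuous_intros)

lemma cutoff_bounds: "0 \<le> cutoff k i x" "cutoff k i x \<le> 1"
  unfolding cutoff_def using clamp01_bounds by (auto intro!: prod_nonneg prod_le_1)

lemma cutoff_zero:
  assumes "j \<in> I" "j \<noteq> i" "c j - 1 / real (Suc k) \<le> u j \<bullet> x"
  shows "cutoff k i x = 0"
proof -
  have "real (Suc k) * (c j - u j \<bullet> x) \<le> 1"
    using assms(3) by (simp add: field_simps)
  then have "clamp01 (real (Suc k) * (c j - u j \<bullet> x) - 1) = 0" by (simp add: clamp01_def)
  then show ?thesis unfolding cutoff_def using assms fin by (intro prod_zero) auto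
qed

lemma cutoff_off_core:
  assumes "u i \<bullet> x = c i" "x \<notin> core i (1 / real (Suc k))"
  shows "cutoff k i x = 0"
proof -
  obtain j where "j \<in> I - {i}" "c j - 1 / real (Suc k) < u j \<bullet> x"
    using assms by (auto simp: core_def not_le)
  then show ?thesis using cutoff_zero[of j i k x] by simp
qed

lemma cutoff_other_face:
  assumes "m \<in> I" "m \<noteq> i" "x \<in> face m"
  shows "cutoff k i x = 0"
  using assms by (intro cutoff_zero[of m]) (auto simp: mem_face)

lemma cutoff_tendsto:
  assumes "\<forall>j\<in>I - {i}. u j \<bullet> x < c j"
  shows "(\<lambda>k. cutoff k i x) \<longlonglongrightarrow> 1"
proof (rule tendsto_eventually)
  have "\<forall>\<^sub>F k in sequentially. \<forall>j\<in>I - {i}. 2 \<le> real (Suc k) * (c j - u j \<bullet> x)"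
  proof (intro eventually_ball_finite ballI)
    fix j assume "j \<in> I - {i}"
    then have pos: "0 < c j - u j \<bullet> x" using assms by simp
    obtain N where N: "2 / (c j - u j \<bullet> x) \<le> real N" using real_arch_simple by blast
    have "2 \<le> real (Suc k) * (c j - u j \<bullet> x)" if "N \<le> k" for k
    proof -
      have "2 \<le> real N * (c j - u j \<bullet> x)" using N pos by (simp add: pos_divide_le_eq)
      also have "\<dots> \<le> real (Suc k) * (c j - u j \<bullet> x)" using that pos by (intro mult_right_mono) auto
      finally show ?thesis .
    qed
    then show "\<forall>\<^sub>F k in sequentially. 2 \<le> real (Suc k) * (c j - u j \<bullet> x)"
      unfolding eventually_sequentially by blast
  qed (use fin in auto)
  then show "\<forall>\<^sub>F k in sequentially. cutoff k i x = 1"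
  proof eventually_elim
    case (elim k)
    have "clamp01 (real (Suc k) * (c j - u j \<bullet> x) - 1) = 1" if "j \<in> I - {i}" for j
    proof -
      have "1 \<le> real (Suc k) * (c j - u j \<bullet> x) - 1" using elim[rule_format, OF that] by linarith
      then show ?thesis by (simp add: clamp01_def)
    qed
    then show ?case unfolding cutoff_def by (intro prod.neutral) blast
  qed
qed

lemma AE_off_other_faces:
  assumes i: "i \<in> I"
  shows "AE x in M i. \<forall>j\<in>I - {i}. u j \<bullet> x \<noteq> c j"
proof (rule AE_finite_allI)
  interpret hyperplane_chart "u i" "c i" "M i" using i by (rule chart)
  fix j assume j: "j \<in> I - {i}"
  obtain p where "u i \<bullet> p = c i" "u j \<bullet> p < c j" using facet_point[OF i] j by blast
  then show "AE x in M i. u j \<bullet> x \<noteq> c j" by (intro AE_off_hyperplane[of p]) auto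
qed (use fin in auto)

text \<open>A boundary point whose foot lies in the core is either on the facet of \<open>i\<close> or so far below it
  that the lift has been cut off.\<close>

lemma lift_eq_on_boundary:
  assumes i: "i \<in> I" and d: "0 < d"
    and supp: "\<And>x. u i \<bullet> x = c i \<Longrightarrow> x \<notin> core i d \<Longrightarrow> \<phi> x = 0"
    and other: "\<And>m x. m \<in> I \<Longrightarrow> m \<noteq> i \<Longrightarrow> x \<in> face m \<Longrightarrow> \<phi> x = 0"
    and m: "m \<in> I" and x: "x \<in> face m"
  shows "lift i d \<phi> x = \<phi> x"
proof -
  interpret hyperplane_chart "u i" "c i" "M i" using i by (rule chart)
  define s where "s = u i \<bullet> x - c i"
  have s: "s \<le> 0" using x i by (auto simp: s_def mem_face)
  have lift: "lift i d \<phi> x = \<phi> (x - s *\<^sub>R u i) * cut d s" by (simp add: lift_def s_def)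
  show ?thesis
  proof (cases "s = 0")
    case True
    then show ?thesis using cut_simps(2)[OF d, of 0] d by (simp add: lift)
  next
    case False
    then have "m \<noteq> i" using x by (auto simp: s_def mem_face)
    then have "\<phi> x = 0" using other m x by blast
    moreover have "lift i d \<phi> x = 0"
    proof (cases "s \<le> - 2 * d / 3")
      case True
      then show ?thesis using cut_simps(1)[OF d] by (simp add: lift)
    next
      case s': False
      let ?q = "x - s *\<^sub>R u i"
      have "?q \<notin> core i d"
      proof
        assume q: "?q \<in> core i d"
        have "\<bar>u m \<bullet> u i\<bar> \<le> norm (u m) * norm (u i)" by (rule Cauchy_Schwarz_ineq2)
        then have "- (u m \<bullet> u i) \<le> 1" using i m by simp
        then have "(- s) * - (u m \<bullet> u i) \<le> (- s) * 1" using s by (intro mult_left_mono) auto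
        moreover have "u m \<bullet> x - s * (u m \<bullet> u i) \<le> c m - d"
          using q m \<open>m \<noteq> i\<close> by (auto simp: core_def inner_diff_right)
        moreover have "u m \<bullet> x = c m" using x by (simp add: mem_face)
        ultimately show False using s' d by linarith
      qed
      then have "\<phi> ?q = 0" by (intro supp) (simp_all add: s_def inner_diff_right)
      then show ?thesis by (simp add: lift)
    qed
    ultimately show ?thesis by simp
  qed
qed

text \<open>Cutoffs reduce the derivative to its values on functions supported deep inside the facets.
  The remainder is controlled by the surface integral of what is cut off.\<close>

lemma reversible_density:
  assumes K: "perturbs K D" and K': "perturbs K' D'"
    and opp: "\<And>f. continuous_on UNIV f \<Longrightarrow> D' f = - D f"
    and cong: "\<And>f g. continuous_on UNIV f \<Longrightarrow> continuous_on UNIV g \<Longrightarrow>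
       (\<And>i x. i \<in> I \<Longrightarrow> x \<in> face i \<Longrightarrow> f x = g x) \<Longrightarrow> D f = D g"
  obtains a b where "\<And>i. i \<in> I \<Longrightarrow> a i \<bullet> u i = 0"
    "\<And>f. continuous_on UNIV f \<Longrightarrow> D f = (\<Sum>i\<in>I. LINT x:face i|M i. f x * (a i \<bullet> x + b i))"
proof -
  define dens where "dens i a b \<longleftrightarrow> a \<bullet> u i = 0 \<and> (\<forall>d \<phi>. 0 < d \<longrightarrow> continuous_on UNIV \<phi> \<longrightarrow> (\<forall>x. 0 \<le> \<phi> x) \<longrightarrow>
       (\<forall>x. u i \<bullet> x = c i \<longrightarrow> x \<notin> core i d \<longrightarrow> \<phi> x = 0) \<longrightarrow>
       D (lift i d \<phi>) = (\<integral>x. \<phi> x * (a \<bullet> x + b) \<partial>M i))" for i a b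
  have "\<forall>i\<in>I. \<exists>ab. dens i (fst ab) (snd ab)"
  proof
    fix i assume i: "i \<in> I"
    obtain a b where "a \<bullet> u i = 0"
      "\<And>d \<phi>. 0 < d \<Longrightarrow> continuous_on UNIV \<phi> \<Longrightarrow> (\<And>x. 0 \<le> \<phi> x) \<Longrightarrow>
       (\<And>x. u i \<bullet> x = c i \<Longrightarrow> x \<notin> core i d \<Longrightarrow> \<phi> x = 0) \<Longrightarrow>
       D (lift i d \<phi>) = (\<integral>x. \<phi> x * (a \<bullet> x + b) \<partial>M i)"
      by (rule reversible_affine_density[OF K K' opp i]) blast+
    then have "dens i a b" unfolding dens_def by blast
    then show "\<exists>ab. dens i (fst ab) (snd ab)" by (intro exI[of _ "(a, b)"]) simp
  qed
  from bchoice[OF this] obtain ab where ab: "\<forall>i\<in>I. dens i (fst (ab i)) (snd (ab i))" by (rule exE)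
  define a b where "a i = fst (ab i)" and "b i = snd (ab i)" for i
  define h where "h i x = a i \<bullet> x + b i" for i x
  have perp: "a i \<bullet> u i = 0" if "i \<in> I" for i using ab that by (auto simp: dens_def a_def)
  have dens: "D (lift i d \<phi>) = (\<integral>x. \<phi> x * h i x \<partial>M i)"
    if "i \<in> I" "0 < d" "continuous_on UNIV \<phi>" "\<And>x. 0 \<le> \<phi> x"
      "\<And>x. u i \<bullet> x = c i \<Longrightarrow> x \<notin> core i d \<Longrightarrow> \<phi> x = 0" for i d \<phi>
    using ab[rule_format, OF that(1)] that(2-) unfolding dens_def h_def a_def b_def by blast
  have hc: "continuous_on UNIV (h i)" for i unfolding h_def by (intro continuous_intros)
  obtain C1 where C1: "0 \<le> C1" "\<And>f. continuous_on UNIV f \<Longrightarrow> (\<And>x. 0 \<le> f x) \<Longrightarrow>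
      D f \<le> C1 * (\<Sum>i\<in>I. LINT x:face i|M i. f x)" by (rule perturbs_le_surface[OF K]) blast
  obtain C2 where C2: "0 \<le> C2" "\<And>f. continuous_on UNIV f \<Longrightarrow> (\<And>x. 0 \<le> f x) \<Longrightarrow>
      D' f \<le> C2 * (\<Sum>i\<in>I. LINT x:face i|M i. f x)" by (rule perturbs_le_surface[OF K']) blast
  have nonneg: "D f = (\<Sum>i\<in>I. LINT x:face i|M i. f x * h i x)"
    if f: "continuous_on UNIV f" and f0: "\<And>x. 0 \<le> f x" for f
  proof -
    have [measurable]: "f \<in> borel_measurable borel" "h i \<in> borel_measurable borel" "cutoff k i \<in> borel_measurable borel" for i k
      using f hc continuous_cutoff by (auto intro: borel_measurable_continuous_onI)
    define \<phi> where "\<phi> k i x = f x * cutoff k i x" for k i x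
    define g where "g k x = f x * max 0 (1 - (\<Sum>i\<in>I. cutoff k i x))" for k x
    have \<phi>c: "continuous_on UNIV (\<phi> k i)" for k i
      unfolding \<phi>_def by (intro continuous_on_mult f continuous_cutoff)
    have gc: "continuous_on UNIV (g k)" for k
      unfolding g_def by (intro continuous_intros f continuous_cutoff)
    have g0: "0 \<le> g k x" for k x unfolding g_def using f0 by simp
    have on_face: "(\<Sum>i\<in>I. cutoff k i x) = cutoff k m x" if "m \<in> I" "x \<in> face m" for k m x
    proof -
      have "(\<Sum>i\<in>I. cutoff k i x) = (\<Sum>i\<in>I. if i = m then cutoff k m x else 0)"
        using cutoff_other_face[OF that(1) _ that(2)] by (intro sum.cong) auto
      then show ?thesis using fin that by simp
    qed
    have g_face: "g k x = f x * (1 - cutoff k m x)" if "m \<in> I" "x \<in> face m" for k m x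
      unfolding g_def on_face[OF that] using cutoff_bounds(2)[of k m x] by simp
    have sc: "continuous_on UNIV (\<lambda>x. \<Sum>i\<in>J. \<phi> k i x)" for J k by (intro continuous_on_sum \<phi>c)
    have Dsum: "D (\<lambda>x. \<Sum>i\<in>J. \<phi> k i x) = (\<Sum>i\<in>J. D (\<phi> k i))" if "finite J" for k J
      using that
    proof (induction J rule: finite_induct)
      case empty
      show ?case using perturbs_linear(2)[OF K continuous_on_const[of _ 0] continuous_on_const[of _ 0], of 0] by simp
    next
      case (insert j J)
      then show ?case
        using perturbs_linear(1)[OF K \<phi>c[of k j] sc[of k J]] by simp
    qed
    have split: "D f = (\<Sum>i\<in>I. \<integral>x. \<phi> k i x * h i x \<partial>M i) + D (g k)" for k
    proof -
      have "D f = D (\<lambda>x. (\<Sum>i\<in>I. \<phi> k i x) + g k x)"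
      proof (rule cong[OF f])
        show "continuous_on UNIV (\<lambda>x. (\<Sum>i\<in>I. \<phi> k i x) + g k x)"
          by (intro continuous_on_add continuous_on_sum \<phi>c gc)
        show "f x = (\<Sum>i\<in>I. \<phi> k i x) + g k x" if "m \<in> I" "x \<in> face m" for m x
          unfolding \<phi>_def g_face[OF that] by (simp add: sum_distrib_left[symmetric] on_face[OF that] algebra_simps)
      qed
      also have "\<dots> = (\<Sum>i\<in>I. D (\<phi> k i)) + D (g k)"
        using perturbs_linear(1)[OF K sc[of k I] gc[of k]] Dsum[OF fin] by simp
      also have "(\<Sum>i\<in>I. D (\<phi> k i)) = (\<Sum>i\<in>I. \<integral>x. \<phi> k i x * h i x \<partial>M i)"
      proof (rule sum.cong)
        fix i assume i: "i \<in> I"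
        let ?d = "1 / real (Suc k)"
        have supp: "\<phi> k i x = 0" if "u i \<bullet> x = c i" "x \<notin> core i ?d" for x
          using cutoff_off_core[OF that] by (simp add: \<phi>_def)
        have "D (\<phi> k i) = D (lift i ?d (\<phi> k i))"
        proof (rule cong[OF \<phi>c continuous_lift[OF \<phi>c]])
          fix m x assume m: "m \<in> I" "x \<in> face m"
          show "\<phi> k i x = lift i ?d (\<phi> k i) x"
            by (rule lift_eq_on_boundary[OF i _ supp _ m, symmetric])
              (auto simp: \<phi>_def cutoff_other_face)
        qed
        also have "\<dots> = (\<integral>x. \<phi> k i x * h i x \<partial>M i)"
          by (rule dens[OF i _ \<phi>c _ supp]) (auto simp: \<phi>_def f0 cutoff_bounds)
        finally show "D (\<phi> k i) = (\<integral>x. \<phi> k i x * h i x \<partial>M i)" .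
      qed simp
      finally show ?thesis .
    qed
    have l1: "(\<lambda>k. \<integral>x. \<phi> k i x * h i x \<partial>M i) \<longlonglongrightarrow> (LINT x:face i|M i. f x * h i x)" if i: "i \<in> I" for i
      unfolding set_lebesgue_integral_def
    proof (rule integral_dominated_convergence)
      interpret hyperplane_chart "u i" "c i" "M i" using i by (rule chart)
      show "integrable (M i) (\<lambda>x. \<bar>indicator (face i) x *\<^sub>R (f x * h i x)\<bar>)"
        using set_integrable_face[OF i continuous_on_mult[OF f hc]] unfolding set_integrable_def
        by (rule Bochner_Integration.integrable_abs)
      have inface: "x \<in> face i" if "u i \<bullet> x = c i" "cutoff k i x \<noteq> 0" for x k
        using cutoff_off_core[OF that(1), of k] that(2) core_subset_face[of "1 / real (Suc k)" i] i by auto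
      show "AE x in M i. norm (\<phi> k i x * h i x) \<le> \<bar>indicator (face i) x *\<^sub>R (f x * h i x)\<bar>" for k
        using on_hyperplane
      proof eventually_elim
        case (elim x)
        show ?case
        proof (cases "cutoff k i x = 0")
          case False
          then have "x \<in> face i" using inface elim by blast
          moreover have "\<bar>f x * h i x\<bar> * cutoff k i x \<le> \<bar>f x * h i x\<bar> * 1"
            using cutoff_bounds by (intro mult_left_mono) auto
          ultimately show ?thesis using cutoff_bounds(1)[of k i x] by (simp add: \<phi>_def abs_mult ac_simps)
        qed (simp add: \<phi>_def)
      qed
      show "AE x in M i. (\<lambda>k. \<phi> k i x * h i x) \<longlonglongrightarrow> indicator (face i) x *\<^sub>R (f x * h i x)"
        using on_hyperplane AE_off_other_faces[OF i]
      proof eventually_elim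
        case (elim x)
        show ?case
        proof (cases "x \<in> face i")
          case True
          have "u j \<bullet> x < c j" if "j \<in> I - {i}" for j
          proof -
            have "u j \<bullet> x \<le> c j" using True that by (auto simp: mem_face)
            moreover have "u j \<bullet> x \<noteq> c j" using elim(2) that by blast
            ultimately show ?thesis by simp
          qed
          then have "(\<lambda>k. f x * cutoff k i x * h i x) \<longlonglongrightarrow> f x * 1 * h i x"
            by (intro tendsto_intros cutoff_tendsto) blast
          then show ?thesis using True by (simp add: \<phi>_def)
        next
          case False
          then have "cutoff k i x = 0" for k using inface[OF elim(1)] by blast
          then show ?thesis using False by (simp add: \<phi>_def)
        qed
      qed
      show "(\<lambda>x. \<phi> k i x * h i x) \<in> borel_measurable (M i)" for k unfolding \<phi>_def by measurable
      show "(\<lambda>x. indicator (face i) x *\<^sub>R (f x * h i x)) \<in> borel_measurable (M i)" by measurable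
    qed
    have l2: "(\<lambda>k. LINT x:face i|M i. g k x) \<longlonglongrightarrow> 0" if i: "i \<in> I" for i
    proof -
      interpret hyperplane_chart "u i" "c i" "M i" using i by (rule chart)
      have [measurable]: "g k \<in> borel_measurable borel" for k using gc by (rule borel_measurable_continuous_onI)
      have "(\<lambda>k. LINT x:face i|M i. g k x) \<longlonglongrightarrow> (\<integral>x. 0 \<partial>M i)"
        unfolding set_lebesgue_integral_def
      proof (rule integral_dominated_convergence)
        show "integrable (M i) (\<lambda>x. indicator (face i) x *\<^sub>R f x)"
          using set_integrable_face[OF i f] by (simp add: set_integrable_def)
        show "AE x in M i. norm (indicator (face i) x *\<^sub>R g k x) \<le> indicator (face i) x *\<^sub>R f x" for k
        proof (rule AE_I2)
          fix x
          show "norm (indicator (face i) x *\<^sub>R g k x) \<le> indicator (face i) x *\<^sub>R f x"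
          proof (cases "x \<in> face i")
            case True
            have "f x * (1 - cutoff k i x) \<le> f x * 1" using f0 cutoff_bounds by (intro mult_left_mono) auto
            then show ?thesis using True g0[of k x] by (simp add: g_face[OF i True])
          qed simp
        qed
        show "AE x in M i. (\<lambda>k. indicator (face i) x *\<^sub>R g k x) \<longlonglongrightarrow> 0"
          using AE_off_other_faces[OF i]
        proof eventually_elim
          case (elim x)
          show ?case
          proof (cases "x \<in> face i")
            case True
            have "u j \<bullet> x < c j" if "j \<in> I - {i}" for j
            proof -
              have "u j \<bullet> x \<le> c j" using True that by (auto simp: mem_face)
              moreover have "u j \<bullet> x \<noteq> c j" using elim that by blast
              ultimately show ?thesis by simp
            qed
            then have "(\<lambda>k. f x * (1 - cutoff k i x)) \<longlonglongrightarrow> f x * (1 - 1)"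
              by (intro tendsto_intros cutoff_tendsto) blast
            then show ?thesis using True by (simp add: g_face[OF i True])
          qed simp
        qed
      qed auto
      then show ?thesis by simp
    qed
    have l3: "(\<lambda>k. D (g k)) \<longlonglongrightarrow> 0"
    proof (rule tendsto_sandwich)
      show "\<forall>\<^sub>F k in sequentially. - (C2 * (\<Sum>i\<in>I. LINT x:face i|M i. g k x)) \<le> D (g k)"
        using C2(2)[OF gc g0] opp[OF gc] by (intro always_eventually allI) (simp add: minus_le_iff)
      show "\<forall>\<^sub>F k in sequentially. D (g k) \<le> C1 * (\<Sum>i\<in>I. LINT x:face i|M i. g k x)"
        using C1(2)[OF gc g0] by (intro always_eventually allI)
      have "(\<lambda>k. - (C2 * (\<Sum>i\<in>I. LINT x:face i|M i. g k x))) \<longlonglongrightarrow> - (C2 * (\<Sum>i\<in>I. 0))"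
        by (intro tendsto_intros l2)
      then show "(\<lambda>k. - (C2 * (\<Sum>i\<in>I. LINT x:face i|M i. g k x))) \<longlonglongrightarrow> 0" by simp
      have "(\<lambda>k. C1 * (\<Sum>i\<in>I. LINT x:face i|M i. g k x)) \<longlonglongrightarrow> C1 * (\<Sum>i\<in>I. 0)"
        by (intro tendsto_intros l2)
      then show "(\<lambda>k. C1 * (\<Sum>i\<in>I. LINT x:face i|M i. g k x)) \<longlonglongrightarrow> 0" by simp
    qed
    have "(\<lambda>k. (\<Sum>i\<in>I. \<integral>x. \<phi> k i x * h i x \<partial>M i) + D (g k)) \<longlonglongrightarrow> (\<Sum>i\<in>I. LINT x:face i|M i. f x * h i x) + 0"
      by (intro tendsto_intros l1 l3)
    then show ?thesis unfolding split[symmetric] by (simp add: LIMSEQ_const_iff)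
  qed
  show ?thesis
  proof (rule that[OF perp])
    fix f :: "'a \<Rightarrow> real" assume f: "continuous_on UNIV f"
    let ?p = "\<lambda>x. max 0 (f x)" and ?m = "\<lambda>x. max 0 (- f x)"
    have c: "continuous_on UNIV ?p" "continuous_on UNIV ?m" by (intro continuous_intros f)+
    have f_eq: "f = (\<lambda>x. ?p x + (- 1) * ?m x)" by (auto simp: max_def)
    have "D f = D ?p + D (\<lambda>x. (- 1) * ?m x)"
      by (subst f_eq) (rule perturbs_linear(1)[OF K c(1) continuous_on_mult_left[OF c(2)]])
    also have "\<dots> = D ?p - D ?m" using perturbs_linear(2)[OF K c(2) c(2), of "- 1"] by simp
    also have "\<dots> = (\<Sum>i\<in>I. LINT x:face i|M i. ?p x * h i x) - (\<Sum>i\<in>I. LINT x:face i|M i. ?m x * h i x)"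
      by (simp only: nonneg[OF c(1)] nonneg[OF c(2)] max.cobounded1)
    also have "\<dots> = (\<Sum>i\<in>I. LINT x:face i|M i. f x * h i x)"
      unfolding sum_subtractf[symmetric]
    proof (rule sum.cong)
      fix i assume i: "i \<in> I"
      have "(LINT x:face i|M i. ?p x * h i x) - (LINT x:face i|M i. ?m x * h i x)
          = (LINT x:face i|M i. ?p x * h i x - ?m x * h i x)"
        by (rule set_integral_diff(2)[symmetric]) (intro set_integrable_face[OF i] continuous_on_mult c hc)+
      also have "(\<lambda>x. ?p x * h i x - ?m x * h i x) = (\<lambda>x. f x * h i x)"
        by (auto simp: max_def)
      finally show "(LINT x:face i|M i. ?p x * h i x) - (LINT x:face i|M i. ?m x * h i x) = (LINT x:face i|M i. f x * h i x)" .
    qed simp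
    finally show "D f = (\<Sum>i\<in>I. LINT x:face i|M i. f x * (a i \<bullet> x + b i))" by (simp add: h_def)
  qed
qed

end


section \<open>Measures with affine density on a facet\<close>

lemma sums_set_integral:
  fixes f :: "'a \<Rightarrow> real"
  assumes f: "integrable M f" and A: "range A \<subseteq> sets M" "disjoint_family A"
  shows "(\<lambda>i. LINT x:A i|M. f x) sums (LINT x:(\<Union>i. A i)|M. f x)"
proof -
  have Am: "A i \<in> sets M" for i using A by auto
  have si: "set_integrable M B f" if "B \<in> sets M" for B
    using that f unfolding set_integrable_def by (rule integrable_mult_indicator)
  have fin: "(\<Sum>i<n. LINT x:A i|M. f x) = (LINT x:(\<Union>i<n. A i)|M. f x)" for n
  proof (induction n)
    case (Suc n)
    have "A i \<inter> A n = {}" if "i < n" for i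
      using disjoint_family_onD[OF A(2), of i n] that by simp
    then have d: "(\<Union>i<n. A i) \<inter> A n = {}" by blast
    have U: "(\<Union>i<Suc n. A i) = (\<Union>i<n. A i) \<union> A n" by (simp add: lessThan_Suc Un_commute)
    have m: "(\<Union>i<n. A i) \<in> sets M" using Am by (intro sets.finite_UN) auto
    show ?case unfolding U set_integral_Un[OF d si[OF m] si[OF Am]] using Suc by simp
  qed (simp add: set_lebesgue_integral_def)
  have "(\<lambda>n. LINT x:(\<Union>i<n. A i)|M. f x) \<longlonglongrightarrow> (LINT x:(\<Union>n. \<Union>i<n. A i)|M. f x)"
    using Am by (intro set_integral_cont_up si incseq_SucI) (auto simp: lessThan_Suc)
  moreover have "(\<Union>n. \<Union>i<n. A i) = (\<Union>i. A i)" by auto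
  ultimately show ?thesis by (simp add: sums_def fin)
qed

text \<open>The default value 0 off the Borel sets is the one required of a signed measure.\<close>

definition sm_density :: "'a::topological_space measure \<Rightarrow> ('a \<Rightarrow> real) \<Rightarrow> 'a signed_measure" where
  "sm_density M h = Abs_signed_measure (\<lambda>B. if B \<in> sets borel then LINT x:B|M. h x else 0)"

lemma sm_apply_density:
  assumes s: "sets M = sets borel" and h: "integrable M h" and B: "B \<in> sets borel"
  shows "sm_apply (sm_density M h) B = (LINT x:B|M. h x)"
proof -
  let ?m = "\<lambda>B. if B \<in> sets borel then LINT x:B|M. h x else 0"
  have "(\<lambda>i. ?m (A i)) sums ?m (\<Union>i. A i)"
    if A: "range A \<subseteq> sets borel" "disjoint_family A" for A :: "nat \<Rightarrow> 'a set"
  proof -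
    have "A i \<in> sets borel" for i using A by auto
    moreover have "(\<Union>i. A i) \<in> sets borel" using A by auto
    ultimately show ?thesis using sums_set_integral[OF h, of A] A s by simp
  qed
  then have "sm_apply (Abs_signed_measure ?m) = ?m"
    by (intro Abs_signed_measure_inverse) (auto simp: set_lebesgue_integral_def)
  then show ?thesis using B by (simp add: sm_density_def)
qed

context hyperplane_chart
begin

lemma emeasure_relopen_pos:
  assumes "AE x in M. x \<notin> U" "x \<in> U" "u \<bullet> x = c" "0 < r"
    "\<And>y. u \<bullet> y = c \<Longrightarrow> y \<in> cball x r \<Longrightarrow> y \<in> U"
  shows False
proof -
  have b: "ball x r \<in> sets borel" using open_ball borel_open by blast
  have "AE y in M. y \<notin> ball x r"
    using assms(1) on_hyperplane by eventually_elim (use assms(5) in fastforce)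
  then have "emeasure M (ball x r) = 0"
    using b by (intro AE_iff_measurable[THEN iffD1, of _ _ "\<lambda>y. y \<notin> ball x r"]) auto
  then show False using emeasure_ball_pos[OF assms(3,4)] by simp
qed

text \<open>The zeros of \<open>k\<close> are dense in \<open>U\<close>, so that their convex hull contains the
  relatively open set \<open>U\<close>; hence \<open>k \<le> 0\<close>. Convexity about a zero next to a given point gives the
  reverse inequality.\<close>

lemma convex_AE_zero_imp_zero:
  fixes k :: "'a \<Rightarrow> real"
  assumes U: "convex U" "\<And>x. x \<in> U \<Longrightarrow> u \<bullet> x = c"
    and relopen: "\<And>x. x \<in> U \<Longrightarrow> \<exists>r>0. \<forall>y. u \<bullet> y = c \<longrightarrow> y \<in> cball x r \<longrightarrow> y \<in> U"
    and ri: "rel_interior U = U"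
    and k: "convex_on U k" and ae: "AE x in M. x \<in> U \<longrightarrow> k x = 0" and x: "x \<in> U"
  shows "k x = 0"
proof -
  define Z where "Z = {x \<in> U. k x = 0}"
  have dense: "\<exists>y\<in>Z. dist x y \<le> e" if x: "x \<in> U" and e: "0 < e" for x e
  proof (rule ccontr)
    assume no: "\<not> (\<exists>y\<in>Z. dist x y \<le> e)"
    obtain r where r: "0 < r" "\<forall>y. u \<bullet> y = c \<longrightarrow> y \<in> cball x r \<longrightarrow> y \<in> U" using relopen[OF x] by blast
    have "AE y in M. y \<notin> U \<inter> cball x e"
      using ae by eventually_elim (use no in \<open>auto simp: Z_def\<close>)
    then show False
      by (rule emeasure_relopen_pos[of _ x "min r e"]) (use x e r U in auto)
  qed
  have cvx: "convex {x \<in> U. k x \<le> 0}"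
  proof (rule convexI)
    fix x y v w :: real and a b assume a: "a \<in> {x \<in> U. k x \<le> 0}" and b: "b \<in> {x \<in> U. k x \<le> 0}"
      and vw: "0 \<le> v" "0 \<le> w" "v + w = 1"
    have "k (v *\<^sub>R a + w *\<^sub>R b) \<le> v * k a + w * k b"
      using k a b vw by (auto simp: convex_on_def)
    also have "\<dots> \<le> 0" using a b vw by (auto intro!: add_nonpos_nonpos mult_nonneg_nonpos)
    finally show "v *\<^sub>R a + w *\<^sub>R b \<in> {x \<in> U. k x \<le> 0}"
      using convexD[OF U(1)] a b vw by simp
  qed
  have hull: "convex hull Z \<subseteq> {x \<in> U. k x \<le> 0}" by (rule hull_minimal) (use cvx in \<open>auto simp: Z_def\<close>)
  have "U \<subseteq> closure (convex hull Z)"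
  proof
    fix x assume "x \<in> U"
    then have "x \<in> closure Z"
      unfolding closure_approachable_le using dense by (metis dist_commute)
    then show "x \<in> closure (convex hull Z)" using closure_mono[OF hull_subset[of Z convex]] by blast
  qed
  then have "closure U \<subseteq> closure (convex hull Z)" by (simp add: closure_minimal)
  moreover have "closure (convex hull Z) \<subseteq> closure U" using hull by (intro closure_mono) auto
  ultimately have eq: "closure (convex hull Z) = closure U" by simp
  have "rel_interior (convex hull Z) = rel_interior (closure (convex hull Z))"
    by (rule convex_rel_interior_closure[symmetric]) simp
  also have "\<dots> = U" unfolding eq using convex_rel_interior_closure[OF U(1)] ri by simp
  finally have "U \<subseteq> convex hull Z" using rel_interior_subset by blast
  then have le: "k y \<le> 0" if "y \<in> U" for y using hull that by blast
  obtain r where r: "0 < r" "\<forall>y. u \<bullet> y = c \<longrightarrow> y \<in> cball x r \<longrightarrow> y \<in> U" using relopen[OF x] by blast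
  obtain y where y: "y \<in> Z" "dist x y \<le> r / 2" using dense[OF x, of "r / 2"] r by auto
  let ?z = "2 *\<^sub>R y - x"
  have "x - ?z = 2 *\<^sub>R (x - y)" by (simp add: algebra_simps scaleR_2)
  then have "dist x ?z = 2 * dist x y" by (simp add: dist_norm)
  then have z: "?z \<in> U" using r y U(2) x by (auto simp: Z_def inner_diff_right)
  have "k ((1 - 1/2) *\<^sub>R x + (1/2) *\<^sub>R ?z) \<le> (1 - 1/2) * k x + (1/2) * k ?z"
    by (rule convex_onD[OF k _ _ x z]) auto
  moreover have "(1 - 1/2) *\<^sub>R x + (1/2) *\<^sub>R ?z = y" by (simp add: algebra_simps)
  ultimately have "0 \<le> k x" using y le[OF z] by (simp add: Z_def)
  then show ?thesis using le[OF x] by simp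
qed

text \<open>Near \<open>p\<close> the function is the interpolation of its values at surrounding points. On a segment
  from \<open>p\<close> it is affine, so that its values near \<open>p\<close> determine the others.\<close>

lemma affine_of_convex_concave:
  fixes f :: "'a \<Rightarrow> real"
  assumes U: "convex U" "\<And>x. x \<in> U \<Longrightarrow> u \<bullet> x = c" and p: "p \<in> U" and r: "0 < r"
    and near: "\<And>y. u \<bullet> y = c \<Longrightarrow> y \<in> cball p r \<Longrightarrow> y \<in> U"
    and f: "convex_on U f" "concave_on U f"
  obtains a b where "\<And>x. x \<in> U \<Longrightarrow> f x = a \<bullet> x + b"
proof -
  have up: "u \<bullet> p = c" using U(2)[OF p] .
  define e where "e j = f (vert u p r j)" for j
  obtain a b where h: "\<And>x. (\<Sum>j\<in>dirs. e j * wt p r j x) = a \<bullet> x + b"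
    by (rule affine_sum_wt[of e p r]) blast
  have loc: "f x = a \<bullet> x + b" if x: "u \<bullet> x = c" "norm (x - p) \<le> r / DIM('a)" for x
  proof -
    have "(\<Sum>j\<in>dirs. wt p r j x * f (vert u p r j)) \<le> f x"
      by (rule concave_ge_weighted_vertices[OF f(2) up x(1) r x(2) near])
    moreover have "(\<Sum>j\<in>dirs. wt p r j x * - f (vert u p r j)) \<le> - f x"
      by (rule concave_ge_weighted_vertices[of U "\<lambda>x. - f x", OF _ up x(1) r x(2) near])
        (use f(1) in \<open>simp_all add: concave_on_def\<close>)
    then have "f x \<le> (\<Sum>j\<in>dirs. wt p r j x * f (vert u p r j))" by (simp add: sum_negf)
    ultimately show ?thesis using h[of x] by (simp add: e_def mult.commute)
  qed
  have "f x = a \<bullet> x + b" if x: "x \<in> U" for x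
  proof -
    define s where "s = r / DIM('a)"
    have s: "0 < s" using r by (simp add: s_def)
    define t where "t = min 1 (s / (norm (x - p) + 1))"
    have n1: "0 < norm (x - p) + 1" by (simp add: add_nonneg_pos)
    have t: "0 < t" "t \<le> 1" using s n1 by (auto simp: t_def)
    let ?y = "(1 - t) *\<^sub>R p + t *\<^sub>R x"
    have uy: "u \<bullet> ?y = c" using up U(2)[OF x] by (simp add: inner_add_right algebra_simps)
    have "?y - p = t *\<^sub>R (x - p)" by (simp add: algebra_simps)
    then have "norm (?y - p) = t * norm (x - p)" using t by simp
    also have "\<dots> \<le> s / (norm (x - p) + 1) * (norm (x - p) + 1)"
      using t s by (intro mult_mono) (auto simp: t_def)
    also have "\<dots> = s" using n1 by simp
    finally have "f ?y = a \<bullet> ?y + b" by (intro loc uy) (simp add: s_def)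
    moreover have "f p = a \<bullet> p + b" using r by (intro loc up) simp
    moreover have "f ?y = (1 - t) * f p + t * f x"
    proof (rule antisym)
      show "f ?y \<le> (1 - t) * f p + t * f x" using f(1) p x t by (auto simp: convex_on_def)
      show "(1 - t) * f p + t * f x \<le> f ?y" using f(2) p x t by (auto simp: concave_on_iff)
    qed
    ultimately have "t * f x = t * (a \<bullet> x + b)" by (simp add: inner_add_right algebra_simps)
    then show ?thesis using t by simp
  qed
  then show ?thesis by (rule that)
qed

end

lemma full_dimensional_if_interior: "interior S \<noteq> {} \<Longrightarrow> full_dimensional S"
  unfolding full_dimensional_def aff_dim_eq_full by (rule affine_hull_nonempty_interior)

text \<open>The facets are their own indices.\<close>

locale polytope_facets = polytope_halfspaces "{F. F facet_of P}" u c affine_volume P x0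
  for u :: "'a::euclidean_space set \<Rightarrow> 'a" and c P x0 +
  assumes face_eq: "F facet_of P \<Longrightarrow> face F = F"
    and rel_interior_eq: "F facet_of P \<Longrightarrow>
        rel_interior F = {x. u F \<bullet> x = c F \<and> (\<forall>G. G facet_of P \<and> G \<noteq> F \<longrightarrow> u G \<bullet> x < c G)}"
    and frontier_eq: "frontier P = \<Union>{F. F facet_of P}"
    and convex_facet: "F facet_of P \<Longrightarrow> convex F"

text \<open>A point violating no facet inequality belongs to \<open>P\<close>: otherwise the segment to it from an interior
  point leaves \<open>P\<close> through a facet, whose inequality is violated behind it. The other facets do not meet
  the relative interior of a facet, since a face meeting it contains the whole facet.\<close>

lemma polytope_facets_exists:
  fixes P :: "'a::euclidean_space set"
  assumes P: "polytope P" and full: "full_dimensional P"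
  obtains u c x0 where "polytope_facets u c P x0"
proof -
  have poly: "polyhedron P" using P by (rule polytope_imp_polyhedron)
  have cvx: "convex P" using P by (rule polytope_imp_convex)
  have cmp: "compact P" using P by (rule polytope_imp_compact)
  have aff: "affine hull P = UNIV" using full aff_dim_eq_full by (auto simp: full_dimensional_def)
  then have ri: "rel_interior P = interior P" by (rule rel_interior_interior)
  have "P \<noteq> {}" using aff by auto
  then obtain x0 where x0: "x0 \<in> interior P" using rel_interior_eq_empty[OF cvx] ri by auto
  have fr: "frontier P = \<Union>{F. F facet_of P}"
    using rel_frontier_of_polyhedron[OF poly] ri by (simp add: rel_frontier_def frontier_def)
  have nrm: "\<exists>uc. norm (fst uc) = 1 \<and> P \<subseteq> {x. fst uc \<bullet> x \<le> snd uc} \<and> F = P \<inter> {x. fst uc \<bullet> x = snd uc}"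
    if F: "F facet_of P" for F
  proof -
    obtain a b where ab: "a \<noteq> 0" "P \<subseteq> {x. a \<bullet> x \<le> b}" "F = P \<inter> {x. a \<bullet> x = b}"
      by (rule facet_of_polyhedron[OF poly F])
    have n: "0 < norm a" using ab(1) by simp
    have "(a /\<^sub>R norm a) \<bullet> x \<le> b / norm a \<longleftrightarrow> a \<bullet> x \<le> b" "(a /\<^sub>R norm a) \<bullet> x = b / norm a \<longleftrightarrow> a \<bullet> x = b" for x
      using n by (auto simp: field_simps)
    then show ?thesis using ab n by (intro exI[of _ "(a /\<^sub>R norm a, b / norm a)"]) auto
  qed
  then have "\<forall>F\<in>{F. F facet_of P}. \<exists>uc. norm (fst uc) = 1 \<and> P \<subseteq> {x. fst uc \<bullet> x \<le> snd uc} \<and> F = P \<inter> {x. fst uc \<bullet> x = snd uc}"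
    by blast
  from bchoice[OF this] obtain uc where uc: "\<forall>F\<in>{F. F facet_of P}. norm (fst (uc F)) = 1 \<and>
      P \<subseteq> {x. fst (uc F) \<bullet> x \<le> snd (uc F)} \<and> F = P \<inter> {x. fst (uc F) \<bullet> x = snd (uc F)}" by (rule exE)
  define u c where "u F = fst (uc F)" and "c F = snd (uc F)" for F
  have u1: "norm (u F) = 1" and Ple: "x \<in> P \<Longrightarrow> u F \<bullet> x \<le> c F" and Feq: "F = P \<inter> {x. u F \<bullet> x = c F}"
    if "F facet_of P" for F x
    using uc that unfolding u_def c_def by blast+
  have F0: "F \<noteq> {}" and Faff: "aff_dim F = int DIM('a) - 1" and Fface: "F face_of P" if "F facet_of P" for F
    using that full by (auto simp: facet_of_def full_dimensional_def)
  have Fcvx: "convex F" if "F facet_of P" for F using face_of_imp_convex[OF Fface[OF that]] .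
  have x0lt: "u F \<bullet> x0 < c F" if F: "F facet_of P" for F
  proof -
    have "x0 \<in> P" using x0 interior_subset by blast
    moreover have "x0 \<notin> F" using x0 fr F by (auto simp: frontier_def)
    ultimately have "u F \<bullet> x0 \<noteq> c F" using Feq[OF F] by blast
    then show ?thesis using Ple[OF F \<open>x0 \<in> P\<close>] by simp
  qed
  have Peq: "P = {x. \<forall>F\<in>{F. F facet_of P}. u F \<bullet> x \<le> c F}"
  proof (intro subset_antisym subsetI)
    fix x assume x: "x \<in> {x. \<forall>F\<in>{F. F facet_of P}. u F \<bullet> x \<le> c F}"
    show "x \<in> P"
    proof (rule ccontr)
      assume nx: "x \<notin> P"
      have "closed_segment x0 x \<inter> frontier P \<noteq> {}"
        using x0 interior_subset nx by (intro connected_Int_frontier) auto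
      then obtain y F where y: "y \<in> closed_segment x0 x" and F: "F facet_of P" "y \<in> F" using fr by auto
      obtain s where s: "0 \<le> s" "s \<le> 1" "y = (1 - s) *\<^sub>R x0 + s *\<^sub>R x" using y by (auto simp: closed_segment_def)
      have "s \<noteq> 1"
      proof
        assume "s = 1"
        then have "x \<in> F" using s F by simp
        then show False using nx Feq[OF F(1)] by blast
      qed
      then have "(1 - s) * (u F \<bullet> x0) < (1 - s) * c F" using s x0lt[OF F(1)] by simp
      moreover have "s * (u F \<bullet> x) \<le> s * c F" using s x F(1) by (intro mult_left_mono) auto
      moreover have "u F \<bullet> y = c F" using Feq[OF F(1)] F(2) by blast
      then have "(1 - s) * (u F \<bullet> x0) + s * (u F \<bullet> x) = c F"
        unfolding s(3) by (simp add: inner_add_right)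
      ultimately show False by (simp add: algebra_simps)
    qed
  qed (use Ple in auto)
  have strict: "u G \<bullet> x < c G" if F: "F facet_of P" and G: "G facet_of P" "G \<noteq> F" and x: "x \<in> rel_interior F" for F G x
  proof -
    have xF: "x \<in> F" using x rel_interior_subset by blast
    then have xP: "x \<in> P" using Feq[OF F] by blast
    have "x \<notin> G"
    proof
      assume "x \<in> G"
      then have "F \<subseteq> G"
        using x facet_of_imp_subset[OF F] by (intro subset_of_face_of[OF Fface[OF G(1)]]) auto
      then have "F face_of G" using Fface[OF F] facet_of_imp_subset[OF G(1)] by (rule_tac face_of_subset)
      then have "aff_dim F < aff_dim G" using G by (intro face_of_aff_dim_lt Fcvx) auto
      then show False using Faff[OF F] Faff[OF G(1)] by simp
    qed
    then have "u G \<bullet> x \<noteq> c G" using Feq[OF G(1)] xP by blast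
    then show ?thesis using Ple[OF G(1) xP] by simp
  qed
  have finF: "finite {F. F facet_of P}" by (rule finite_polyhedron_facets[OF poly])
  have halfspaces: "polytope_halfspaces {F. F facet_of P} u c affine_volume P x0"
  proof (rule polytope_halfspaces.intro)
    show "bounded P" using cmp by (rule compact_imp_bounded)
    fix F assume "F \<in> {F. F facet_of P}"
    then have F: "F facet_of P" by simp
    show "hyperplane_chart (u F) (c F) (affine_volume F)"
    proof (rule hyperplane_chart_affine_volume[OF F0[OF F] u1[OF F] _ Faff[OF F]])
      fix x assume "x \<in> F"
      then show "u F \<bullet> x = c F" using Feq[OF F] by blast
    qed
    show "u F \<bullet> x0 < c F" using F by (rule x0lt)
    obtain p where p: "p \<in> rel_interior F" using rel_interior_eq_empty[OF Fcvx[OF F]] F0[OF F] by auto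
    then have "p \<in> F" using rel_interior_subset by blast
    then have "u F \<bullet> p = c F" using Feq[OF F] by blast
    then show "\<exists>p. u F \<bullet> p = c F \<and> (\<forall>j\<in>{F. F facet_of P} - {F}. u j \<bullet> p < c j)"
      using strict[OF F _ _ p] by blast
  qed (rule finF Peq)+
  interpret polytope_halfspaces "{F. F facet_of P}" u c affine_volume P x0 by (rule halfspaces)
  have "polytope_facets u c P x0"
  proof
    fix F assume F: "F facet_of P"
    show "face F = F" using Feq[OF F] by (auto simp: face_def)
    show "convex F" by (rule Fcvx[OF F])
    show "rel_interior F = {x. u F \<bullet> x = c F \<and> (\<forall>G. G facet_of P \<and> G \<noteq> F \<longrightarrow> u G \<bullet> x < c G)}" (is "_ = ?R")
    proof (intro subset_antisym subsetI)
      fix x assume x: "x \<in> rel_interior F"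
      then have "x \<in> F" using rel_interior_subset by blast
      then have "u F \<bullet> x = c F" using Feq[OF F] by blast
      then show "x \<in> ?R" using strict[OF F _ _ x] by blast
    next
      fix x assume x: "x \<in> ?R"
      define T where "T = (\<Inter>G\<in>{F. F facet_of P} - {F}. {y. u G \<bullet> y < c G})"
      have inF: "y \<in> F" if "y \<in> T" "u F \<bullet> y = c F" for y
      proof -
        have "u G \<bullet> y \<le> c G" if "G facet_of P" for G
          using that \<open>y \<in> T\<close> \<open>u F \<bullet> y = c F\<close> by (cases "G = F") (auto simp: T_def less_imp_le)
        then have "y \<in> P" by (simp add: mem_P)
        then show ?thesis using that(2) Feq[OF F] by blast
      qed
      have "open T" unfolding T_def using finF by (intro open_INT open_halfspace_lt ballI) auto
      moreover have "x \<in> T \<inter> F" using x inF[of x] by (auto simp: T_def)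
      moreover have "affine hull F \<subseteq> {y. u F \<bullet> y = c F}"
      proof (rule hull_minimal)
        show "F \<subseteq> {y. u F \<bullet> y = c F}" using Feq[OF F] by blast
      qed (rule affine_hyperplane)
      then have "T \<inter> affine hull F \<subseteq> F" using inF by blast
      ultimately show "x \<in> rel_interior F" unfolding mem_rel_interior by blast
    qed
  qed (rule fr)
  then show ?thesis by (rule that)
qed

context polytope_facets
begin

lemma facet_chart: "F facet_of P \<Longrightarrow> hyperplane_chart (u F) (c F) (affine_volume F)"
  using chart by simp

lemma rel_interior_relopen:
  assumes F: "F facet_of P" and x: "x \<in> rel_interior F"
  shows "\<exists>r>0. \<forall>y. u F \<bullet> y = c F \<longrightarrow> y \<in> cball x r \<longrightarrow> y \<in> rel_interior F"
proof -
  let ?T = "\<Inter>G\<in>{F. F facet_of P} - {F}. {y. u G \<bullet> y < c G}"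
  have "open ?T" using fin by (intro open_INT open_halfspace_lt ballI) auto
  moreover have "x \<in> ?T" using x rel_interior_eq[OF F] by auto
  ultimately obtain r where "0 < r" "cball x r \<subseteq> ?T" by (meson open_contains_cball)
  then show ?thesis unfolding rel_interior_eq[OF F] by (intro exI[of _ r]) auto
qed

lemma rel_interior_measurable [measurable]:
  assumes F: "F facet_of P"
  shows "rel_interior F \<in> sets borel"
proof -
  let ?T = "\<Inter>G\<in>{F. F facet_of P} - {F}. {y. u G \<bullet> y < c G}"
  have "open ?T" using fin by (intro open_INT open_halfspace_lt ballI) auto
  then have T: "?T \<in> sets borel" by (rule borel_open)
  have eq: "rel_interior F = {x. u F \<bullet> x = c F} \<inter> ?T" unfolding rel_interior_eq[OF F] by auto
  have "{x. u F \<bullet> x = c F} \<in> sets borel" by (intro borel_closed closed_hyperplane)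
  then show ?thesis unfolding eq using T by (rule sets.Int)
qed

lemma rel_interior_nonempty: "F facet_of P \<Longrightarrow> rel_interior F \<noteq> {}"
  using facet_point[of F] by (auto simp: rel_interior_eq)

lemma AE_rel_interior:
  assumes F: "F facet_of P"
  shows "AE x in affine_volume F. x \<in> rel_interior F \<longleftrightarrow> x \<in> F"
proof -
  interpret hyperplane_chart "u F" "c F" "affine_volume F" using F by (rule facet_chart)
  have "AE x in affine_volume F. \<forall>G\<in>{F. F facet_of P} - {F}. u G \<bullet> x \<noteq> c G"
    using F by (intro AE_off_other_faces) simp
  then show ?thesis
    using on_hyperplane
  proof eventually_elim
    case (elim x)
    have "x \<in> rel_interior F" if "x \<in> F"
    proof -
      have "x \<in> P" using that facet_of_imp_subset[OF F] by blast
      then have "u G \<bullet> x \<le> c G" if "G facet_of P" for G using that by (simp add: mem_P)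
      then show ?thesis using elim unfolding rel_interior_eq[OF F] by force
    qed
    then show ?case using rel_interior_subset by blast
  qed
qed

text \<open>On the hyperplane of a facet every affine function is uniquely of the form
  \<open>x \<mapsto> a \<bullet> (x - x0)\<close>, because \<open>x0\<close> does not lie on it. This parametrizes the measures with
  affine density on the facet by \<open>a\<close>.\<close>

definition facet_measure :: "'a set \<Rightarrow> 'a \<Rightarrow> 'a signed_measure" where
  "facet_measure F a = sm_density (affine_volume F) (\<lambda>x. indicator (rel_interior F) x * (a \<bullet> (x - x0)))"

lemma facet_density_integrable:
  assumes F: "F facet_of P"
  shows "integrable (affine_volume F) (\<lambda>x. indicator (rel_interior F) x * (a \<bullet> (x - x0)))"
proof -
  interpret hyperplane_chart "u F" "c F" "affine_volume F" using F by (rule facet_chart)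
  have "set_integrable (affine_volume F) (face F) (\<lambda>x. a \<bullet> (x - x0))"
    using F by (intro set_integrable_face continuous_intros) simp
  then have i: "integrable (affine_volume F) (\<lambda>x. indicator F x * (a \<bullet> (x - x0)))"
    by (simp add: face_eq[OF F] set_integrable_def)
  have [measurable]: "rel_interior F \<in> sets borel" using F by (rule rel_interior_measurable)
  show ?thesis
    by (rule Bochner_Integration.integrable_bound[OF i])
      (measurable, use rel_interior_subset[of F] in \<open>auto simp: indicator_def intro!: AE_I2\<close>)
qed

lemma sm_apply_facet_measure:
  assumes F: "F facet_of P" and B: "B \<in> sets borel"
  shows "sm_apply (facet_measure F a) B = (LINT x:B|affine_volume F. indicator (rel_interior F) x * (a \<bullet> (x - x0)))"
  unfolding facet_measure_def
  using hyperplane_chart.sets_M[OF facet_chart[OF F]] facet_density_integrable[OF F] B by (rule sm_apply_density)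

lemma facet_measure_add:
  assumes F: "F facet_of P"
  shows "facet_measure F (a + b) = facet_measure F a + facet_measure F b"
proof (rule sm_eqI)
  fix B :: "'a set" assume B: "B \<in> sets borel"
  have B': "B \<in> sets (affine_volume F)" using B hyperplane_chart.sets_M[OF facet_chart[OF F]] by simp
  have "set_integrable (affine_volume F) B (\<lambda>x. indicator (rel_interior F) x * (a \<bullet> (x - x0)))" for a
    unfolding set_integrable_def using integrable_mult_indicator[OF B' facet_density_integrable[OF F]] .
  then show "sm_apply (facet_measure F (a + b)) B = sm_apply (facet_measure F a + facet_measure F b) B"
    unfolding sm_plus sm_apply_facet_measure[OF F B]
    by (subst set_integral_add(2)[symmetric]) (auto simp: inner_add_left distrib_left)
qed

lemma facet_measure_scaleR:
  assumes F: "F facet_of P"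
  shows "facet_measure F (k *\<^sub>R a) = k *\<^sub>R facet_measure F a"
  by (rule sm_eqI) (simp add: sm_apply_facet_measure[OF F] mult.left_commute)

lemma facet_measure_zero: "F facet_of P \<Longrightarrow> facet_measure F 0 = 0"
  using facet_measure_scaleR[of F 0 0] by simp

lemma facet_measure_minus: "F facet_of P \<Longrightarrow> facet_measure F (- a) = - facet_measure F a"
  using facet_measure_scaleR[of F "-1" a] by simp

lemma facet_measure_sum:
  assumes F: "F facet_of P"
  shows "facet_measure F (\<Sum>j\<in>J. a j) = (\<Sum>j\<in>J. facet_measure F (a j))"
  by (induction J rule: infinite_finite_induct) (simp_all add: facet_measure_zero[OF F] facet_measure_add[OF F])

lemma affine_to_centred:
  assumes F: "F facet_of P"
  obtains a' where "\<And>x. u F \<bullet> x = c F \<Longrightarrow> a \<bullet> x + b = a' \<bullet> (x - x0)"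
proof -
  have pos: "0 < c F - u F \<bullet> x0" using centre[of F] F by simp
  define k where "k = (b + a \<bullet> x0) / (c F - u F \<bullet> x0)"
  have k: "k * (c F - u F \<bullet> x0) = b + a \<bullet> x0" using pos by (simp add: k_def)
  have "a \<bullet> x + b = (a + k *\<^sub>R u F) \<bullet> (x - x0)" if "u F \<bullet> x = c F" for x
    using k that by (simp add: inner_add_left inner_diff_right algebra_simps)
  then show ?thesis by (rule that)
qed

lemma centred_to_affine:
  assumes F: "F facet_of P"
  obtains a' b' where "a' \<bullet> u F = 0" "\<And>x. u F \<bullet> x = c F \<Longrightarrow> a \<bullet> (x - x0) = a' \<bullet> x + b'"
proof (rule that)
  interpret hyperplane_chart "u F" "c F" "affine_volume F" using F by (rule facet_chart)
  show "(a - (a \<bullet> u F) *\<^sub>R u F) \<bullet> u F = 0" by (simp add: inner_diff_left)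
  show "a \<bullet> (x - x0) = (a - (a \<bullet> u F) *\<^sub>R u F) \<bullet> x + ((a \<bullet> u F) * c F - a \<bullet> x0)" if "u F \<bullet> x = c F" for x
    using that by (simp add: inner_diff_left inner_diff_right)
qed

lemma convex_rel_interior_facet: "F facet_of P \<Longrightarrow> convex (rel_interior F)"
  using convex_facet by (rule convex_rel_interior)

lemma facet_measure_convex_density:
  assumes F: "F facet_of P"
  shows "facet_measure F a \<in> convex_density_measures F"
  unfolding convex_density_measures_def
proof (intro CollectI exI[of _ "\<lambda>x. a \<bullet> (x - x0)"] conjI ballI)
  show "convex_on (rel_interior F) (\<lambda>x. a \<bullet> (x - x0))"
    unfolding convex_on_def
  proof (intro conjI ballI allI impI convex_rel_interior_facet F)
    fix x y and v w :: real assume "0 \<le> v" "0 \<le> w" and vw: "v + w = 1"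
    have w: "w = 1 - v" using vw by simp
    show "a \<bullet> (v *\<^sub>R x + w *\<^sub>R y - x0) \<le> v * (a \<bullet> (x - x0)) + w * (a \<bullet> (y - x0))"
      unfolding w by (simp add: inner_diff_right inner_add_right algebra_simps)
  qed
  show "set_integrable (affine_volume F) (rel_interior F) (\<lambda>x. a \<bullet> (x - x0))"
    unfolding set_integrable_def using facet_density_integrable[OF F] by simp
  fix A :: "'a set" assume A: "A \<in> sets borel"
  show "sm_apply (facet_measure F a) A = (LINT x:A \<inter> rel_interior F|affine_volume F. a \<bullet> (x - x0))"
    unfolding sm_apply_facet_measure[OF F A] set_lebesgue_integral_def
    by (simp add: indicator_inter_arith mult.assoc)
qed

text \<open>If \<open>\<mu>\<close> has a convex density \<open>f\<close> and \<open>- \<mu>\<close> a convex density \<open>g\<close>, then \<open>f + g\<close> is convex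
  and vanishes almost everywhere, hence everywhere; so \<open>f\<close> is also concave.\<close>

lemma convex_density_measures_reversible:
  assumes F: "F facet_of P"
  shows "convex_density_measures F \<inter> uminus ` convex_density_measures F = range (facet_measure F)"
proof (intro subset_antisym subsetI)
  fix \<mu> assume "\<mu> \<in> range (facet_measure F)"
  then obtain a where a: "\<mu> = facet_measure F a" by auto
  have "- facet_measure F (- a) \<in> uminus ` convex_density_measures F"
    by (rule imageI) (rule facet_measure_convex_density[OF F])
  then show "\<mu> \<in> convex_density_measures F \<inter> uminus ` convex_density_measures F"
    using facet_measure_convex_density[OF F, of a] by (simp add: a facet_measure_minus[OF F])
next
  interpret hyperplane_chart "u F" "c F" "affine_volume F" using F by (rule facet_chart)
  let ?U = "rel_interior F"
  fix \<mu> assume "\<mu> \<in> convex_density_measures F \<inter> uminus ` convex_density_measures F"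
  then obtain \<nu> where \<mu>: "\<mu> \<in> convex_density_measures F" and \<nu>: "\<nu> \<in> convex_density_measures F" "\<mu> = - \<nu>" by auto
  obtain f where f: "convex_on ?U f" "set_integrable (affine_volume F) ?U f"
      "\<forall>A\<in>sets borel. sm_apply \<mu> A = (LINT x:A \<inter> ?U|affine_volume F. f x)"
    using \<mu> unfolding convex_density_measures_def by blast
  obtain g where g: "convex_on ?U g" "set_integrable (affine_volume F) ?U g"
      "\<forall>A\<in>sets borel. sm_apply \<nu> A = (LINT x:A \<inter> ?U|affine_volume F. g x)"
    using \<nu>(1) unfolding convex_density_measures_def by blast
  have set_int: "(LINT x:A \<inter> ?U|affine_volume F. h x) = (LINT x:A|affine_volume F. indicator ?U x * h x)" for A and h :: "'a \<Rightarrow> real"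
    by (simp add: set_lebesgue_integral_def indicator_inter_arith mult.assoc)
  have "AE x in affine_volume F. indicator ?U x * f x = - (indicator ?U x * g x)"
  proof (rule density_unique_real)
    show "integrable (affine_volume F) (\<lambda>x. indicator ?U x * f x)" "integrable (affine_volume F) (\<lambda>x. - (indicator ?U x * g x))"
      using f(2) g(2) by (simp_all add: set_integrable_def)
    fix A assume "A \<in> sets (affine_volume F)"
    then have A: "A \<in> sets borel" by simp
    have "sm_apply \<mu> A = - sm_apply \<nu> A" by (simp add: \<nu>(2))
    moreover have "sm_apply \<mu> A = (LINT x:A|affine_volume F. indicator ?U x * f x)"
      unfolding set_int[symmetric] using f(3) A by blast
    moreover have "sm_apply \<nu> A = (LINT x:A|affine_volume F. indicator ?U x * g x)"
      unfolding set_int[symmetric] using g(3) A by blast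
    ultimately show "(LINT x:A|affine_volume F. indicator ?U x * f x) = (LINT x:A|affine_volume F. - (indicator ?U x * g x))"
      by (simp add: set_lebesgue_integral_def)
  qed
  then have ae: "AE x in affine_volume F. x \<in> ?U \<longrightarrow> f x + g x = 0"
    by eventually_elim auto
  have UF: "u F \<bullet> x = c F" if "x \<in> ?U" for x using that rel_interior_eq[OF F] by auto
  have cU: "convex ?U" by (rule convex_rel_interior_facet[OF F])
  have zero: "f x + g x = 0" if "x \<in> ?U" for x
    by (rule convex_AE_zero_imp_zero[OF cU UF rel_interior_relopen[OF F] _ convex_on_add[OF f(1) g(1)] ae that])
      (simp_all add: rel_interior_rel_interior convex_facet[OF F])
  have conc: "concave_on ?U f"
  proof -
    have "- f x = g x" if "x \<in> ?U" for x using zero[OF that] by simp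
    then show ?thesis
      using g(1) convexD[OF cU] unfolding concave_on_def convex_on_def by simp
  qed
  obtain p where p: "p \<in> ?U" using rel_interior_nonempty[OF F] by blast
  obtain r where r: "0 < r" "\<forall>y. u F \<bullet> y = c F \<longrightarrow> y \<in> cball p r \<longrightarrow> y \<in> ?U"
    using rel_interior_relopen[OF F p] by blast
  obtain a b where ab: "\<And>x. x \<in> ?U \<Longrightarrow> f x = a \<bullet> x + b"
    by (rule affine_of_convex_concave[OF cU UF p r(1) _ f(1) conc]) (use r(2) in blast)+
  obtain a' where a': "\<And>x. u F \<bullet> x = c F \<Longrightarrow> a \<bullet> x + b = a' \<bullet> (x - x0)"
    by (rule affine_to_centred[OF F]) blast
  have "\<mu> = facet_measure F a'"
  proof (rule sm_eqI)
    fix B :: "'a set" assume B: "B \<in> sets borel"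
    have eq: "indicator ?U x * f x = indicator ?U x * (a' \<bullet> (x - x0))" for x
      using ab[of x] a'[OF UF, of x] by (cases "x \<in> ?U") auto
    show "sm_apply \<mu> B = sm_apply (facet_measure F a') B"
      using f(3) B unfolding sm_apply_facet_measure[OF F B] set_int eq by simp
  qed
  then show "\<mu> \<in> range (facet_measure F)" by blast
qed

section \<open>Reversible small perturbations of a polytope\<close>

lemma frontier_compact: "compact (frontier P)"
  using compact_P by (simp add: compact_frontier)

lemma frontier_measurable [measurable]: "frontier P \<in> sets borel"
  using frontier_compact by (rule borel_compact)

lemma continuous_bounded_frontier:
  fixes f :: "'a \<Rightarrow> real"
  assumes "continuous_on UNIV f"
  obtains b where "\<And>x. x \<in> frontier P \<Longrightarrow> \<bar>f x\<bar> \<le> b"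
proof -
  have "bounded (f ` frontier P)"
    using assms frontier_compact by (intro compact_imp_bounded compact_continuous_image) (auto intro: continuous_on_subset)
  then obtain b where "\<forall>x\<in>frontier P. \<bar>f x\<bar> \<le> b" unfolding bounded_iff by auto
  then show ?thesis using that by blast
qed

lemma facet_subset_frontier: "F facet_of P \<Longrightarrow> F \<subseteq> frontier P"
  unfolding frontier_eq by blast

lemma integral_facet_measure:
  fixes f :: "'a \<Rightarrow> real"
  assumes F: "F facet_of P" and f: "continuous_on UNIV f"
  shows "signed_set_integral (facet_measure F a) (frontier P) f = (LINT x:face F|affine_volume F. f x * (a \<bullet> (x - x0)))"
proof -
  interpret hyperplane_chart "u F" "c F" "affine_volume F" using F by (rule facet_chart)
  have [measurable]: "f \<in> borel_measurable borel" using f by (rule borel_measurable_continuous_onI)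
  have [measurable]: "rel_interior F \<in> sets borel" using F by (rule rel_interior_measurable)
  have [measurable]: "F \<in> sets borel" using face_measurable[of F] face_eq[OF F] by simp
  obtain b where b: "\<And>x. x \<in> frontier P \<Longrightarrow> \<bar>f x\<bar> \<le> b" by (rule continuous_bounded_frontier[OF f]) blast
  have "signed_set_integral (facet_measure F a) (frontier P) f
      = (LINT x:frontier P|affine_volume F. f x * (indicator (rel_interior F) x * (a \<bullet> (x - x0))))"
    by (rule signed_set_integral_density[OF sets_M facet_density_integrable[OF F] sm_apply_facet_measure[OF F] _ _ b]) auto
  also have "\<dots> = (LINT x:F|affine_volume F. f x * (a \<bullet> (x - x0)))"
    unfolding set_lebesgue_integral_def
  proof (rule integral_cong_AE)
    show "AE x in affine_volume F. indicator (frontier P) x *\<^sub>R (f x * (indicator (rel_interior F) x * (a \<bullet> (x - x0))))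
        = indicator F x *\<^sub>R (f x * (a \<bullet> (x - x0)))"
      using AE_rel_interior[OF F]
    proof eventually_elim
      case (elim x)
      then show ?case using facet_subset_frontier[OF F] by (cases "x \<in> F") auto
    qed
  qed measurable
  finally show ?thesis by (simp add: face_eq[OF F])
qed

lemma supported_facet_measures:
  "supported_on (\<Sum>F\<in>{F. F facet_of P}. facet_measure F (a F)) (frontier P)"
  unfolding supported_on_def
proof (intro ballI impI)
  fix B :: "'a set" assume B: "B \<in> sets borel" "B \<subseteq> - frontier P"
  have "sm_apply (facet_measure F (a F)) B = 0" if F: "F facet_of P" for F
  proof -
    have z: "indicator B x *\<^sub>R (indicator (rel_interior F) x * (a F \<bullet> (x - x0))) = 0" for x
      using B(2) facet_subset_frontier[OF F] rel_interior_subset[of F] by (auto simp: indicator_def)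
    show ?thesis unfolding sm_apply_facet_measure[OF F B(1)] set_lebesgue_integral_def z by simp
  qed
  then show "sm_apply (\<Sum>F\<in>{F. F facet_of P}. facet_measure F (a F)) B = 0" by simp
qed

lemma integral_facet_measures:
  fixes f :: "'a \<Rightarrow> real"
  assumes f: "continuous_on UNIV f"
  shows "signed_set_integral (\<Sum>F\<in>{F. F facet_of P}. facet_measure F (a F)) (frontier P) f
    = (\<Sum>F\<in>{F. F facet_of P}. LINT x:face F|affine_volume F. f x * (a F \<bullet> (x - x0)))"
proof -
  obtain b where b: "\<And>x. x \<in> frontier P \<Longrightarrow> \<bar>f x\<bar> \<le> b" by (rule continuous_bounded_frontier[OF f]) blast
  have "signed_set_integral (\<Sum>F\<in>{F. F facet_of P}. facet_measure F (a F)) (frontier P) f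
    = (\<Sum>F\<in>{F. F facet_of P}. signed_set_integral (facet_measure F (a F)) (frontier P) f)"
    by (rule signed_set_integral_sum[OF borel_measurable_continuous_onI[OF f] frontier_measurable b])
  then show ?thesis by (simp add: integral_facet_measure[OF _ f])
qed

lemma deformed_full_dimensional:
  "\<forall>\<^sub>F t in at_right 0. full_dimensional (deformed a b t)"
proof -
  obtain \<eta> where \<eta>: "0 < \<eta>" "\<And>i. i \<in> {F. F facet_of P} \<Longrightarrow> u i \<bullet> x0 + \<eta> \<le> c i" by (rule slack) blast
  define \<rho> where "\<rho> = min 1 (\<eta> / 2)"
  have \<rho>: "0 < \<rho>" "\<rho> \<le> 1" "\<rho> \<le> \<eta> / 2" using \<eta> by (auto simp: \<rho>_def)
  define A where "A = 1 + (\<Sum>i\<in>{F. F facet_of P}. norm (a i) + \<bar>a i \<bullet> x0 + b i\<bar>)"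
  have A: "norm (a i) + \<bar>a i \<bullet> x0 + b i\<bar> \<le> A" if "i \<in> {F. F facet_of P}" for i
    using member_le_sum[OF that, of "\<lambda>i. norm (a i) + \<bar>a i \<bullet> x0 + b i\<bar>"] fin by (simp add: A_def)
  have A1: "1 \<le> A" unfolding A_def by (simp add: sum_nonneg)
  have "\<forall>\<^sub>F t in at_right 0. t < \<eta> / (2 * A)"
    using \<eta> A1 by (intro eventually_at_rightI[of 0 "\<eta> / (2 * A)"]) auto
  then show ?thesis using eventually_at_right_less[of 0]
  proof eventually_elim
    case (elim t)
    have tA: "t * A \<le> \<eta> / 2" using elim A1 by (simp add: field_simps)
    have "ball x0 \<rho> \<subseteq> deformed a b t"
      unfolding deformed_def
    proof safe
      fix x F assume x: "x \<in> ball x0 \<rho>" and F: "F facet_of P"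
      have nx: "norm (x - x0) \<le> \<rho>" using x by (simp add: dist_norm norm_minus_commute)
      have "\<bar>u F \<bullet> (x - x0)\<bar> \<le> norm (u F) * norm (x - x0)" by (rule Cauchy_Schwarz_ineq2)
      then have "u F \<bullet> x \<le> u F \<bullet> x0 + \<eta> / 2" using F nx \<rho> by (simp add: inner_diff_right)
      moreover have "\<bar>a F \<bullet> (x - x0)\<bar> \<le> norm (a F) * norm (x - x0)" by (rule Cauchy_Schwarz_ineq2)
      moreover have "norm (a F) * norm (x - x0) \<le> norm (a F) * 1" using nx \<rho> by (intro mult_left_mono) auto
      ultimately have *: "u F \<bullet> x \<le> c F - \<eta> / 2" "- A \<le> a F \<bullet> x + b F"
        using \<eta>(2)[of F] A[of F] F by (auto simp: inner_diff_right)
      have "t * - A \<le> t * (a F \<bullet> x + b F)" using *(2) elim by (intro mult_left_mono) auto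
      then show "u F \<bullet> x \<le> c F + t * (a F \<bullet> x + b F)" using *(1) tA by simp
    qed
    then have "interior (deformed a b t) \<noteq> {}"
      using interior_maximal[OF _ open_ball, of x0 \<rho> "deformed a b t"] \<rho> by force
    then show "full_dimensional (deformed a b t)" by (rule full_dimensional_if_interior)
  qed
qed

text \<open>The facets are tilted according to the density. Stopping the deformation at a positive time
  keeps all members of the family convex bodies.\<close>

lemma facet_measures_small_perturbation:
  "small_perturbation P (\<Sum>F\<in>{F. F facet_of P}. facet_measure F (a F))"
proof -
  let ?I = "{F. F facet_of P}"
  have "\<forall>F\<in>?I. \<exists>ab. fst ab \<bullet> u F = 0 \<and> (\<forall>x. u F \<bullet> x = c F \<longrightarrow> a F \<bullet> (x - x0) = fst ab \<bullet> x + snd ab)"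
  proof
    fix F assume "F \<in> ?I"
    then have F: "F facet_of P" by simp
    obtain a' b' where "a' \<bullet> u F = 0" "\<And>x. u F \<bullet> x = c F \<Longrightarrow> a F \<bullet> (x - x0) = a' \<bullet> x + b'"
      by (rule centred_to_affine[OF F]) blast
    then show "\<exists>ab. fst ab \<bullet> u F = 0 \<and> (\<forall>x. u F \<bullet> x = c F \<longrightarrow> a F \<bullet> (x - x0) = fst ab \<bullet> x + snd ab)"
      by (intro exI[of _ "(a', b')"]) auto
  qed
  from bchoice[OF this] obtain ab where
    ab: "\<forall>F\<in>?I. fst (ab F) \<bullet> u F = 0 \<and> (\<forall>x. u F \<bullet> x = c F \<longrightarrow> a F \<bullet> (x - x0) = fst (ab F) \<bullet> x + snd (ab F))"
    by (rule exE)
  define a' b' where "a' F = fst (ab F)" and "b' F = snd (ab F)" for F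
  have perp: "a' F \<bullet> u F = 0" if "F \<in> ?I" for F using ab that by (simp add: a'_def)
  have aff: "a F \<bullet> (x - x0) = a' F \<bullet> x + b' F" if "F \<in> ?I" "u F \<bullet> x = c F" for F x
    using ab that by (simp add: a'_def b'_def)
  have "\<forall>\<^sub>F t in at_right 0. compact (deformed a' b' t) \<and> full_dimensional (deformed a' b' t)"
    by (intro eventually_conj deformed_compact deformed_full_dimensional)
  then obtain e where e: "0 < e" "\<And>t. 0 < t \<Longrightarrow> t < e \<Longrightarrow> compact (deformed a' b' t) \<and> full_dimensional (deformed a' b' t)"
    unfolding eventually_at_right_field by blast
  define K where "K t = deformed a' b' (min t (e / 2))" for t
  have K0: "K 0 = P" using e by (simp add: K_def)
  have fullP: "full_dimensional P"
  proof -
    have "x0 \<in> interior P"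
    proof -
      have "open {x. \<forall>F\<in>?I. u F \<bullet> x < c F}"
      proof -
        have "{x. \<forall>F\<in>?I. u F \<bullet> x < c F} = (\<Inter>F\<in>?I. {x. u F \<bullet> x < c F})" by auto
        then show ?thesis using fin by (auto intro!: open_INT open_halfspace_lt)
      qed
      moreover have "{x. \<forall>F\<in>?I. u F \<bullet> x < c F} \<subseteq> P" by (auto simp: mem_P less_imp_le)
      ultimately show ?thesis using centre by (intro interiorI[of "{x. \<forall>F\<in>?I. u F \<bullet> x < c F}"]) auto
    qed
    then show ?thesis by (intro full_dimensional_if_interior) auto
  qed
  have bodies: "convex_body (K t) \<and> full_dimensional (K t)" if "t \<in> {0..1}" for t
  proof -
    have "compact (K t) \<and> full_dimensional (K t)"
    proof (cases "t = 0")
      case True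
      then show ?thesis using K0 compact_P fullP by simp
    next
      case False
      then show ?thesis using e that by (simp add: K_def)
    qed
    moreover have "K t \<noteq> {}" if "full_dimensional (K t)" using that by (auto simp: full_dimensional_def)
    ultimately show ?thesis by (auto simp: convex_body_def K_def convex_deformed)
  qed
  have deriv: "((\<lambda>t. LINT x:K t|lborel. f x) has_vector_derivative
      signed_set_integral (\<Sum>F\<in>?I. facet_measure F (a F)) (frontier P) f) (at_right 0)"
    if f: "continuous_on UNIV f" for f :: "'a \<Rightarrow> real"
  proof -
    have "(\<Sum>F\<in>?I. LINT x:face F|affine_volume F. f x * (a' F \<bullet> x + b' F))
        = signed_set_integral (\<Sum>F\<in>?I. facet_measure F (a F)) (frontier P) f"
      unfolding integral_facet_measures[OF f]
    proof (rule sum.cong)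
      fix F assume F: "F \<in> ?I"
      have z: "indicator (face F) x *\<^sub>R (f x * (a' F \<bullet> x + b' F)) = indicator (face F) x *\<^sub>R (f x * (a F \<bullet> (x - x0)))" for x
        using aff[OF F, of x] by (cases "x \<in> face F") (auto simp: face_def)
      show "(LINT x:face F|affine_volume F. f x * (a' F \<bullet> x + b' F)) = (LINT x:face F|affine_volume F. f x * (a F \<bullet> (x - x0)))"
        unfolding set_lebesgue_integral_def z by simp
    qed simp
    then have "((\<lambda>t. ((LINT x:deformed a' b' t|lborel. f x) - (LINT x:P|lborel. f x)) / t)
        \<longlongrightarrow> signed_set_integral (\<Sum>F\<in>?I. facet_measure F (a F)) (frontier P) f) (at_right 0)"
      using first_variation[OF perp f, of b'] by simp
    then have "((\<lambda>t. ((LINT x:K t|lborel. f x) - (LINT x:K 0|lborel. f x)) / (t - 0))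
        \<longlongrightarrow> signed_set_integral (\<Sum>F\<in>?I. facet_measure F (a F)) (frontier P) f) (at_right 0)"
    proof (rule Lim_transform_eventually)
      have "\<forall>\<^sub>F t in at_right 0. t < e / 2" using e by (intro eventually_at_rightI[of 0 "e / 2"]) auto
      then show "\<forall>\<^sub>F t in at_right 0. ((LINT x:deformed a' b' t|lborel. f x) - (LINT x:P|lborel. f x)) / t
          = ((LINT x:K t|lborel. f x) - (LINT x:K 0|lborel. f x)) / (t - 0)"
        by eventually_elim (simp add: K0, simp add: K_def)
    qed
    then show ?thesis
      unfolding has_real_derivative_iff_has_vector_derivative[symmetric] has_field_derivative_iff .
  qed
  show ?thesis
    unfolding small_perturbation_def
  proof (intro conjI exI[of _ K] allI impI supported_facet_measures K0)
    show "weakly_differentiable K"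
      unfolding weakly_differentiable_def
      using bodies differentiableI_vector[OF deriv] by blast
    fix f :: "'a \<Rightarrow> real" assume f: "continuous_on UNIV f"
    show "weak_derivative K f = signed_set_integral (\<Sum>F\<in>?I. facet_measure F (a F)) (frontier P) f"
      unfolding weak_derivative_def by (rule vector_derivative_within[OF _ deriv[OF f]]) simp
  qed
qed

lemma small_perturbation_perturbs:
  assumes "small_perturbation P \<mu>"
  obtains K where "perturbs K (signed_set_integral \<mu> (frontier P))"
proof -
  obtain K where K: "weakly_differentiable K" "K 0 = P"
    "\<And>f. continuous_on UNIV f \<Longrightarrow> weak_derivative K f = signed_set_integral \<mu> (frontier P) f"
    using assms unfolding small_perturbation_def by blast
  have "perturbs K (signed_set_integral \<mu> (frontier P))"
    unfolding perturbs_def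
  proof (intro conjI allI impI)
    have "\<forall>\<^sub>F t in at_right 0. t < (1 :: real)" by (intro eventually_at_rightI[of 0 1]) auto
    then show "\<forall>\<^sub>F t in at_right 0. compact (K t) \<and> convex (K t)"
      using eventually_at_right_less[of "0 :: real"]
      by eventually_elim (use K(1) in \<open>auto simp: weakly_differentiable_def convex_body_def\<close>)
    fix f :: "'a \<Rightarrow> real" assume f: "continuous_on UNIV f"
    have "(\<lambda>t. LINT x:K t|lborel. f x) differentiable (at_right 0)"
      using K(1) f by (simp add: weakly_differentiable_def)
    then have "((\<lambda>t. LINT x:K t|lborel. f x) has_vector_derivative signed_set_integral \<mu> (frontier P) f) (at_right 0)"
      using K(3)[OF f] unfolding weak_derivative_def vector_derivative_works by simp
    then show "((\<lambda>t. ((LINT x:K t|lborel. f x) - (LINT x:P|lborel. f x)) / t) \<longlongrightarrow> signed_set_integral \<mu> (frontier P) f) (at_right 0)"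
      unfolding has_real_derivative_iff_has_vector_derivative[symmetric] has_field_derivative_iff by (simp add: K(2))
  qed
  then show ?thesis by (rule that)
qed

lemma reversible_imp_facet_measures:
  assumes "\<mu> \<in> reversible_small_perturbations P"
  shows "\<exists>a. \<mu> = (\<Sum>F\<in>{F. F facet_of P}. facet_measure F (a F))"
proof -
  let ?I = "{F. F facet_of P}"
  have sp: "small_perturbation P \<mu>" "small_perturbation P (- \<mu>)"
    using assms by (auto simp: reversible_small_perturbations_def)
  obtain K where K: "perturbs K (signed_set_integral \<mu> (frontier P))"
    using small_perturbation_perturbs[OF sp(1)] by blast
  obtain K' where K': "perturbs K' (signed_set_integral (- \<mu>) (frontier P))"
    using small_perturbation_perturbs[OF sp(2)] by blast
  have cong: "signed_set_integral \<mu> (frontier P) f = signed_set_integral \<mu> (frontier P) g"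
    if "\<And>F x. F \<in> ?I \<Longrightarrow> x \<in> face F \<Longrightarrow> f x = g x" for f g :: "'a \<Rightarrow> real"
  proof -
    have "f x = g x" if x: "x \<in> frontier P" for x
    proof -
      obtain F where F: "F facet_of P" "x \<in> F" using x unfolding frontier_eq by blast
      then show ?thesis using \<open>\<And>F x. F \<in> ?I \<Longrightarrow> x \<in> face F \<Longrightarrow> f x = g x\<close>[of F x] face_eq[OF F(1)] by simp
    qed
    then have z: "indicator (frontier P) x *\<^sub>R f x = indicator (frontier P) x *\<^sub>R g x" for x
      by (cases "x \<in> frontier P") auto
    show ?thesis unfolding signed_set_integral_def set_lebesgue_integral_def z by simp
  qed
  obtain a b where ab: "\<And>f. continuous_on UNIV f \<Longrightarrow>
      signed_set_integral \<mu> (frontier P) f = (\<Sum>F\<in>?I. LINT x:face F|affine_volume F. f x * (a F \<bullet> x + b F))"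
    by (rule reversible_density[OF K K' signed_set_integral_uminus cong]) blast+
  have "\<forall>F\<in>?I. \<exists>a'. \<forall>x. u F \<bullet> x = c F \<longrightarrow> a F \<bullet> x + b F = a' \<bullet> (x - x0)"
  proof
    fix F assume "F \<in> ?I"
    then have F: "F facet_of P" by simp
    obtain a' where "\<And>x. u F \<bullet> x = c F \<Longrightarrow> a F \<bullet> x + b F = a' \<bullet> (x - x0)"
      by (rule affine_to_centred[OF F]) blast
    then show "\<exists>a'. \<forall>x. u F \<bullet> x = c F \<longrightarrow> a F \<bullet> x + b F = a' \<bullet> (x - x0)" by blast
  qed
  from bchoice[OF this] obtain a' where
    a': "\<forall>F\<in>?I. \<forall>x. u F \<bullet> x = c F \<longrightarrow> a F \<bullet> x + b F = a' F \<bullet> (x - x0)" by (rule exE)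
  have "\<mu> = (\<Sum>F\<in>?I. facet_measure F (a' F))"
  proof (rule signed_measure_eq_on_closed[of "frontier P"])
    show "closed (frontier P)" by simp
    show "bounded (f ` frontier P)" if "continuous_on UNIV f" for f :: "'a \<Rightarrow> real"
      using that frontier_compact by (intro compact_imp_bounded compact_continuous_image) (auto intro: continuous_on_subset)
    show "supported_on \<mu> (frontier P)" using sp(1) by (simp add: small_perturbation_def)
    show "supported_on (\<Sum>F\<in>?I. facet_measure F (a' F)) (frontier P)" by (rule supported_facet_measures)
    fix f :: "'a \<Rightarrow> real" assume f: "continuous_on UNIV f"
    show "signed_set_integral \<mu> (frontier P) f = signed_set_integral (\<Sum>F\<in>?I. facet_measure F (a' F)) (frontier P) f"
      unfolding ab[OF f] integral_facet_measures[OF f]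
    proof (rule sum.cong)
      fix F assume F: "F \<in> ?I"
      have z: "indicator (face F) x *\<^sub>R (f x * (a F \<bullet> x + b F)) = indicator (face F) x *\<^sub>R (f x * (a' F \<bullet> (x - x0)))" for x
        using a' F by (cases "x \<in> face F") (auto simp: face_def)
      show "(LINT x:face F|affine_volume F. f x * (a F \<bullet> x + b F)) = (LINT x:face F|affine_volume F. f x * (a' F \<bullet> (x - x0)))"
        unfolding set_lebesgue_integral_def z by simp
    qed simp
  qed
  then show ?thesis by blast
qed

lemma reversible_eq_facet_measures:
  "reversible_small_perturbations P = range (\<lambda>a. \<Sum>F\<in>{F. F facet_of P}. facet_measure F (a F))"
proof (intro subset_antisym subsetI)
  fix \<mu> assume "\<mu> \<in> range (\<lambda>a. \<Sum>F\<in>{F. F facet_of P}. facet_measure F (a F))"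
  then obtain a where a: "\<mu> = (\<Sum>F\<in>{F. F facet_of P}. facet_measure F (a F))" by auto
  have "- \<mu> = (\<Sum>F\<in>{F. F facet_of P}. facet_measure F (- a F))"
    by (simp add: a facet_measure_minus sum_negf)
  then show "\<mu> \<in> reversible_small_perturbations P"
    using facet_measures_small_perturbation[of a] facet_measures_small_perturbation[of "\<lambda>F. - a F"]
    by (simp add: reversible_small_perturbations_def a)
qed (use reversible_imp_facet_measures in auto)

text \<open>The relative interiors of the facets are disjoint, so each density vanishes almost everywhere.
  The zeros of a nonzero density form a null set, while the relative interior has positive volume.\<close>

lemma facet_measures_eq_0_imp:
  assumes eq: "(\<Sum>F\<in>{F. F facet_of P}. facet_measure F (a F)) = 0" and F: "F facet_of P"
  shows "a F = 0"
proof (rule ccontr)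
  assume a: "a F \<noteq> 0"
  interpret hyperplane_chart "u F" "c F" "affine_volume F" using F by (rule facet_chart)
  let ?U = "rel_interior F"
  have disj: "x \<notin> rel_interior G" if "x \<in> ?U" "G facet_of P" "G \<noteq> F" for x G
    using that rel_interior_eq[OF F] rel_interior_eq[OF that(2)] by force
  have "AE x in affine_volume F. indicator ?U x * (a F \<bullet> (x - x0)) = 0"
  proof (rule density_unique_real)
    show "integrable (affine_volume F) (\<lambda>x. indicator ?U x * (a F \<bullet> (x - x0)))" by (rule facet_density_integrable[OF F])
    fix B assume "B \<in> sets (affine_volume F)"
    then have B: "B \<inter> ?U \<in> sets borel" using rel_interior_measurable[OF F] by simp
    have "sm_apply (facet_measure G (a G)) (B \<inter> ?U) = 0" if G: "G facet_of P" "G \<noteq> F" for G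
    proof -
      have z: "indicator (B \<inter> ?U) x *\<^sub>R (indicator (rel_interior G) x * (a G \<bullet> (x - x0))) = 0" for x
        using disj[OF _ G] by (auto simp: indicator_def)
      show ?thesis unfolding sm_apply_facet_measure[OF G(1) B] set_lebesgue_integral_def z by simp
    qed
    then have "sm_apply (\<Sum>G\<in>{F. F facet_of P}. facet_measure G (a G)) (B \<inter> ?U) = sm_apply (facet_measure F (a F)) (B \<inter> ?U)"
      using F fin by (simp add: sum.remove[of _ F])
    then have "sm_apply (facet_measure F (a F)) (B \<inter> ?U) = 0" using eq by simp
    moreover have z: "indicator (B \<inter> ?U) x *\<^sub>R (indicator ?U x * (a F \<bullet> (x - x0))) = indicator B x *\<^sub>R (indicator ?U x * (a F \<bullet> (x - x0)))" for x
      by (auto simp: indicator_def)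
    ultimately show "(LINT x:B|affine_volume F. indicator ?U x * (a F \<bullet> (x - x0))) = (LINT x:B|affine_volume F. 0)"
      unfolding sm_apply_facet_measure[OF F B] set_lebesgue_integral_def z by simp
  qed simp
  moreover have "AE x in affine_volume F. a F \<bullet> x \<noteq> a F \<bullet> x0"
  proof -
    define w where "w = a F - (a F \<bullet> u F) *\<^sub>R u F"
    have wu: "u F \<bullet> w = 0" by (simp add: w_def inner_diff_right inner_commute)
    have aw: "a F \<bullet> w = w \<bullet> w" using wu by (simp add: w_def inner_diff_left inner_commute)
    define q where "q = foot x0"
    have q: "u F \<bullet> q = c F" by (simp add: q_def)
    have "\<exists>p. u F \<bullet> p = c F \<and> a F \<bullet> p \<noteq> a F \<bullet> x0"
    proof (cases "a F \<bullet> q = a F \<bullet> x0")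
      case True
      have "w \<noteq> 0"
      proof
        assume "w = 0"
        then have aF: "a F = (a F \<bullet> u F) *\<^sub>R u F" by (simp add: w_def)
        have "a F \<bullet> (q - x0) = (a F \<bullet> u F) * (u F \<bullet> (q - x0))" using arg_cong[OF aF, of "\<lambda>v. v \<bullet> (q - x0)"] by simp
        then have "(a F \<bullet> u F) * (c F - u F \<bullet> x0) = 0" using True q by (simp add: inner_diff_right)
        then have "a F \<bullet> u F = 0" using centre[of F] F by simp
        then show False using aF a by simp
      qed
      then have "a F \<bullet> (q + w) \<noteq> a F \<bullet> x0" using True aw by (simp add: inner_add_right)
      moreover have "u F \<bullet> (q + w) = c F" using q wu by (simp add: inner_add_right)
      ultimately show ?thesis by blast
    qed (use q in blast)
    then show ?thesis using AE_off_hyperplane by blast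
  qed
  ultimately have ae: "AE x in affine_volume F. x \<notin> ?U"
    by eventually_elim (auto simp: indicator_def inner_diff_right)
  obtain p where p: "p \<in> ?U" using rel_interior_nonempty[OF F] by blast
  obtain r where r: "0 < r" "\<forall>y. u F \<bullet> y = c F \<longrightarrow> y \<in> cball p r \<longrightarrow> y \<in> ?U"
    using rel_interior_relopen[OF F p] by blast
  show False
    by (rule emeasure_relopen_pos[OF ae p _ r(1)]) (use r p rel_interior_eq[OF F] in auto)
qed

text \<open>The measures with density \<open>x \<mapsto> e \<bullet> (x - x0)\<close> on a facet, for all facets and all standard basis
  vectors \<open>e\<close>, form a basis.\<close>

theorem reversible_small_perturbations_polytope:
  "reversible_small_perturbations P =
     (\<Sum>F\<in>{F. F facet_of P}. convex_density_measures F \<inter> uminus ` convex_density_measures F)"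
  "subspace (reversible_small_perturbations P)"
  "dim (reversible_small_perturbations P) = card {F. F facet_of P} * DIM('a)"
proof -
  let ?I = "{F. F facet_of P}" and ?W = "reversible_small_perturbations P"
  let ?s = "\<lambda>a. \<Sum>F\<in>?I. facet_measure F (a F)"
  have "(\<Sum>F\<in>?I. convex_density_measures F \<inter> uminus ` convex_density_measures F) = (\<Sum>F\<in>?I. range (facet_measure F))"
    by (intro sum.cong) (simp_all add: convex_density_measures_reversible)
  also have "\<dots> = {sum s ?I |s. \<forall>F\<in>?I. s F \<in> range (facet_measure F)}" by (rule set_sum_alt[OF fin])
  also have "\<dots> = range ?s"
  proof (intro subset_antisym subsetI)
    fix \<mu> assume "\<mu> \<in> {sum s ?I |s. \<forall>F\<in>?I. s F \<in> range (facet_measure F)}"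
    then obtain s where s: "\<mu> = sum s ?I" "\<forall>F\<in>?I. s F \<in> range (facet_measure F)" by blast
    have "\<forall>F\<in>?I. \<exists>a. s F = facet_measure F a" using s(2) by blast
    from bchoice[OF this] obtain a where "\<forall>F\<in>?I. s F = facet_measure F (a F)" by (rule exE)
    then have "\<mu> = ?s a" using s(1) by simp
    then show "\<mu> \<in> range ?s" by blast
  qed auto
  finally show "?W = (\<Sum>F\<in>?I. convex_density_measures F \<inter> uminus ` convex_density_measures F)"
    using reversible_eq_facet_measures by simp
  note W = reversible_eq_facet_measures
  show sub: "subspace ?W"
    unfolding W
  proof (rule subspaceI)
    have "?s (\<lambda>_. 0) = 0" by (simp add: facet_measure_zero)
    then show "0 \<in> range ?s" by (intro range_eqI[where x = "\<lambda>_. 0"]) (rule sym)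
    fix \<mu> \<nu> assume "\<mu> \<in> range ?s" "\<nu> \<in> range ?s"
    then obtain a b where ab: "\<mu> = ?s a" "\<nu> = ?s b" by auto
    have "?s (\<lambda>F. a F + b F) = \<mu> + \<nu>" by (simp add: ab facet_measure_add sum.distrib)
    then show "\<mu> + \<nu> \<in> range ?s" by (intro range_eqI[where x = "\<lambda>F. a F + b F"]) (rule sym)
  next
    fix k :: real and \<mu> assume "\<mu> \<in> range ?s"
    then obtain a where a: "\<mu> = ?s a" by auto
    have "?s (\<lambda>F. k *\<^sub>R a F) = k *\<^sub>R \<mu>" by (simp add: a facet_measure_scaleR scaleR_sum_right)
    then show "k *\<^sub>R \<mu> \<in> range ?s" by (intro range_eqI[where x = "\<lambda>F. k *\<^sub>R a F"]) (rule sym)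
  qed
  define \<psi> where "\<psi> = (\<lambda>(F, e :: 'a). facet_measure F e)"
  have single: "?s (\<lambda>G. if G = F then e else 0) = facet_measure F e" if "F \<in> ?I" for F e
  proof -
    have "?s (\<lambda>G. if G = F then e else 0) = (\<Sum>G\<in>?I. if G = F then facet_measure F e else 0)"
      by (intro sum.cong) (auto simp: facet_measure_zero)
    then show ?thesis using fin that by simp
  qed
  have inj: "inj_on \<psi> (?I \<times> Basis)"
  proof (rule inj_onI)
    fix x y assume "x \<in> ?I \<times> Basis" "y \<in> ?I \<times> Basis" and eq: "\<psi> x = \<psi> y"
    then obtain F e G e' where xy: "x = (F, e)" "y = (G, e')" "F \<in> ?I" "G \<in> ?I" "e \<in> Basis" "e' \<in> Basis" by auto
    have "?s (\<lambda>H. (if H = F then e else 0) + - (if H = G then e' else 0))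
        = ?s (\<lambda>H. if H = F then e else 0) + - ?s (\<lambda>H. if H = G then e' else 0)"
      by (simp add: facet_measure_add facet_measure_minus sum.distrib sum_negf del: add_uminus_conv_diff)
    also have "\<dots> = 0" using eq xy by (simp add: single \<psi>_def)
    finally have "(if F = F then e else 0) + - (if F = G then e' else 0) = 0"
      using facet_measures_eq_0_imp[of "\<lambda>H. (if H = F then e else 0) + - (if H = G then e' else 0)" F] xy(3) by simp
    then show "x = y" using xy nonzero_Basis by (auto split: if_splits)
  qed
  let ?B = "\<psi> ` (?I \<times> Basis)"
  have finB: "finite ?B" using fin by simp
  have ind: "independent ?B"
  proof (rule independent_if_scalars_zero[OF finB])
    fix f x assume f: "(\<Sum>x\<in>?B. f x *\<^sub>R x) = 0" and x: "x \<in> ?B"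
    define a where "a F = (\<Sum>e\<in>Basis. f (\<psi> (F, e)) *\<^sub>R e)" for F
    have "?s a = (\<Sum>F\<in>?I. \<Sum>e\<in>Basis. f (\<psi> (F, e)) *\<^sub>R \<psi> (F, e))"
      by (intro sum.cong) (simp_all add: a_def facet_measure_sum facet_measure_scaleR \<psi>_def)
    also have "\<dots> = (\<Sum>z\<in>?I \<times> Basis. f (\<psi> z) *\<^sub>R \<psi> z)"
      by (simp add: sum.cartesian_product case_prod_beta)
    also have "\<dots> = 0" using f by (simp add: sum.reindex[OF inj])
    finally have a0: "a F = 0" if "F \<in> ?I" for F using facet_measures_eq_0_imp[of a F] that by simp
    obtain F e where xe: "x = \<psi> (F, e)" "F \<in> ?I" "e \<in> Basis" using x by auto
    have "a F \<bullet> e = f (\<psi> (F, e))" using xe(3) by (simp add: a_def inner_sum_left inner_Basis if_distrib sum.delta cong: if_cong)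
    then show "f x = 0" using a0[OF xe(2)] xe(1) by simp
  qed
  have "?B \<subseteq> ?W"
  proof
    fix x assume "x \<in> ?B"
    then obtain F e where "x = facet_measure F e" "F \<in> ?I" by (auto simp: \<psi>_def)
    then have "x = ?s (\<lambda>G. if G = F then e else 0)" using single by simp
    then show "x \<in> ?W" unfolding W by (intro range_eqI[where x = "\<lambda>G. if G = F then e else 0"])
  qed
  moreover have "?W \<subseteq> span ?B"
  proof
    fix x assume "x \<in> ?W"
    then obtain a where x: "x = ?s a" unfolding W by auto
    have "facet_measure F (a F) = (\<Sum>e\<in>Basis. (a F \<bullet> e) *\<^sub>R \<psi> (F, e))" if "F \<in> ?I" for F
    proof -
      have "facet_measure F (\<Sum>e\<in>Basis. (a F \<bullet> e) *\<^sub>R e) = (\<Sum>e\<in>Basis. (a F \<bullet> e) *\<^sub>R \<psi> (F, e))"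
        using that by (simp add: facet_measure_sum facet_measure_scaleR \<psi>_def)
      then show ?thesis unfolding euclidean_representation .
    qed
    then have "x = (\<Sum>F\<in>?I. \<Sum>e\<in>Basis. (a F \<bullet> e) *\<^sub>R \<psi> (F, e))" using x by simp
    also have "\<dots> \<in> span ?B" by (intro span_sum span_scale span_base) auto
    finally show "x \<in> span ?B" .
  qed
  ultimately have "span ?B = ?W" using span_subspace[OF _ _ sub] by blast
  then have "span ?B = span ?W" using sub by (metis span_eq_iff)
  then have "dim ?W = card ?B" using ind by (rule dim_eq_card)
  also have "\<dots> = card ?I * DIM('a)" by (simp add: card_image[OF inj] card_cartesian_product)
  finally show "dim ?W = card ?I * DIM('a)" .
qed

end

theorem corollary1p8:
  fixes P :: "(real ^ 'n) set"
  assumes "polytope P"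
    and "full_dimensional P"
  shows "reversible_small_perturbations P =
           (\<Sum>F\<in>{F. F facet_of P}.
              convex_density_measures F \<inter> uminus ` convex_density_measures F)
         \<and> subspace (reversible_small_perturbations P)
         \<and> dim (reversible_small_perturbations P) = card {F. F facet_of P} * CARD('n)"
proof -
  obtain u c x0 where "polytope_facets u c P x0"
    by (rule polytope_facets_exists[OF assms])
  then interpret polytope_facets u c P x0 .
  show ?thesis using reversible_small_perturbations_polytope by simp
qed

end
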